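(* Let $d\ge2$, $1\le n\le d$ and $a\in(-1,\infty)^n$, and let $u\in H^{1,a}(B_1^* )$ be a weak solution to $$\begin{cases}-\operatorname{div}(\omega^a\nabla u)=0&\text{in }B_1^*,\\ \omega^a\partial_{y_i}u=0&\text{on }\partial B_1^*\cap\Sigma_i,\ i=1,\dots,n.\end{cases}$$ Then $u\in C^\infty(B_r^* )$ for every $r\in(0,1)$.
   Context: Coordinates are $z=(x,y)\in\mathbb R^{d-n}\times\mathbb R^n$. $\mathbb R^d_*=\{z: y_i>0,\ i=1,\dots,n\}$, $B_R$ is the open ball of radius $R$ centred at $0$ in $\mathbb R^d$, $B_R^*=B_R\cap\mathbb R^d_*$, $\Sigma_i=\{z:y_i=0\}$, $\omega^a(y)=\prod_{i=1}^n y_i^{a_i}$. $H^{1,a}(B_1^* )$ is the completion of $C^\infty(\overline{B_1^*})$ (restrictions of functions in $C^\infty(\mathbb R^d)$) with respect to $\|u\|^2=\int_{B_1^*}\omega^a(u^2+|\nabla u|^2)\,dz$. A weak solution is $u\in H^{1,a}(B_1^* )$ with $\int_{B_1^*}\omega^a\nabla u\cdot\nabla\phi\,dz=0$ for all $\phi\in C_c^\infty(B_1)$ (test functions need not vanish on the $\Sigma_i$). Here $C^\infty(B_r^* )$ means smoothness up to the boundary: $u$ has finite $C^{k,\alpha}$ norm on $B_r^*$ for every $k\in\mathbb N$ and $\alpha\in(0,1)$, so all derivatives extend continuously to $\overline{B_r^*}$. *)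

theory Defs
  imports "HOL-Analysis.Analysis"
begin

text \<open>Points of $R^d$ are \<open>z :: real^'d\<close>. The splitting $z = (x, y)$ is given by the set
  \<open>Y :: 'd set\<close> of those coordinate directions that are $y$-variables, so that $n$ is \<open>card Y\<close>;
  the case where all coordinates are $y$-variables ($n = d$) is \<open>Y = UNIV\<close>. Exponents are a function
  \<open>a :: 'd \<Rightarrow> real\<close> of which only the values on \<open>Y\<close> are used.\<close>

definition half_ball :: "'d::finite set \<Rightarrow> real \<Rightarrow> (real^'d) set" where
  "half_ball Y R = ball 0 R \<inter> {z. \<forall>i\<in>Y. 0 < z $ i}"

definition weight :: "'d::finite set \<Rightarrow> ('d \<Rightarrow> real) \<Rightarrow> real^'d \<Rightarrow> real" where
  "weight Y a z = (\<Prod>i\<in>Y. (z $ i) powr a i)"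

definition partial_deriv :: "'d::finite \<Rightarrow> (real^'d \<Rightarrow> real) \<Rightarrow> real^'d \<Rightarrow> real" where
  "partial_deriv i f z = frechet_derivative f (at z) (axis i 1)"

definition gradient :: "(real^'d::finite \<Rightarrow> real) \<Rightarrow> real^'d \<Rightarrow> real^'d" where
  "gradient f z = (\<chi> i. partial_deriv i f z)"

text \<open>\<open>C_k k U f\<close>: \<open>f\<close> is of class $C^k$ on \<open>U\<close>, for open \<open>U\<close>.\<close>

primrec C_k :: "nat \<Rightarrow> (real^'d::finite) set \<Rightarrow> (real^'d \<Rightarrow> real) \<Rightarrow> bool" where
  "C_k 0 U f \<longleftrightarrow> continuous_on U f"
| "C_k (Suc k) U f \<longleftrightarrow> (\<forall>z\<in>U. f differentiable (at z)) \<and> (\<forall>i. C_k k U (partial_deriv i f))"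

definition smooth :: "(real^'d::finite \<Rightarrow> real) \<Rightarrow> bool" where
  "smooth f \<longleftrightarrow> (\<forall>k. C_k k UNIV f)"

definition test_function :: "(real^'d::finite) set \<Rightarrow> (real^'d \<Rightarrow> real) \<Rightarrow> bool" where
  "test_function U \<phi> \<longleftrightarrow>
     smooth \<phi> \<and> compact (closure {z. \<phi> z \<noteq> 0}) \<and> closure {z. \<phi> z \<noteq> 0} \<subseteq> U"

text \<open>The square of the norm of the pair \<open>(u, G)\<close> in the product of $L^2(B_1^*, \omega^a)$ and
  $L^2(B_1^*, \omega^a)^d$; for a smooth \<open>u\<close> and \<open>G = gradient u\<close> it is $\|u\|^2$.\<close>

definition H1_norm_sq ::
  "'d::finite set \<Rightarrow> ('d \<Rightarrow> real) \<Rightarrow> (real^'d \<Rightarrow> real) \<Rightarrow> (real^'d \<Rightarrow> real^'d) \<Rightarrow> ennreal" where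
  "H1_norm_sq Y a u G =
     (\<integral>\<^sup>+ z. ennreal (weight Y a z * ((u z)\<^sup>2 + (norm (G z))\<^sup>2)) \<partial>lebesgue_on (half_ball Y 1))"

text \<open>The completion of the smooth functions is realised inside a complete space: \<open>\<phi>\<close> is sent
  isometrically to the pair \<open>(\<phi>, gradient \<phi>)\<close> of weighted $L^2$ functions, and the completion is the
  closure of the image. Thus \<open>H1 Y a u G\<close> says that \<open>(u, G)\<close> represents an element of $H^{1,a}(B_1^*)$
  whose gradient is \<open>G\<close>. As $\omega^a$ is locally bounded above and away from 0 in $B_1^*$,
  \<open>G\<close> is the distributional gradient of \<open>u\<close> there and is determined by \<open>u\<close> almost everywhere.\<close>

definition H1 ::
  "'d::finite set \<Rightarrow> ('d \<Rightarrow> real) \<Rightarrow> (real^'d \<Rightarrow> real) \<Rightarrow> (real^'d \<Rightarrow> real^'d) \<Rightarrow> bool" where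
  "H1 Y a u G \<longleftrightarrow>
     u \<in> borel_measurable (lebesgue_on (half_ball Y 1)) \<and>
     G \<in> borel_measurable (lebesgue_on (half_ball Y 1)) \<and>
     H1_norm_sq Y a u G < \<infinity> \<and>
     (\<exists>\<phi>. (\<forall>k. smooth (\<phi> k)) \<and>
        (\<lambda>k::nat. H1_norm_sq Y a (\<lambda>z. \<phi> k z - u z) (\<lambda>z. gradient (\<phi> k) z - G z)) \<longlonglongrightarrow> 0)"

text \<open>Weak solutions of $-\mathrm{div}(\omega^a \nabla u) = 0$ with the conormal conditions on the
  $\Sigma_i$. The conormal conditions are encoded by test functions supported in the full ball, which
  need not vanish on the $\Sigma_i$.\<close>

definition weak_solution :: "'d::finite set \<Rightarrow> ('d \<Rightarrow> real) \<Rightarrow> (real^'d \<Rightarrow> real) \<Rightarrow> bool" where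
  "weak_solution Y a u \<longleftrightarrow>
     (\<exists>G. H1 Y a u G \<and>
        (\<forall>\<phi>. test_function (ball 0 1) \<phi> \<longrightarrow>
           (\<integral> z. weight Y a z * (G z \<bullet> gradient \<phi> z) \<partial>lebesgue_on (half_ball Y 1)) = 0))"

text \<open>Iterated derivatives are indexed by lists of directions rather than by multi-indices. The order of
  the directions is immaterial for $C^k$ functions, so the norm below merely counts each mixed
  derivative with a positive integer multiplicity.\<close>

definition iter_deriv :: "'d::finite list \<Rightarrow> (real^'d \<Rightarrow> real) \<Rightarrow> real^'d \<Rightarrow> real" where
  "iter_deriv is f = foldr partial_deriv is f"

definition sup_norm_on :: "(real^'d::finite) set \<Rightarrow> (real^'d \<Rightarrow> real) \<Rightarrow> ennreal" where
  "sup_norm_on U f = (SUP z\<in>U. ennreal \<bar>f z\<bar>)"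

definition holder_seminorm :: "real \<Rightarrow> (real^'d::finite) set \<Rightarrow> (real^'d \<Rightarrow> real) \<Rightarrow> ennreal" where
  "holder_seminorm \<alpha> U f =
     (SUP (z, w)\<in>{(z, w). z \<in> U \<and> w \<in> U \<and> z \<noteq> w}. ennreal (\<bar>f z - f w\<bar> / dist z w powr \<alpha>))"

definition C_k_alpha_norm ::
  "nat \<Rightarrow> real \<Rightarrow> (real^'d::finite) set \<Rightarrow> (real^'d \<Rightarrow> real) \<Rightarrow> ennreal" where
  "C_k_alpha_norm k \<alpha> U f =
     (\<Sum>is | length is \<le> k. sup_norm_on U (iter_deriv is f)) +
     (\<Sum>is | length is = k. holder_seminorm \<alpha> U (iter_deriv is f))"

text \<open>$C^\infty(U)$ for open \<open>U\<close>, in the sense of smoothness up to the boundary.\<close>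

definition C_infinity :: "(real^'d::finite) set \<Rightarrow> (real^'d \<Rightarrow> real) set" where
  "C_infinity U =
     {f. \<forall>k \<alpha>. 0 < \<alpha> \<and> \<alpha> < 1 \<longrightarrow> C_k k U f \<and> C_k_alpha_norm k \<alpha> U f < \<infinity>}"

end

(* Weyl's lemma with the heat kernel of the operator L = \<omega>^{-1} div(\<omega> \<nabla>), which is the sum over the
   coordinates of the Bessel operators \<partial>_i^2 + (a_i/y_i) \<partial>_i (with a_i = 0 for the x-variables). Its Neumann heat
   kernel p_s(z,w) is the product of the one-dimensional kernels
     s^{-(a_i+1)/2} exp(-(y^2+\<eta>^2)/4s) E_i(y\<eta>/2s),   E'' + (a_i/t) E' = E,   E(0) = 1, E'(0) = 0
   (E = exp for the x-variables). It is symmetric and positive, its mass c is constant, it is entire and even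
   in each y_i, and all its derivatives are bounded by s^{-N} exp(-|z-w|^2/4s). For a radial cutoff \<zeta> the function
   \<zeta> p_s(z,.) is an admissible test function, and testing with it gives
     d/ds \<integral> u \<zeta> p_s(z,.) \<omega> dw = - \<integral> u R_s(z,.) \<omega> dw,
   where R_s = [L, \<zeta>] p_s lives where \<nabla>\<zeta> \<noteq> 0, that is, away from the points z with |z| < r. Letting s go to 0,
     c u(z) = \<integral> u \<zeta> p_1(z,.) \<omega> dw + \<integral>_0^1 \<integral> u R_s(z,.) \<omega> dw ds,
   whose right-hand side may be differentiated in z under the integral any number of times. *)

theory Submission
  imports Defs "HOL-Probability.Distributions" "HOL-Real_Asymp.Real_Asymp"
begin

subsection \<open>Smooth functions\<close>


text \<open>The obstacle is the boundary. At \<open>y_i = 0\<close> the weight blows up for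
  \<open>a_i < 0\<close> and degenerates for \<open>a_i > 0\<close>, several hyperplanes may meet at
  one point, and translation in \<open>y_i\<close> respects neither the weight nor the domain. But
  the operator is a sum of one-variable operators, and its kernel is an explicit product that is
  smooth across every hyperplane; corners cost nothing extra. The Neumann condition of the kernel at
  \<open>w_i = 0\<close> keeps the singular terms \<open>(a_i / w_i) \<partial>_i\<close> bounded on
  the test functions and removes the boundary terms. A radial cutoff preserves it, since its
  derivative in direction \<open>i\<close> contains the factor \<open>w_i\<close>. Once both
  derivatives sit on the test function, two properties of \<open>u\<close> suffice: integrability
  against the weight, and approximation by smooth functions in that L^1 norm. The approximation is
  what makes the limit in \<open>s\<close> possible: the kernel converges pointwise on continuous
  functions and acts boundedly on L^1. The time integral is harmless at \<open>s = 0\<close>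
  because, at distance at least \<open>\<rho>1 - r\<close>, the Gaussian beats every power of
  \<open>1 / s\<close>.\<close>

lemma differentiable_has_partials:
  fixes f :: "real^'d::finite \<Rightarrow> real"
  assumes "f differentiable (at z)"
  shows "(f has_derivative (\<lambda>h. \<Sum>i\<in>UNIV. h $ i * partial_deriv i f z)) (at z)"
proof -
  have D: "(f has_derivative frechet_derivative f (at z)) (at z)"
    using assms frechet_derivative_works by blast
  then have lin: "linear (frechet_derivative f (at z))"
    by (rule has_derivative_linear)
  have "frechet_derivative f (at z) h = (\<Sum>i\<in>UNIV. h $ i * partial_deriv i f z)" for h
  proof -
    have "h = (\<Sum>i\<in>UNIV. h $ i *\<^sub>R axis i 1)"
      by (simp add: basis_expansion scalar_mult_eq_scaleR flip: scalar_mult_eq_scaleR)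
    then have "frechet_derivative f (at z) h = frechet_derivative f (at z) (\<Sum>i\<in>UNIV. h $ i *\<^sub>R axis i 1)"
      by simp
    also have "\<dots> = (\<Sum>i\<in>UNIV. h $ i * partial_deriv i f z)"
      by (simp add: linear_sum[OF lin] linear_scale[OF lin] partial_deriv_def)
    finally show ?thesis .
  qed
  then have "frechet_derivative f (at z) = (\<lambda>h. \<Sum>i\<in>UNIV. h $ i * partial_deriv i f z)" by (rule ext)
  then show ?thesis using D by (simp only:)
qed

lemma sum_axis_mult: "(\<Sum>i\<in>UNIV. axis k (1::real) $ i * f i) = f (k::'d::finite)"
  by (simp add: axis_def if_distrib[of "\<lambda>x. x * _"] cong: if_cong)

lemma partial_deriv_eqI:
  fixes f :: "real^'d::finite \<Rightarrow> real"
  assumes "(f has_derivative (\<lambda>h. \<Sum>i\<in>UNIV. h $ i * f' i)) (at z)"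
  shows "partial_deriv k f z = f' k"
  unfolding partial_deriv_def frechet_derivative_at[OF assms, symmetric] by (rule sum_axis_mult)

lemma has_derivative_coord: "((\<lambda>w :: real^'d::finite. w $ i) has_derivative (\<lambda>h. h $ i)) (at w)"
  using bounded_linear.has_derivative[OF bounded_linear_vec_nth[of i] has_derivative_ident] .

lemma has_partials_coord:
  "((\<lambda>z::real^'d::finite. z $ j) has_derivative (\<lambda>h. \<Sum>i\<in>UNIV. h $ i * (if i = j then 1 else 0))) (at z)"
  using has_derivative_coord by (simp add: if_distrib[of "\<lambda>x. _ * x"] cong: if_cong)

lemma has_partials_add:
  fixes f g :: "real^'d::finite \<Rightarrow> real"
  assumes "f differentiable (at z)" "g differentiable (at z)"
  shows "((\<lambda>z. f z + g z) has_derivative (\<lambda>h. \<Sum>i\<in>UNIV. h $ i * (partial_deriv i f z + partial_deriv i g z))) (at z)"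
  using has_derivative_add[OF differentiable_has_partials[OF assms(1)] differentiable_has_partials[OF assms(2)]]
  by (simp add: distrib_left sum.distrib)

lemma has_partials_mult:
  fixes f g :: "real^'d::finite \<Rightarrow> real"
  assumes "f differentiable (at z)" "g differentiable (at z)"
  shows "((\<lambda>z. f z * g z) has_derivative (\<lambda>h. \<Sum>i\<in>UNIV. h $ i * (f z * partial_deriv i g z + partial_deriv i f z * g z))) (at z)"
  using has_derivative_mult[OF differentiable_has_partials[OF assms(1)] differentiable_has_partials[OF assms(2)]]
  by (simp add: distrib_left sum.distrib sum_distrib_left sum_distrib_right mult.assoc mult.left_commute)

lemmas partial_deriv_coord = partial_deriv_eqI[OF has_partials_coord]
lemmas partial_deriv_add = partial_deriv_eqI[OF has_partials_add]
lemmas partial_deriv_mult = partial_deriv_eqI[OF has_partials_mult]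

lemma partial_deriv_zero_outside:
  fixes f :: "real^'d::finite \<Rightarrow> real"
  assumes "\<And>w. \<rho> < norm w \<Longrightarrow> f w = 0" "\<rho> < norm w"
  shows "partial_deriv i f w = 0"
proof -
  have "(f has_derivative (\<lambda>h. 0)) (at w)"
    by (rule has_derivative_transform_within_open[OF has_derivative_const, of "- cball 0 \<rho>"]) (use assms in auto)
  then show ?thesis by (intro partial_deriv_eqI[where f'="\<lambda>i. 0"]) simp
qed

lemma has_real_derivative_along_axis:
  fixes f :: "real^'d::finite \<Rightarrow> real"
  assumes "f differentiable (at (z + t *\<^sub>R axis k 1))"
  shows "((\<lambda>t. f (z + t *\<^sub>R axis k 1)) has_real_derivative partial_deriv k f (z + t *\<^sub>R axis k 1)) (at t)"
proof -
  have "((\<lambda>t. f (z + t *\<^sub>R axis k 1)) has_derivative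
      (\<lambda>x. \<Sum>i\<in>UNIV. (x *\<^sub>R axis k 1 :: real^'d) $ i * partial_deriv i f (z + t *\<^sub>R axis k 1))) (at t)"
    by (rule has_derivative_compose[where f="\<lambda>t. z + t *\<^sub>R axis k 1" and g=f,
          OF _ differentiable_has_partials[OF assms]])
       (auto intro!: derivative_eq_intros)
  moreover have "(\<Sum>i\<in>UNIV. (x *\<^sub>R axis k 1 :: real^'d) $ i * g i) = g k * x" for x g
    using sum_axis_mult[of k "\<lambda>i. g i * x"] by (simp add: mult_ac)
  ultimately show ?thesis
    unfolding has_field_derivative_def by simp
qed

text \<open>Since \<open>C_k\<close> quantifies over all partial derivatives, products and
  compositions are awkward to treat with it directly. This syntactic class is closed under
  \<open>partial_deriv\<close> by one rule induction. The rule \<open>comp\<close> takes the outer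
  function together with all its derivatives \<open>D m\<close>, so that differentiating merely
  shifts \<open>D\<close>.\<close>

inductive elem_smooth :: "(real^'d::finite \<Rightarrow> real) \<Rightarrow> bool" where
  const: "elem_smooth (\<lambda>z. c)"
| coord: "elem_smooth (\<lambda>z. z $ i)"
| add: "elem_smooth f \<Longrightarrow> elem_smooth g \<Longrightarrow> elem_smooth (\<lambda>z. f z + g z)"
| mult: "elem_smooth f \<Longrightarrow> elem_smooth g \<Longrightarrow> elem_smooth (\<lambda>z. f z * g z)"
| comp: "(\<And>m t. (D m has_real_derivative D (Suc m) t) (at t)) \<Longrightarrow> elem_smooth f \<Longrightarrow>
    elem_smooth (\<lambda>z. D (0::nat) (f z))"

lemma elem_smooth_deriv:
  assumes "elem_smooth f"
  shows "(\<forall>z. f differentiable (at z)) \<and> (\<forall>i. elem_smooth (partial_deriv i f))"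
  using assms
proof (induction rule: elem_smooth.induct)
  case (const c)
  have "partial_deriv i (\<lambda>z. c) = (\<lambda>z. 0)" for i :: 'a
    by (auto simp: partial_deriv_def frechet_derivative_const)
  then show ?case using elem_smooth.const by auto
next
  case (coord j)
  have "partial_deriv i (\<lambda>z. z $ j) = (\<lambda>z. if i = j then 1 else 0)" for i :: 'a
    by (simp add: fun_eq_iff partial_deriv_coord)
  then show ?case using has_partials_coord elem_smooth.const by (auto simp: differentiable_def)
next
  case (add f g)
  have "partial_deriv i (\<lambda>z. f z + g z) = (\<lambda>z. partial_deriv i f z + partial_deriv i g z)" for i
    using partial_deriv_add add by blast
  moreover have "elem_smooth (\<lambda>z. partial_deriv i f z + partial_deriv i g z)" for i
    using add by (intro elem_smooth.add) auto
  ultimately show ?case using add by auto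
next
  case (mult f g)
  have "partial_deriv i (\<lambda>z. f z * g z) = (\<lambda>z. f z * partial_deriv i g z + partial_deriv i f z * g z)" for i
    using partial_deriv_mult mult by blast
  moreover have "elem_smooth (\<lambda>z. f z * partial_deriv i g z + partial_deriv i f z * g z)" for i
    using mult by (intro elem_smooth.add elem_smooth.mult) auto
  ultimately show ?case using mult by auto
next
  case (comp D f)
  have D: "((\<lambda>z. D 0 (f z)) has_derivative (\<lambda>h. \<Sum>i\<in>UNIV. h $ i * (D 1 (f z) * partial_deriv i f z))) (at z)" for z
  proof -
    have "(f has_derivative (\<lambda>h. \<Sum>i\<in>UNIV. h $ i * partial_deriv i f z)) (at z)"
      using comp differentiable_has_partials by blast
    moreover have "(D 0 has_derivative (*) (D 1 (f z))) (at (f z))"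
      using comp(1)[of 0 "f z"] unfolding has_field_derivative_def by simp
    ultimately show ?thesis
      using has_derivative_compose[where f=f and g="D 0"]
      by (fastforce simp: sum_distrib_left mult.left_commute)
  qed
  have "partial_deriv i (\<lambda>z. D 0 (f z)) = (\<lambda>z. D 1 (f z) * partial_deriv i f z)" for i
    using partial_deriv_eqI[OF D] by auto
  moreover have "elem_smooth (\<lambda>z. D 1 (f z))"
    using elem_smooth.comp[of "\<lambda>m. D (Suc m)" f] comp by simp
  ultimately have "elem_smooth (partial_deriv i (\<lambda>z. D 0 (f z)))" for i
    using comp elem_smooth.mult[of "\<lambda>z. D 1 (f z)" "partial_deriv i f"] by simp
  then show ?case using D by (auto simp: differentiable_def)
qed

lemma elem_smooth_differentiable: "elem_smooth f \<Longrightarrow> f differentiable (at z)"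
  and elem_smooth_partial: "elem_smooth f \<Longrightarrow> elem_smooth (partial_deriv i f)"
  using elem_smooth_deriv by auto

lemma elem_smooth_continuous: "elem_smooth f \<Longrightarrow> continuous_on S f"
  by (meson continuous_at_imp_continuous_on differentiable_imp_continuous_within elem_smooth_differentiable)

lemma elem_smooth_imp_smooth: "elem_smooth f \<Longrightarrow> smooth f"
proof -
  have "elem_smooth f \<Longrightarrow> C_k k UNIV f" for k
    by (induction k arbitrary: f)
       (auto simp: elem_smooth_continuous elem_smooth_differentiable elem_smooth_partial)
  then show "elem_smooth f \<Longrightarrow> smooth f" by (simp add: smooth_def)
qed

lemma elem_smooth_prod: "finite I \<Longrightarrow> (\<And>i. i \<in> I \<Longrightarrow> elem_smooth (f i)) \<Longrightarrow> elem_smooth (\<lambda>z. \<Prod>i\<in>I. f i z)"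
  by (induction rule: finite_induct) (auto intro: elem_smooth.intros)

lemma elem_smooth_sum: "finite I \<Longrightarrow> (\<And>i. i \<in> I \<Longrightarrow> elem_smooth (f i)) \<Longrightarrow> elem_smooth (\<lambda>z. \<Sum>i\<in>I. f i z)"
  by (induction rule: finite_induct) (auto intro: elem_smooth.intros)

lemma smooth_differentiable: "smooth f \<Longrightarrow> f differentiable (at z)"
  unfolding smooth_def using C_k.simps(2) by blast

lemma smooth_continuous_partial: "smooth f \<Longrightarrow> continuous_on UNIV (partial_deriv i f)"
  unfolding smooth_def using C_k.simps by blast

lemma smooth_continuous: "smooth f \<Longrightarrow> continuous_on S f"
  by (meson continuous_at_imp_continuous_on differentiable_imp_continuous_within smooth_differentiable)

section \<open>Flat functions and the radial cutoff\<close>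

definition flat_fun :: "real poly \<Rightarrow> real \<Rightarrow> real" where
  "flat_fun p t = (if t \<le> 0 then 0 else poly p (1 / t) * exp (- (1 / t)))"

text \<open>As \<open>1 / t\<close> has derivative \<open>- 1 / t^2\<close>, differentiating
  \<open>p (1 / t) * exp (- 1 / t)\<close> replaces the polynomial p by X^2 (p - p'). Thus all
  derivatives of \<open>exp (- 1 / t)\<close> stay in the family \<open>flat_fun\<close>.\<close>

definition flat_deriv :: "real poly \<Rightarrow> real poly" where
  "flat_deriv p = [:0, 0, 1:] * (p - pderiv p)"

lemma flat_fun_tendsto_0: "((\<lambda>t::real. poly p (1 / t) * exp (- (1 / t))) \<longlongrightarrow> 0) (at_right 0)"
proof -
  have *: "((\<lambda>x. poly p x * exp (- x)) \<longlongrightarrow> 0) at_top"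
  proof (induction p)
    case (pCons a p)
    have "((\<lambda>x. poly q x * exp (- x)) \<longlongrightarrow> 0) at_top" if "q = monom c n" for q and c :: real and n :: nat
      using tendsto_mult_right_zero[OF tendsto_power_div_exp_0[of n], of c] that
      by (simp add: poly_monom exp_minus divide_inverse mult.assoc)
    note mono = this
    show ?case
    proof -
      have "poly (pCons a p) = (\<lambda>x. \<Sum>i\<le>degree (pCons a p). coeff (pCons a p) i * x ^ i)"
        by (rule ext) (simp only: poly_altdef)
      moreover have "((\<lambda>x. \<Sum>i\<le>n. coeff (pCons a p) i * x ^ i * exp (- x)) \<longlongrightarrow> 0) at_top" for n
      proof (rule tendsto_null_sum)
        fix i
        show "((\<lambda>x. coeff (pCons a p) i * x ^ i * exp (- x)) \<longlongrightarrow> 0) at_top"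
          using mono[OF refl, of "coeff (pCons a p) i" i] unfolding poly_monom .
      qed
      ultimately show ?thesis by (simp add: sum_distrib_right)
    qed
  qed auto
  have "filterlim (\<lambda>t::real. 1 / t) at_top (at_right 0)"
    using filterlim_inverse_at_top_right by (simp add: inverse_eq_divide)
  from filterlim_compose[OF * this] show ?thesis .
qed

lemma flat_fun_has_derivative: "(flat_fun p has_real_derivative flat_fun (flat_deriv p) t) (at t)"
proof -
  consider "t < 0" | "t = 0" | "t > 0" by linarith
  then show ?thesis
  proof cases
    case 1
    have "((\<lambda>t. 0) has_real_derivative 0) (at t)" by simp
    moreover have "\<forall>\<^sub>F x in nhds t. flat_fun p x = 0"
      using eventually_nhds_in_open[of "{..<0}" t] 1 by (auto simp: flat_fun_def elim!: eventually_mono)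
    ultimately show ?thesis using 1
      by (subst DERIV_cong_ev[OF refl _ refl, where g="\<lambda>t. 0"]) (auto simp: flat_fun_def)
  next
    case 3
    have "((\<lambda>t. poly p (1 / t) * exp (- (1 / t))) has_real_derivative flat_fun (flat_deriv p) t) (at t)"
      using 3 by (auto intro!: derivative_eq_intros DERIV_chain'[OF _ poly_DERIV]
         simp: flat_fun_def flat_deriv_def field_simps power2_eq_square)
    moreover have "\<forall>\<^sub>F x in nhds t. flat_fun p x = poly p (1 / x) * exp (- (1 / x))"
      using eventually_nhds_in_open[of "{0<..}" t] 3 by (auto simp: flat_fun_def elim!: eventually_mono)
    ultimately show ?thesis
      by (subst DERIV_cong_ev[OF refl _ refl]) auto
  next
    case 2
    have R: "((\<lambda>h. flat_fun p h / h) \<longlongrightarrow> 0) (at_right 0)"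
    proof (rule Lim_transform_eventually)
      \<comment> \<open>Dividing by \<open>t\<close> multiplies the polynomial by X, so the
        difference quotient at 0 is again of flat type.\<close>
      show "((\<lambda>t. poly ([:0, 1:] * p) (1 / t) * exp (- (1 / t))) \<longlongrightarrow> 0) (at_right 0)"
        by (rule flat_fun_tendsto_0)
      show "\<forall>\<^sub>F t in at_right 0. poly ([:0, 1:] * p) (1 / t) * exp (- (1 / t)) = flat_fun p t / t"
        by (auto simp: eventually_at_right_field flat_fun_def intro!: exI[of _ 1])
    qed
    have L: "((\<lambda>h. flat_fun p h / h) \<longlongrightarrow> 0) (at_left 0)"
      by (rule Lim_transform_eventually[OF tendsto_const])
         (auto simp: eventually_at_left_field flat_fun_def intro!: exI[of _ "-1"])
    have "((\<lambda>h. flat_fun p h / h) \<longlongrightarrow> 0) (at 0)"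
      using L R filterlim_split_at by blast
    then show ?thesis using 2 by (simp add: DERIV_def flat_fun_def)
  qed
qed

lemma elem_smooth_flat: "elem_smooth f \<Longrightarrow> elem_smooth (\<lambda>z. flat_fun p (f z))"
  using elem_smooth.comp[of "\<lambda>m. flat_fun ((flat_deriv ^^ m) p)" f]
  by (simp add: flat_fun_has_derivative)


lemma flat_fun_1_less: "0 < t \<Longrightarrow> s < t \<Longrightarrow> flat_fun 1 s < flat_fun 1 t"
  by (auto simp: flat_fun_def field_simps)

lemma flat_fun_1_mono: "s \<le> t \<Longrightarrow> flat_fun 1 s \<le> flat_fun 1 t"
  by (cases "s = t"; cases "0 < t") (auto simp: flat_fun_1_less less_imp_le, auto simp: flat_fun_def)

lemma flat_fun_nonpos: "t \<le> 0 \<Longrightarrow> flat_fun p t = 0"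
  by (simp add: flat_fun_def)

lemma norm_sq_vec: "(norm w)\<^sup>2 = (\<Sum>i\<in>UNIV. (w $ i)\<^sup>2)" for w :: "real^'d::finite"
  by (simp add: norm_vec_def L2_set_def sum_nonneg)

lemma has_derivative_norm_sq:
  "((\<lambda>w. (norm w)\<^sup>2) has_derivative (\<lambda>h. \<Sum>i\<in>UNIV. h $ i * (2 * w $ i))) (at w)" for w :: "real^'d::finite"
  unfolding norm_sq_vec by (auto intro!: derivative_eq_intros has_derivative_coord sum.cong simp: mult_ac)

lemma elem_smooth_norm_sq: "elem_smooth (\<lambda>w::real^'d::finite. (norm w)\<^sup>2)"
  unfolding norm_sq_vec unfolding power2_eq_square
  by (intro elem_smooth_sum elem_smooth.mult elem_smooth.coord finite)

lemma elem_smooth_diff: "elem_smooth f \<Longrightarrow> elem_smooth g \<Longrightarrow> elem_smooth (\<lambda>z. f z - g z)"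
  using elem_smooth.add[OF _ elem_smooth.mult[OF elem_smooth.const[of "-1"]], of f g] by simp

text \<open>The radial cutoff is \<open>\<theta>(|w|\<^sup>2)\<close> with \<open>\<theta>(t) = f(f(c) - f(t - \<rho>\<^sub>1\<^sup>2))\<close> up to a constant, where \<open>f\<close> is the flat
  function \<open>exp (-1/t)\<close>; being radial, it satisfies the Neumann condition on every \<open>\<Sigma>\<^sub>i\<close>.\<close>

lemma radial_cutoff:
  assumes "0 < \<rho>1" "\<rho>1 < \<rho>2"
  obtains \<zeta> m :: "real^'d::finite \<Rightarrow> real" where
    "elem_smooth \<zeta>" "elem_smooth m" "\<And>i w. partial_deriv i \<zeta> w = w $ i * m w"
    "\<And>w. norm w \<le> \<rho>1 \<Longrightarrow> \<zeta> w = 1" "\<And>w. \<rho>2 \<le> norm w \<Longrightarrow> \<zeta> w = 0"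
    "\<And>w. norm w \<le> \<rho>1 \<Longrightarrow> m w = 0"
proof -
  \<comment> \<open>With this value the outer argument reaches 0 exactly at
    \<open>norm w = \<rho>2\<close>; dividing by \<open>K\<close>, the value of the outer function
    at \<open>c\<close>, makes the cutoff equal to 1 inside.\<close>
  define c where "c = flat_fun 1 (\<rho>2\<^sup>2 - \<rho>1\<^sup>2)"
  have pos: "0 < \<rho>2\<^sup>2 - \<rho>1\<^sup>2" using assms by (simp add: power_strict_mono)
  have c: "0 < c" unfolding c_def using pos by (simp add: flat_fun_def)
  define K where "K = flat_fun 1 c"
  have K: "0 < K" using c by (simp add: K_def flat_fun_def)
  define \<zeta> where "\<zeta> = (\<lambda>w::real^'d. 1 / K * flat_fun 1 (c - flat_fun 1 ((norm w)\<^sup>2 - \<rho>1\<^sup>2)))"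
  \<comment> \<open>What remains of the gradient of \<open>\<zeta>\<close> after splitting off
    \<open>w $ i\<close>: the 2 comes from the derivative of the squared norm, the sign from the
    inner difference \<open>c - ...\<close>.\<close>
  define m where "m = (\<lambda>w::real^'d. (-2 / K) * (flat_fun (flat_deriv 1) (c - flat_fun 1 ((norm w)\<^sup>2 - \<rho>1\<^sup>2)) *
      flat_fun (flat_deriv 1) ((norm w)\<^sup>2 - \<rho>1\<^sup>2)))"
  have D: "(\<zeta> has_derivative (\<lambda>h. \<Sum>i\<in>UNIV. h $ i * (w $ i * m w))) (at w)" for w
  proof -
    have F: "((\<lambda>w. flat_fun p (g w)) has_derivative (\<lambda>h. flat_fun (flat_deriv p) (g w) * g' h)) (at w)"
      if "(g has_derivative g') (at w)" for p g g'
      using has_derivative_compose[OF that flat_fun_has_derivative[of p "g w", unfolded has_field_derivative_def]] .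
    note d1 = has_derivative_diff[OF has_derivative_norm_sq[of w] has_derivative_const[of "\<rho>1\<^sup>2"]]
    note d2 = F[OF has_derivative_diff[OF has_derivative_const[of c] F[OF d1, of 1]], of 1]
    show ?thesis unfolding \<zeta>_def
      by (rule has_derivative_eq_rhs[OF has_derivative_mult_right[OF d2]])
         (simp add: fun_eq_iff m_def sum_distrib_left sum_distrib_right sum_divide_distrib mult_ac sum_negf)
  qed
  show ?thesis
  proof (rule that[of \<zeta> m])
    show "elem_smooth \<zeta>" "elem_smooth m" unfolding \<zeta>_def m_def
      by (intro elem_smooth.mult elem_smooth.const elem_smooth_flat elem_smooth_diff elem_smooth_norm_sq)+
    show "partial_deriv i \<zeta> w = w $ i * m w" for i w
      by (rule partial_deriv_eqI[OF D])
    fix w :: "real^'d"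
    show "\<zeta> w = 1" "m w = 0" if "norm w \<le> \<rho>1"
    proof -
      have "(norm w)\<^sup>2 - \<rho>1\<^sup>2 \<le> 0" using that by (simp add: power_mono)
      then show "\<zeta> w = 1" "m w = 0"
        using K by (simp_all add: \<zeta>_def m_def flat_fun_nonpos K_def)
    qed
    show "\<zeta> w = 0" if "\<rho>2 \<le> norm w"
    proof -
      have "\<rho>2\<^sup>2 - \<rho>1\<^sup>2 \<le> (norm w)\<^sup>2 - \<rho>1\<^sup>2" using that assms by (simp add: power_mono)
      then have "c \<le> flat_fun 1 ((norm w)\<^sup>2 - \<rho>1\<^sup>2)" unfolding c_def by (rule flat_fun_1_mono)
      then show ?thesis by (simp add: \<zeta>_def flat_fun_nonpos)
    qed
  qed
qed

subsection \<open>The one-dimensional Bessel heat kernel\<close>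


text \<open>Power series of the even solution \<open>E\<close> of \<open>E'' + (al/t) E' = E\<close>, \<open>E(0) = 1\<close>.\<close>

fun bcoef :: "real \<Rightarrow> nat \<Rightarrow> real" where
  "bcoef al 0 = 1"
| "bcoef al (Suc 0) = 0"
| "bcoef al (Suc (Suc n)) = bcoef al n / ((real n + 2) * (real n + 1 + al))"

text \<open>\<open>bexp h al k\<close> is the \<open>k\<close>-th derivative of the generalised exponential of a coordinate: the
  Bessel-type series above for a \<open>y\<close>-variable (\<open>h\<close> true), and \<open>exp\<close> for an \<open>x\<close>-variable.\<close>

definition bexp :: "bool \<Rightarrow> real \<Rightarrow> nat \<Rightarrow> real \<Rightarrow> real" where
  "bexp h al k t = (if h then \<Sum>n. (diffs ^^ k) (bcoef al) n * t ^ n else exp t)"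

definition heat1 :: "bool \<Rightarrow> real \<Rightarrow> real \<Rightarrow> real \<Rightarrow> real \<Rightarrow> real" where
  "heat1 h al s y \<eta> = s powr (- ((al + 1) / 2)) * exp (- (y\<^sup>2 + \<eta>\<^sup>2) / (4 * s)) * bexp h al 0 (y * \<eta> / (2 * s))"

text \<open>The generators are the heat kernel with \<open>bexp\<close> differentiated
  \<open>k\<close> times and with monomials in \<open>y\<close>, \<open>\<eta>\<close> and
  \<open>1 / s\<close> in front. Their span is stable under differentiation, so a Gaussian bound
  proved on generators holds for every derivative that occurs.\<close>

inductive kerfun :: "bool \<Rightarrow> real \<Rightarrow> (real \<Rightarrow> real \<Rightarrow> real \<Rightarrow> real) \<Rightarrow> bool" for h al where
  gen: "kerfun h al (\<lambda>s y \<eta>. y ^ i * \<eta> ^ j * (1 / s) ^ l * (s powr (- ((al + 1) / 2)) *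
          exp (- (y\<^sup>2 + \<eta>\<^sup>2) / (4 * s)) * bexp h al k (y * \<eta> / (2 * s))))"
| scale: "kerfun h al f \<Longrightarrow> kerfun h al (\<lambda>s y \<eta>. c * f s y \<eta>)"
| add: "kerfun h al f \<Longrightarrow> kerfun h al g \<Longrightarrow> kerfun h al (\<lambda>s y \<eta>. f s y \<eta> + g s y \<eta>)"

lemma diffs_funpow: "(diffs ^^ k) (c :: nat \<Rightarrow> real) n = fact (n + k) / fact n * c (n + k)"
proof (induction k arbitrary: n)
  case (Suc k)
  have "(diffs ^^ Suc k) c n = real (Suc n) * (diffs ^^ k) c (Suc n)"
    by (simp only: funpow.simps o_apply diffs_def[of "(diffs ^^ k) c"])
  also have "\<dots> = real (Suc n) * (fact (Suc n + k) / fact (Suc n) * c (Suc n + k))"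
    by (simp only: Suc)
  also have "\<dots> = fact (n + Suc k) / fact n * c (n + Suc k)"
    by (simp only: fact_Suc[of n] add_Suc add_Suc_right) (simp del: fact_Suc of_nat_Suc)
  finally show ?case .
qed simp

text \<open>Up to a constant, the coefficients \<open>(n + c) / n!\<close> majorise those of the
  Bessel series and of its derivatives; this evaluates the majorant.\<close>

lemma exp_poly_sums:
  "(\<lambda>n. (real n + c) / fact n * x ^ n) sums ((x + c) * exp x)" for x :: real
proof -
  have e: "(\<lambda>n. x ^ n / fact n) sums exp x"
    using exp_converges[of x] by (simp add: divide_inverse mult.commute)
  have "(\<lambda>n. real (Suc n) / fact (Suc n) * x ^ Suc n) sums (x * exp x)"
  proof -
    have "real (Suc n) / fact (Suc n) * x ^ Suc n = x * (x ^ n / fact n)" for n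
      by (simp add: field_simps del: of_nat_Suc)
    then show ?thesis using sums_mult[OF e, of x] by simp
  qed
  then have "(\<lambda>n. real n / fact n * x ^ n) sums (x * exp x)"
    by (subst (asm) sums_Suc_iff) simp
  from sums_add[OF this sums_mult[OF e, of c]] show ?thesis
    by (simp add: field_simps)
qed

text \<open>\<open>h\<close> marks a \<open>y\<close>-variable. Admitting \<open>\<not> h\<close>
  with \<open>al = 0\<close> lets the same lemmas serve the \<open>x\<close>-variables, which range
  over the whole line and carry the ordinary heat kernel.\<close>

locale bessel1 =
  fixes h :: bool and al :: real
  assumes al: "-1 < al" and flat: "\<not> h \<Longrightarrow> al = 0"
begin

text \<open>Half the effective dimension \<open>al + 1\<close> of the weight: the power of
  \<open>s\<close> in the kernel and the argument of Gamma in its mass.\<close>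

definition b :: real where "b = (al + 1) / 2"
text \<open>The 1 covers the coefficient at 0; \<open>1 / (1 + al)\<close> covers the first step of
  the recursion, whose denominator \<open>2 * (1 + al)\<close> is small when \<open>al\<close> is
  near -1.\<close>

definition C0 :: real where "C0 = 1 + 1 / (1 + al)"

lemma b_pos: "0 < b" using al by (simp add: b_def)

lemma C0_pos: "0 < C0" using al by (simp add: C0_def add_pos_pos)

lemma bcoef_nonneg: "0 \<le> bcoef al n"
  by (induction n rule: induct_nat_012) (use al in \<open>auto intro!: divide_nonneg_nonneg mult_nonneg_nonneg\<close>)

lemma bcoef_odd: "odd n \<Longrightarrow> bcoef al n = 0"
  by (induction al n rule: bcoef.induct) auto

lemma bcoef_bound: "bcoef al n \<le> C0 * (real n + 1) / fact n"
proof (induction n rule: induct_nat_012)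
  case 0
  then show ?case using al by (simp add: C0_def)
next
  case 1
  then show ?case using C0_pos by simp
next
  case (ge2 n)
  have p: "0 < real n + 1 + al" using al by linarith
  show ?case
  proof (cases "n = 0")
    case True
    then show ?thesis using al by (simp add: C0_def field_simps)
  next
    case False
    then have n: "1 \<le> real n" by simp
    \<comment> \<open>One step of the recursion gains \<open>(n + 3) / (n + 1)\<close> from the
      linear factor, which pays for \<open>(n + 1) / (n + 1 + al)\<close> when
      \<open>n \<ge> 1\<close>. At \<open>n = 0\<close> this fails for \<open>al\<close> near -1,
      and \<open>C0\<close> takes over.\<close>
    have le: "(real n + 1) * (real n + 1) \<le> (real n + 3) * (real n + 1 + al)"
    proof -
      have "(real n + 1) * (real n + 1) \<le> (real n + 3) * real n" using n by (simp add: algebra_simps)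
      also have "\<dots> \<le> (real n + 3) * (real n + 1 + al)" using al by (intro mult_left_mono) auto
      finally show ?thesis .
    qed
    have "bcoef al (Suc (Suc n)) \<le> (C0 * (real n + 1) / fact n) / ((real n + 2) * (real n + 1 + al))"
      unfolding bcoef.simps using p by (intro divide_right_mono ge2(1) mult_nonneg_nonneg) auto
    also have "\<dots> \<le> C0 * (real n + 3) / ((real n + 2) * (real n + 1) * fact n)"
    proof -
      have "(real n + 1) / (real n + 1 + al) \<le> (real n + 3) / (real n + 1)"
        using le p by (simp add: divide_simps)
      then have "(C0 / (fact n * (real n + 2))) * ((real n + 1) / (real n + 1 + al)) \<le> (C0 / (fact n * (real n + 2))) * ((real n + 3) / (real n + 1))"
        using C0_pos by (intro mult_left_mono) auto
      then show ?thesis by (simp add: mult_ac)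
    qed
    also have "\<dots> = C0 * (real (Suc (Suc n)) + 1) / fact (Suc (Suc n))"
      by (simp add: algebra_simps)
    finally show ?thesis .
  qed
qed

lemma diffs_bcoef_bound: "\<bar>(diffs ^^ k) (bcoef al) n * t ^ n\<bar> \<le> C0 * ((real n + (real k + 1)) / fact n * \<bar>t\<bar> ^ n)"
proof -
  have "(diffs ^^ k) (bcoef al) n \<le> fact (n + k) / fact n * (C0 * (real (n + k) + 1) / fact (n + k))"
    unfolding diffs_funpow by (intro mult_left_mono bcoef_bound) auto
  also have "\<dots> = C0 * ((real n + (real k + 1)) / fact n)" by (simp add: field_simps)
  finally have "(diffs ^^ k) (bcoef al) n \<le> C0 * ((real n + (real k + 1)) / fact n)" .
  moreover have "0 \<le> (diffs ^^ k) (bcoef al) n" unfolding diffs_funpow by (simp add: bcoef_nonneg)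
  ultimately have "\<bar>(diffs ^^ k) (bcoef al) n\<bar> * \<bar>t\<bar> ^ n \<le> C0 * ((real n + (real k + 1)) / fact n) * \<bar>t\<bar> ^ n"
    by (intro mult_right_mono) auto
  then show ?thesis by (simp only: abs_mult power_abs mult.assoc)
qed

lemma diffs_bcoef_summable: "summable (\<lambda>n. (diffs ^^ k) (bcoef al) n * t ^ n)"
  by (rule summable_comparison_test'[OF summable_mult[OF sums_summable[OF exp_poly_sums]]])
     (use diffs_bcoef_bound in simp)

lemma bexp_deriv: "(bexp h al k has_real_derivative bexp h al (Suc k) t) (at t)"
proof (cases h)
  case True
  have "((\<lambda>t. \<Sum>n. (diffs ^^ k) (bcoef al) n * t ^ n) has_real_derivative (\<Sum>n. diffs ((diffs ^^ k) (bcoef al)) n * t ^ n)) (at t)"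
    by (rule termdiffs_strong_converges_everywhere[OF diffs_bcoef_summable])
  then show ?thesis using True by (simp add: bexp_def[abs_def])
qed (simp add: bexp_def[abs_def] DERIV_exp)

text \<open>The exponent has to be \<open>t\<close> and not its absolute value, because it must
  combine with the Gaussian in \<open>y\<^sup>2 + \<eta>\<^sup>2\<close> to one in
  \<open>y - \<eta>\<close>. For a \<open>y\<close>-variable the function is even and grows on both
  sides, hence the sign condition.\<close>

lemma bexp_bound:
  assumes "h \<Longrightarrow> 0 \<le> t"
  shows "\<bar>bexp h al k t\<bar> \<le> (1 + C0) * (real k + 1) * (1 + \<bar>t\<bar>) * exp t"
proof (cases h)
  case True
  have S: "(\<lambda>n. C0 * ((real n + (real k + 1)) / fact n * \<bar>t\<bar> ^ n)) sums (C0 * ((\<bar>t\<bar> + (real k + 1)) * exp \<bar>t\<bar>))"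
    by (intro sums_mult exp_poly_sums)
  have su: "summable (\<lambda>n. norm ((diffs ^^ k) (bcoef al) n * t ^ n))"
    by (rule summable_comparison_test'[OF sums_summable[OF S]]) (use diffs_bcoef_bound in simp)
  have "\<bar>bexp h al k t\<bar> \<le> (\<Sum>n. norm ((diffs ^^ k) (bcoef al) n * t ^ n))"
    using summable_norm[OF su] True by (simp add: bexp_def)
  also have "\<dots> \<le> (\<Sum>n. C0 * ((real n + (real k + 1)) / fact n * \<bar>t\<bar> ^ n))"
    by (rule suminf_le[OF _ su sums_summable[OF S]]) (use diffs_bcoef_bound in simp)
  also have "\<dots> = C0 * ((\<bar>t\<bar> + (real k + 1)) * exp \<bar>t\<bar>)" using sums_unique[OF S] by simp
  also have "\<dots> \<le> (1 + C0) * ((real k + 1) * (1 + \<bar>t\<bar>) * exp t)"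
    using assms True C0_pos by (intro mult_mono) (auto simp: algebra_simps)
  finally show ?thesis by (simp add: mult_ac)
next
  case False
  have "1 * 1 * 1 \<le> (1 + C0) * (real k + 1) * (1 + \<bar>t\<bar>)" using C0_pos by (intro mult_mono) auto
  then show ?thesis using False by (simp add: bexp_def mult_right_mono)
qed

lemma bexp_nonneg: "0 \<le> bexp h al 0 t"
proof -
  have "0 \<le> bcoef al n * t ^ n" for n
    by (cases "even n") (auto simp: bcoef_odd bcoef_nonneg zero_le_even_power)
  then show ?thesis using diffs_bcoef_summable[of 0 t] by (auto simp: bexp_def intro!: suminf_nonneg)
qed

lemma bexp_1_0: "h \<Longrightarrow> bexp h al (Suc 0) 0 = 0"
  using powser_zero[of "diffs (bcoef al)"] by (simp add: bexp_def diffs_def)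

lemma bexp_0_0: "bexp h al 0 0 = 1"
  using powser_zero[of "bcoef al"] by (simp add: bexp_def)

lemma bexp_ode: "t * bexp h al 2 t + al * bexp h al 1 t = t * bexp h al 0 t"
proof (cases h)
  case True
  let ?c = "bcoef al"
  have s0: "(\<lambda>n. ?c n * t ^ n) sums bexp h al 0 t"
    using summable_sums[OF diffs_bcoef_summable[of 0 t]] True by (simp add: bexp_def)
  have s1: "(\<lambda>n. diffs ?c n * t ^ n) sums bexp h al 1 t"
    using summable_sums[OF diffs_bcoef_summable[of 1 t]] True by (simp add: bexp_def)
  have s2: "(\<lambda>n. diffs (diffs ?c) n * t ^ n) sums bexp h al 2 t"
    using summable_sums[OF diffs_bcoef_summable[of 2 t]] True by (simp add: bexp_def numeral_2_eq_2)
  \<comment> \<open>Both series are aligned at the power \<open>t ^ (n + 1)\<close>. The term split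
    off from the first derivative is \<open>al * diffs ?c 0\<close>, which vanishes because the
    coefficient at 1 is 0.\<close>
  have "(\<lambda>n. t * (diffs (diffs ?c) n * t ^ n)) sums (t * bexp h al 2 t)"
    by (rule sums_mult[OF s2])
  moreover have "(\<lambda>n. al * (diffs ?c (Suc n) * t ^ Suc n)) sums (al * bexp h al 1 t - al * diffs ?c 0)"
    using sums_mult[OF s1, of al] by (subst sums_Suc_iff) (simp add: diffs_def)
  ultimately have "(\<lambda>n. t * (diffs (diffs ?c) n * t ^ n) + al * (diffs ?c (Suc n) * t ^ Suc n)) sums (t * bexp h al 2 t + (al * bexp h al 1 t - al * diffs ?c 0))"
    by (rule sums_add)
  moreover have "t * (diffs (diffs ?c) n * t ^ n) + al * (diffs ?c (Suc n) * t ^ Suc n) = t * (?c n * t ^ n)" for n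
  proof -
    have "0 < real n + 1 + al" using al by linarith
    then have "?c (Suc (Suc n)) * ((real n + 2) * (real n + 1 + al)) = ?c n" by simp
    then have "?c n = (real n + 1) * (real n + 2) * ?c (Suc (Suc n)) + al * ((real n + 2) * ?c (Suc (Suc n)))"
      by (simp add: algebra_simps del: bcoef.simps)
    moreover have "diffs (diffs ?c) n = (real n + 1) * (real n + 2) * ?c (Suc (Suc n))"
      "diffs ?c (Suc n) = (real n + 2) * ?c (Suc (Suc n))" by (simp_all add: diffs_def add.commute del: bcoef.simps)
    ultimately show ?thesis by (simp add: algebra_simps del: bcoef.simps)
  qed
  ultimately have "(\<lambda>n. t * (?c n * t ^ n)) sums (t * bexp h al 2 t + (al * bexp h al 1 t - al * diffs ?c 0))" by simp
  from sums_unique2[OF this sums_mult[OF s0]] show ?thesis by (simp add: diffs_def)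
qed (use flat in \<open>simp add: bexp_def\<close>)

end


text \<open>The cut at 0 turns integrals over the half line into integrals over the line, and makes
  the product of these weights carry the restriction to the orthant.\<close>

definition weight1 :: "bool \<Rightarrow> real \<Rightarrow> real \<Rightarrow> real" where
  "weight1 h al t = (if h then (if 0 < t then t powr al else 0) else 1)"

lemma weight1_nonneg: "0 \<le> weight1 h al t"
  by (simp add: weight1_def)

lemma weight1_measurable [measurable]: "weight1 h al \<in> borel_measurable borel"
  unfolding weight1_def[abs_def] by measurable

context bessel1
begin

abbreviation (input) ker where
  "ker i j l k \<equiv> (\<lambda>s y \<eta>. y ^ i * \<eta> ^ j * (1 / s) ^ l * (s powr (- ((al + 1) / 2)) *
          exp (- (y\<^sup>2 + \<eta>\<^sup>2) / (4 * s)) * bexp h al k (y * \<eta> / (2 * s))))"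

lemma heat1_ker: "heat1 h al = ker 0 0 0 0"
  by (simp add: heat1_def fun_eq_iff)

lemma kerfun_heat1: "kerfun h al (heat1 h al)"
  unfolding heat1_ker by (rule kerfun.gen)

lemma bexp_continuous: "continuous_on S (bexp h al k)"
  by (rule DERIV_continuous_on[OF has_field_derivative_at_within[OF bexp_deriv]])

lemma bexp_measurable [measurable]: "bexp h al k \<in> borel_measurable borel"
  by (rule borel_measurable_continuous_onI) (rule bexp_continuous)

lemma kerfun_measurable:
  assumes "kerfun h al f" and [measurable]: "S \<in> borel_measurable M" "Z \<in> borel_measurable M" "W \<in> borel_measurable M"
  shows "(\<lambda>x. f (S x) (Z x) (W x)) \<in> borel_measurable M"
  using assms(1)
proof induction
  case (gen i j l k)
  have [measurable]: "(\<lambda>x. bexp h al k (Z x * W x / (2 * S x))) \<in> borel_measurable M"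
    by (rule measurable_compose[OF _ bexp_measurable]) measurable
  show ?case by measurable
next
  case (scale f c)
  then show ?case by (intro borel_measurable_times borel_measurable_const)
next
  case (add f g)
  then show ?case by (intro borel_measurable_add)
qed

text \<open>For arguments of size at most 1 the monomials are harmless, negative powers of
  \<open>s\<close> go into the power of \<open>1 + 1 / s\<close>, and the exponential from
  \<open>bexp_bound\<close> completes the square in the Gaussian.\<close>

lemma kerfun_bound:
  assumes "kerfun h al f"
  shows "\<exists>C N. 0 \<le> C \<and> (\<forall>s y \<eta>. 0 < s \<longrightarrow> (h \<longrightarrow> 0 \<le> y \<and> 0 \<le> \<eta>) \<longrightarrow> \<bar>y\<bar> \<le> 1 \<longrightarrow> \<bar>\<eta>\<bar> \<le> 1 \<longrightarrow>
            \<bar>f s y \<eta>\<bar> \<le> C * (1 + 1 / s) ^ N * exp (- (y - \<eta>)\<^sup>2 / (4 * s)))"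
  using assms
proof induction
  case (gen i j l k)
  define C where "C = (1 + C0) * (real k + 1)"
  have C: "0 \<le> C" using C0_pos by (simp add: C_def)
  define N where "N = nat \<lceil>b\<rceil>"
  have "\<bar>ker i j l k s y \<eta>\<bar> \<le> C * (1 + 1 / s) ^ (l + N + 1) * exp (- (y - \<eta>)\<^sup>2 / (4 * s))"
    if s: "0 < s" and h: "h \<longrightarrow> 0 \<le> y \<and> 0 \<le> \<eta>" and y: "\<bar>y\<bar> \<le> 1" and e: "\<bar>\<eta>\<bar> \<le> 1" for s y \<eta>
  proof -
    have "s powr (- b) = (1 / s) powr b" using s by (simp add: powr_minus_divide powr_divide)
    also have "\<dots> \<le> (1 + 1 / s) powr b" using s b_pos by (intro powr_mono2) auto
    also have "\<dots> \<le> (1 + 1 / s) powr N" using s unfolding N_def by (intro powr_mono) (auto simp: real_nat_ceiling_ge)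
    also have "\<dots> = (1 + 1 / s) ^ N" using s by (intro powr_realpow) (simp add: add_pos_pos)
    finally have p: "s powr (- b) \<le> (1 + 1 / s) ^ N" .
    have t: "\<bar>y * \<eta> / (2 * s)\<bar> \<le> 1 / s"
    proof -
      have "\<bar>y * \<eta>\<bar> \<le> 1 * 1" unfolding abs_mult using y e by (intro mult_mono) auto
      then show ?thesis using s by (simp add: field_simps)
    qed
    have bb: "\<bar>bexp h al k (y * \<eta> / (2 * s))\<bar> \<le> C * (1 + \<bar>y * \<eta> / (2 * s)\<bar>) * exp (y * \<eta> / (2 * s))"
      unfolding C_def using h s by (intro bexp_bound) auto
    also have "\<dots> \<le> C * (1 + 1 / s) * exp (y * \<eta> / (2 * s))"
      using t C by (intro mult_right_mono mult_left_mono) auto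
    finally have bb: "\<bar>bexp h al k (y * \<eta> / (2 * s))\<bar> \<le> C * (1 + 1 / s) * exp (y * \<eta> / (2 * s))" .
    have ij: "\<bar>y ^ i * \<eta> ^ j\<bar> \<le> 1"
      using power_le_one[OF _ y, of i] power_le_one[OF _ e, of j] by (simp add: abs_mult power_abs mult_le_one)
    have ls: "(1 / s) ^ l \<le> (1 + 1 / s) ^ l" using s by (intro power_mono) auto
    have "\<bar>ker i j l k s y \<eta>\<bar> = \<bar>y ^ i * \<eta> ^ j\<bar> * (1 / s) ^ l * (s powr (- b) * exp (- (y\<^sup>2 + \<eta>\<^sup>2) / (4 * s)) * \<bar>bexp h al k (y * \<eta> / (2 * s))\<bar>)"
      using s by (simp add: abs_mult b_def)
    also have "\<dots> \<le> 1 * (1 + 1 / s) ^ l * ((1 + 1 / s) ^ N * exp (- (y\<^sup>2 + \<eta>\<^sup>2) / (4 * s)) * (C * (1 + 1 / s) * exp (y * \<eta> / (2 * s))))"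
      using ij ls p bb s C by (intro mult_mono) auto
    also have "\<dots> = C * (1 + 1 / s) ^ (l + N + 1) * (exp (- (y\<^sup>2 + \<eta>\<^sup>2) / (4 * s)) * exp (y * \<eta> / (2 * s)))"
      by (simp add: power_add)
    also have "exp (- (y\<^sup>2 + \<eta>\<^sup>2) / (4 * s)) * exp (y * \<eta> / (2 * s)) = exp (- (y - \<eta>)\<^sup>2 / (4 * s))"
      using s by (simp add: field_simps power2_eq_square flip: exp_add)
    finally show ?thesis .
  qed
  then show ?case using C by blast
next
  case (scale f c)
  then obtain C N where C: "0 \<le> C" and N: "\<And>s y \<eta>. 0 < s \<Longrightarrow> (h \<longrightarrow> 0 \<le> y \<and> 0 \<le> \<eta>) \<Longrightarrow> \<bar>y\<bar> \<le> 1 \<Longrightarrow> \<bar>\<eta>\<bar> \<le> 1 \<Longrightarrow>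
            \<bar>f s y \<eta>\<bar> \<le> C * (1 + 1 / s) ^ N * exp (- (y - \<eta>)\<^sup>2 / (4 * s))" by blast
  have "\<bar>c * f s y \<eta>\<bar> \<le> \<bar>c\<bar> * C * (1 + 1 / s) ^ N * exp (- (y - \<eta>)\<^sup>2 / (4 * s))"
    if "0 < s" "h \<longrightarrow> 0 \<le> y \<and> 0 \<le> \<eta>" "\<bar>y\<bar> \<le> 1" "\<bar>\<eta>\<bar> \<le> 1" for s y \<eta>
    using mult_left_mono[OF N[OF that], of "\<bar>c\<bar>"] by (simp add: abs_mult mult_ac)
  then show ?case using C by (intro exI[of _ "\<bar>c\<bar> * C"] exI[of _ N]) auto
next
  case (add f g)
  then obtain C N C' N' where C: "0 \<le> C" "0 \<le> C'" and N: "\<And>s y \<eta>. 0 < s \<Longrightarrow> (h \<longrightarrow> 0 \<le> y \<and> 0 \<le> \<eta>) \<Longrightarrow> \<bar>y\<bar> \<le> 1 \<Longrightarrow> \<bar>\<eta>\<bar> \<le> 1 \<Longrightarrow>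
            \<bar>f s y \<eta>\<bar> \<le> C * (1 + 1 / s) ^ N * exp (- (y - \<eta>)\<^sup>2 / (4 * s))"
     and N': "\<And>s y \<eta>. 0 < s \<Longrightarrow> (h \<longrightarrow> 0 \<le> y \<and> 0 \<le> \<eta>) \<Longrightarrow> \<bar>y\<bar> \<le> 1 \<Longrightarrow> \<bar>\<eta>\<bar> \<le> 1 \<Longrightarrow>
            \<bar>g s y \<eta>\<bar> \<le> C' * (1 + 1 / s) ^ N' * exp (- (y - \<eta>)\<^sup>2 / (4 * s))" by blast
  have "\<bar>f s y \<eta> + g s y \<eta>\<bar> \<le> (C + C') * (1 + 1 / s) ^ (N + N') * exp (- (y - \<eta>)\<^sup>2 / (4 * s))"
    if A: "0 < s" "h \<longrightarrow> 0 \<le> y \<and> 0 \<le> \<eta>" "\<bar>y\<bar> \<le> 1" "\<bar>\<eta>\<bar> \<le> 1" for s y \<eta>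
  proof -
    have "(1 + 1 / s) ^ N \<le> (1 + 1 / s) ^ (N + N')" "(1 + 1 / s) ^ N' \<le> (1 + 1 / s) ^ (N + N')"
      using A by (intro power_increasing; simp)+
    then have "C * (1 + 1 / s) ^ N * exp (- (y - \<eta>)\<^sup>2 / (4 * s)) \<le> C * (1 + 1 / s) ^ (N + N') * exp (- (y - \<eta>)\<^sup>2 / (4 * s))"
      "C' * (1 + 1 / s) ^ N' * exp (- (y - \<eta>)\<^sup>2 / (4 * s)) \<le> C' * (1 + 1 / s) ^ (N + N') * exp (- (y - \<eta>)\<^sup>2 / (4 * s))"
      using C by (intro mult_right_mono mult_left_mono; simp)+
    then show ?thesis using N[OF A] N'[OF A] by (simp add: distrib_right)
  qed
  then show ?case using C by (intro exI[of _ "C + C'"] exI[of _ "N + N'"]) auto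
qed

text \<open>The three terms come from the monomial, the Gaussian and the argument of
  \<open>bexp\<close>. At \<open>i = 0\<close> the truncated \<open>i - 1\<close> is multiplied by
  \<open>real i = 0\<close>.\<close>

lemma ker_deriv_y:
  assumes "0 < s"
  shows "((\<lambda>y. ker i j l k s y \<eta>) has_real_derivative
     (real i * ker (i - 1) j l k s y \<eta> + (-1/2) * ker (i + 1) j (l + 1) k s y \<eta> + (1/2) * ker i (j + 1) (l + 1) (k + 1) s y \<eta>)) (at y)"
proof -
  have 1: "((\<lambda>y. y ^ i * \<eta> ^ j * (1 / s) ^ l) has_real_derivative real i * y ^ (i - 1) * \<eta> ^ j * (1 / s) ^ l) (at y)"
    by (auto intro!: derivative_eq_intros)
  have 2: "((\<lambda>y. exp (- (y\<^sup>2 + \<eta>\<^sup>2) / (4 * s))) has_real_derivative (-1/2) * y * (1/s) * exp (- (y\<^sup>2 + \<eta>\<^sup>2) / (4 * s))) (at y)"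
    using assms by (auto intro!: derivative_eq_intros)
  have 3: "((\<lambda>y. bexp h al k (y * \<eta> / (2 * s))) has_real_derivative bexp h al (k + 1) (y * \<eta> / (2 * s)) * (1/2 * \<eta> * (1/s))) (at y)"
    using assms by (intro DERIV_cong[OF DERIV_chain2[OF bexp_deriv]]) (auto intro!: derivative_eq_intros)
  show ?thesis
    by (rule DERIV_cong[OF DERIV_mult[OF 1 DERIV_mult[OF DERIV_cmult[OF 2] 3]]])
       (simp add: algebra_simps del: times_divide_eq_left times_divide_eq_right)
qed



lemma ker_deriv_eta:
  assumes "0 < s"
  shows "((\<lambda>\<eta>. ker i j l k s y \<eta>) has_real_derivative
     (real j * ker i (j - 1) l k s y \<eta> + (-1/2) * ker i (j + 1) (l + 1) k s y \<eta> + (1/2) * ker (i + 1) j (l + 1) (k + 1) s y \<eta>)) (at \<eta>)"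
proof -
  have 1: "((\<lambda>\<eta>. y ^ i * \<eta> ^ j * (1 / s) ^ l) has_real_derivative y ^ i * (real j * \<eta> ^ (j - 1)) * (1 / s) ^ l) (at \<eta>)"
    by (auto intro!: derivative_eq_intros)
  have 2: "((\<lambda>\<eta>. exp (- (y\<^sup>2 + \<eta>\<^sup>2) / (4 * s))) has_real_derivative (-1/2) * \<eta> * (1/s) * exp (- (y\<^sup>2 + \<eta>\<^sup>2) / (4 * s))) (at \<eta>)"
    using assms by (auto intro!: derivative_eq_intros)
  have 3: "((\<lambda>\<eta>. bexp h al k (y * \<eta> / (2 * s))) has_real_derivative bexp h al (k + 1) (y * \<eta> / (2 * s)) * (1/2 * y * (1/s))) (at \<eta>)"
    using assms by (intro DERIV_cong[OF DERIV_chain2[OF bexp_deriv]]) (auto intro!: derivative_eq_intros)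
  show ?thesis
    by (rule DERIV_cong[OF DERIV_mult[OF 1 DERIV_mult[OF DERIV_cmult[OF 2] 3]]])
       (simp add: algebra_simps del: times_divide_eq_left times_divide_eq_right)
qed

lemma kerfun_deriv_y:
  assumes "kerfun h al f"
  shows "\<exists>g. kerfun h al g \<and> (\<forall>s y \<eta>. 0 < s \<longrightarrow> ((\<lambda>y. f s y \<eta>) has_real_derivative g s y \<eta>) (at y))"
  using assms
proof induction
  case (gen i j l k)
  show ?case
    by (intro exI[of _ "\<lambda>s y \<eta>. real i * ker (i - 1) j l k s y \<eta> + (-1/2) * ker (i + 1) j (l + 1) k s y \<eta> + (1/2) * ker i (j + 1) (l + 1) (k + 1) s y \<eta>"]
          conjI allI impI ker_deriv_y kerfun.add kerfun.scale kerfun.gen)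
next
  case (scale f c)
  then obtain g where "kerfun h al g" "\<And>s y \<eta>. 0 < s \<Longrightarrow> ((\<lambda>y. f s y \<eta>) has_real_derivative g s y \<eta>) (at y)" by blast
  then show ?case
    by (intro exI[of _ "\<lambda>s y \<eta>. c * g s y \<eta>"]) (auto intro!: kerfun.scale DERIV_cmult)
next
  case (add f f')
  then obtain g g' where "kerfun h al g" "\<And>s y \<eta>. 0 < s \<Longrightarrow> ((\<lambda>y. f s y \<eta>) has_real_derivative g s y \<eta>) (at y)"
    "kerfun h al g'" "\<And>s y \<eta>. 0 < s \<Longrightarrow> ((\<lambda>y. f' s y \<eta>) has_real_derivative g' s y \<eta>) (at y)" by blast
  then show ?case
    by (intro exI[of _ "\<lambda>s y \<eta>. g s y \<eta> + g' s y \<eta>"]) (auto intro!: kerfun.add DERIV_add)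
qed

lemma kerfun_deriv_seq:
  assumes "kerfun h al f"
  obtains F where "F 0 = f" "\<And>m. kerfun h al (F m)"
    "\<And>m s y \<eta>. 0 < s \<Longrightarrow> ((\<lambda>y. F m s y \<eta>) has_real_derivative F (Suc m) s y \<eta>) (at y)"
proof -
  have "\<exists>F. \<forall>m. (kerfun h al (F m) \<and> (m = 0 \<longrightarrow> F m = f)) \<and>
     (\<forall>s y \<eta>. 0 < s \<longrightarrow> ((\<lambda>y. F m s y \<eta>) has_real_derivative F (Suc m) s y \<eta>) (at y))"
    by (rule dependent_nat_choice) (use assms kerfun_deriv_y in \<open>auto\<close>)
  then show ?thesis using that by metis
qed

text \<open>\<open>heat1_e\<close>, \<open>heat1_ee\<close> and \<open>heat1_s\<close> are the first
  and second \<eta>-derivative and the time derivative of \<open>heat1\<close>, expanded in the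
  generators of \<open>kerfun\<close>.\<close>

definition heat1_e :: "real \<Rightarrow> real \<Rightarrow> real \<Rightarrow> real" where
  "heat1_e s y \<eta> = (-1/2) * ker 0 1 1 0 s y \<eta> + (1/2) * ker 1 0 1 1 s y \<eta>"

definition heat1_ee :: "real \<Rightarrow> real \<Rightarrow> real \<Rightarrow> real" where
  "heat1_ee s y \<eta> = (-1/2) * (ker 0 0 1 0 s y \<eta> + (-1/2) * ker 0 2 2 0 s y \<eta> + (1/2) * ker 1 1 2 1 s y \<eta>) +
     (1/2) * ((-1/2) * ker 1 1 2 1 s y \<eta> + (1/2) * ker 2 0 2 2 s y \<eta>)"

definition heat1_s :: "real \<Rightarrow> real \<Rightarrow> real \<Rightarrow> real" where
  "heat1_s s y \<eta> = (- b) * ker 0 0 1 0 s y \<eta> + (1/4) * ker 2 0 2 0 s y \<eta> + (1/4) * ker 0 2 2 0 s y \<eta> + (-1/2) * ker 1 1 2 1 s y \<eta>"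

lemma kerfun_heat1_e: "kerfun h al heat1_e"
  unfolding heat1_e_def[abs_def] by (rule kerfun.add kerfun.scale kerfun.gen)+

lemma kerfun_heat1_s: "kerfun h al heat1_s"
  unfolding heat1_s_def[abs_def] by (rule kerfun.add kerfun.scale kerfun.gen)+

lemma heat1_deriv_eta: 
  assumes "0 < s" shows "(heat1 h al s y has_real_derivative heat1_e s y \<eta>) (at \<eta>)"
  unfolding heat1_ker heat1_e_def
  by (rule DERIV_cong[OF ker_deriv_eta[OF assms, where i=0 and j=0 and l=0 and k=0]]) simp

lemma heat1_e_deriv_eta: 
  assumes "0 < s" shows "(heat1_e s y has_real_derivative heat1_ee s y \<eta>) (at \<eta>)"
  unfolding heat1_e_def[abs_def]
  by (rule DERIV_cong[OF DERIV_add[OF DERIV_cmult[OF ker_deriv_eta[OF assms, where i=0 and j=1 and l=1 and k=0]]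
     DERIV_cmult[OF ker_deriv_eta[OF assms, where i=1 and j=0 and l=1 and k=1]]]]) 
   (simp add: heat1_ee_def numeral_2_eq_2)

lemma heat1_deriv_s:
  assumes s: "0 < s" shows "((\<lambda>s. heat1 h al s y \<eta>) has_real_derivative heat1_s s y \<eta>) (at s)"
proof -
  have 1: "((\<lambda>s. s powr (- b)) has_real_derivative (- b) * (1/s) * s powr (- b)) (at s)"
    using s by (auto intro!: derivative_eq_intros simp: powr_diff field_simps)
  have 2: "((\<lambda>s. exp (- (y\<^sup>2 + \<eta>\<^sup>2) / (4 * s))) has_real_derivative (y\<^sup>2 + \<eta>\<^sup>2) / 4 * (1/s)\<^sup>2 * exp (- (y\<^sup>2 + \<eta>\<^sup>2) / (4 * s))) (at s)"
    using s by (auto intro!: derivative_eq_intros simp: field_simps power2_eq_square)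
  have 3: "((\<lambda>s. bexp h al 0 (y * \<eta> / (2 * s))) has_real_derivative (bexp h al 1 (y * \<eta> / (2 * s)) * (- y * \<eta> / 2 * (1/s)\<^sup>2))) (at s)"
    using s by (intro DERIV_cong[OF DERIV_chain2[OF bexp_deriv]])
      (auto intro!: derivative_eq_intros simp: field_simps power2_eq_square)
  show ?thesis
    unfolding heat1_def b_def[symmetric]
    by (rule DERIV_cong[OF DERIV_mult[OF DERIV_mult[OF 1 2] 3]])
       (unfold heat1_s_def b_def[symmetric], use s in \<open>simp add: power2_eq_square field_simps\<close>)
qed

text \<open>All terms cancel except a multiple of the Bessel equation for \<open>bexp\<close> at
  \<open>y * \<eta> / (2 * s)\<close>. For an \<open>x\<close>-variable \<open>al = 0\<close>
  removes the quotient by \<open>\<eta>\<close>.\<close>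

lemma heat1_equation:
  assumes s: "0 < s" and n: "h \<Longrightarrow> \<eta> \<noteq> 0"
  shows "heat1_ee s y \<eta> + al / \<eta> * heat1_e s y \<eta> = heat1_s s y \<eta>"
proof -
  define A where "A = s powr (- ((al + 1) / 2)) * exp (- (y\<^sup>2 + \<eta>\<^sup>2) / (4 * s))"
  define E where "E k = bexp h al k (y * \<eta> / (2 * s))" for k
  define r where "r = 1 / s"
  have ee: "heat1_ee s y \<eta> = A * ((-1/2) * (r * E 0 + (-1/2) * \<eta>\<^sup>2 * r\<^sup>2 * E 0 + 1/2 * y * \<eta> * r\<^sup>2 * E 1) +
     1/2 * ((-1/2) * y * \<eta> * r\<^sup>2 * E 1 + 1/2 * y\<^sup>2 * r\<^sup>2 * E 2))"
    by (simp only: heat1_ee_def A_def[symmetric] E_def[symmetric] r_def[symmetric] power_0 power_one_right) (simp only: algebra_simps mult_1)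
  have ss: "heat1_s s y \<eta> = A * (- (al + 1) / 2 * r * E 0 + 1/4 * y\<^sup>2 * r\<^sup>2 * E 0 + 1/4 * \<eta>\<^sup>2 * r\<^sup>2 * E 0 + (-1/2) * y * \<eta> * r\<^sup>2 * E 1)"
    by (simp only: heat1_s_def b_def A_def[symmetric] E_def[symmetric] r_def[symmetric] power_0 power_one_right) (simp only: algebra_simps mult_1 minus_divide_left)
  have he: "heat1_e s y \<eta> = A * ((-1/2) * \<eta> * r * E 0 + 1/2 * y * r * E 1)"
    by (simp only: heat1_e_def A_def[symmetric] E_def[symmetric] r_def[symmetric] power_0 power_one_right) (simp only: algebra_simps mult_1)
  have e: "al / \<eta> * heat1_e s y \<eta> = A * ((-1/2) * al * r * E 0 + 1/2 * y * r * (al / \<eta>) * E 1)"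
  proof (cases "al = 0")
    case False
    then have "\<eta> \<noteq> 0" using n flat by blast
    then show ?thesis unfolding he by (simp add: field_simps)
  qed simp
  have ode: "1/4 * y\<^sup>2 * r\<^sup>2 * E 2 + 1/2 * y * r * (al / \<eta>) * E 1 - 1/4 * y\<^sup>2 * r\<^sup>2 * E 0 = 0"
  proof (cases h)
    case True
    have o: "y * \<eta> / (2 * s) * E 2 + al * E 1 = y * \<eta> / (2 * s) * E 0"
      unfolding E_def by (rule bexp_ode)
    \<comment> \<open>\<open>bexp_ode\<close> carries a factor \<open>t\<close>; multiplying it by
      \<open>y / (2 * s * \<eta>)\<close> restores the coefficient
      \<open>y\<^sup>2 / (4 * s\<^sup>2)\<close> of the second derivative.\<close>
    have "1/4 * y\<^sup>2 * r\<^sup>2 * E 2 + 1/2 * y * r * (al / \<eta>) * E 1 - 1/4 * y\<^sup>2 * r\<^sup>2 * E 0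
       = (y * \<eta> / (2 * s) * E 2 + al * E 1 - y * \<eta> / (2 * s) * E 0) * (y / (2 * s * \<eta>))"
      using n True s by (simp add: r_def field_simps power2_eq_square)
    then show ?thesis using o by simp
  next
    case False
    then show ?thesis using flat by (simp add: E_def bexp_def)
  qed
  have "heat1_ee s y \<eta> + al / \<eta> * heat1_e s y \<eta> - heat1_s s y \<eta> =
    A * (1/4 * y\<^sup>2 * r\<^sup>2 * E 2 + 1/2 * y * r * (al / \<eta>) * E 1 - 1/4 * y\<^sup>2 * r\<^sup>2 * E 0)"
    unfolding e ee ss by (simp add: field_simps)
  then show ?thesis unfolding ode by simp
qed

text \<open>The Gaussian contributes a factor \<open>\<eta>\<close>, the series its first
  derivative, which is odd. This Neumann condition is what frees integration by parts against the
  kernel from boundary terms.\<close>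

lemma heat1_e_0: "h \<Longrightarrow> heat1_e s y 0 = 0"
  unfolding heat1_e_def using bexp_1_0 by simp

lemma heat1_nonneg: "0 \<le> heat1 h al s y \<eta>"
  by (simp add: heat1_def bexp_nonneg)

lemma heat1_sym: "heat1 h al s y \<eta> = heat1 h al s \<eta> y"
  by (simp add: heat1_def mult_ac add.commute)

section \<open>Mass and tails of the one-dimensional kernel\<close>

text \<open>The substitution \<open>\<eta> = sqrt (4 * s * x)\<close>, written with
  \<open>powr\<close> below, leads to Euler's integral for Gamma.\<close>

lemma moment_half_line:
  assumes s: "0 < s" and p: "-1 < p"
  shows "(\<integral>\<^sup>+\<eta>. ennreal (indicator {0<..} \<eta> * (\<eta> powr p * exp (- \<eta>\<^sup>2 / (4 * s)))) \<partial>lborel) =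
     ennreal (1/2 * (4 * s) powr ((p + 1) / 2) * Gamma ((p + 1) / 2))"
proof -
  define q where "q = (p + 1) / 2"
  have q: "0 < q" using p by (simp add: q_def)
  define f where "f = (\<lambda>\<eta>. \<eta> powr p * exp (- \<eta>\<^sup>2 / (4 * s)))"
  define g where "g = (\<lambda>x. (4 * s * x) powr (1/2))"
  define g' where "g' = (\<lambda>x. 1/2 * (4 * s) powr (1/2) * x powr (-1/2))"
  have fg: "f (g x) * g' x = 1/2 * (4 * s) powr q * (x powr (q - 1) / exp x)" if "0 < x" for x
  proof -
    have "(g x)\<^sup>2 = (4 * s * x) powr (1/2 + 1/2)"
      unfolding g_def power2_eq_square powr_add ..
    also have "\<dots> = 4 * s * x" using that s by simp
    finally have e: "exp (- (g x)\<^sup>2 / (4 * s)) = exp (- x)" using s by simp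
    have g: "g x powr p = (4 * s) powr (p / 2) * x powr (p / 2)"
      using that s unfolding g_def powr_powr by (subst powr_mult[symmetric]) auto
    have q0: "q = p / 2 + 1/2" and q1: "q - 1 = p / 2 + (-1/2)" by (simp_all add: q_def field_simps)
    have "f (g x) * g' x = 1/2 * ((4 * s) powr (p / 2) * (4 * s) powr (1/2)) * ((x powr (p / 2) * x powr (-1/2)) * inverse (exp x))"
      unfolding f_def e g g'_def exp_minus by (simp only: mult_ac)
    also have "\<dots> = 1/2 * (4 * s) powr q * (x powr (q - 1) * inverse (exp x))"
      by (simp only: powr_add[symmetric] q0[symmetric] q1[symmetric])
    finally show ?thesis by (simp only: divide_inverse)
  qed
  have G: "has_bochner_integral lborel (\<lambda>t. indicator {0..} t * t powr (q - 1) / exp t) (Gamma q)"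
    by (rule has_bochner_integral_nn_integral[OF _ _ _ Gamma_conv_nn_integral_real[OF q, symmetric]])
       (use q in \<open>auto simp: Gamma_real_pos less_imp_le\<close>)
  have G': "has_bochner_integral lborel (\<lambda>t. indicator {0<..} t *\<^sub>R (f (g t) * g' t)) (1/2 * (4 * s) powr q * Gamma q)"
    by (rule has_bochner_integral_cong[THEN iffD1, OF refl _ refl, OF _ has_bochner_integral_mult_right[OF G, of "1/2 * (4 * s) powr q"]])
       (auto simp: indicator_def fg)
  have lims: "((ereal \<circ> g \<circ> real_of_ereal) \<longlongrightarrow> ereal 0) (at_right (ereal 0))"
     "((ereal \<circ> g \<circ> real_of_ereal) \<longlongrightarrow> \<infinity>) (at_left \<infinity>)"
  proof -
    have "(g \<longlongrightarrow> 0) (at_right 0)" unfolding g_def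
      using s by (auto intro!: tendsto_eq_intros eventually_at_rightI[of 0 1])
    then have "((ereal \<circ> g) \<longlongrightarrow> ereal 0) (at_right 0)"
      by (simp only: ereal_tendsto_simps2)
    then show "((ereal \<circ> g \<circ> real_of_ereal) \<longlongrightarrow> ereal 0) (at_right (ereal 0))"
      by (simp only: ereal_tendsto_simps1)
    have "filterlim g at_top at_top" unfolding g_def using s by real_asymp
    then have "((ereal \<circ> g) \<longlongrightarrow> \<infinity>) at_top"
      by (simp only: ereal_tendsto_simps2)
    then show "((ereal \<circ> g \<circ> real_of_ereal) \<longlongrightarrow> \<infinity>) (at_left \<infinity>)"
      by (simp only: ereal_tendsto_simps1)
  qed
  have D: "(g has_real_derivative g' x) (at x)" if "0 < x" for x
    unfolding g_def g'_def using that s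
    by (auto intro!: derivative_eq_intros simp: powr_mult powr_diff powr_minus field_simps powr_half_sqrt)
  have set1: "set_integrable lborel (einterval (ereal 0) \<infinity>) (\<lambda>x. f (g x) * g' x)"
    using G' by (simp add: set_integrable_def has_bochner_integral_iff)
  have cont: "isCont f (g x)" "isCont g' x" if "0 < x" for x
  proof -
    have "0 < g x" using that s by (simp add: g_def)
    then show "isCont f (g x)" unfolding f_def using s by (auto intro!: continuous_intros)
    show "isCont g' x" unfolding g'_def using that by (auto intro!: continuous_intros)
  qed
  have nn: "0 \<le> f x" "0 \<le> g' x" for x by (auto simp: f_def g'_def)
  note S = interval_integral_substitution_nonneg[of "ereal 0" \<infinity> g g' f "ereal 0" \<infinity>, OF _ _ _ _ _ _ lims set1]
  have "set_integrable lborel (einterval (ereal 0) \<infinity>) f"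
    by (rule S(1)) (use D cont nn in auto)
  then have "set_integrable lborel {0<..} f" by simp
  moreover have I: "(LBINT x=ereal 0..\<infinity>. f x) = (LBINT x=ereal 0..\<infinity>. f (g x) * g' x)"
    by (rule S(2)) (use D cont nn in auto)
  ultimately have int: "integrable lborel (\<lambda>x. indicator {0<..} x * f x)" by (simp add: set_integrable_def)
  have "(\<integral>x. indicator {0<..} x * f x \<partial>lborel) = (LBINT x=ereal 0..\<infinity>. f x)"
    by (simp add: interval_lebesgue_integral_def set_lebesgue_integral_def)
  also have "\<dots> = 1/2 * (4 * s) powr q * Gamma q"
    unfolding I using G' by (simp add: interval_lebesgue_integral_def set_lebesgue_integral_def has_bochner_integral_iff)
  finally have "(\<integral>\<^sup>+x. ennreal (indicator {0<..} x * f x) \<partial>lborel) = ennreal (1/2 * (4 * s) powr q * Gamma q)"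
    using nn_integral_eq_integral[OF int] nn(1) by (simp only: mult_nonneg_nonneg indicator_pos_le always_eventually simp_thms)
  then show ?thesis by (simp only: f_def q_def)
qed

text \<open>The weighted integral of the kernel at \<open>y = 0\<close>, where it is a single
  Gaussian moment; \<open>heat1_mass\<close> shows that \<open>y\<close> and \<open>s\<close> do not
  change it.\<close>

definition mass :: real where
  "mass = (if h then 1/2 * 4 powr b * Gamma b else 2 * sqrt pi)"

lemma mass_pos: "0 < mass"
  using b_pos by (auto simp: mass_def Gamma_real_pos)

text \<open>Identifies the series, for \<open>t > 0\<close>, with
  \<open>Gamma b * (t / 2) powr (1 - b) * I(t)\<close>, where \<open>I\<close> is the modified
  Bessel function of order \<open>b - 1\<close>. The product form matches the factors
  \<open>Gamma (k + b)\<close> of the Gaussian moments.\<close>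

lemma bcoef_even: "bcoef al (2 * k) * (4 ^ k * fact k * Gamma (real k + b)) = Gamma b"
proof (induction k)
  case (Suc k)
  have G: "Gamma (real k + b + 1) = (real k + b) * Gamma (real k + b)"
    using b_pos by (intro Gamma_plus1) (auto simp: nonpos_Ints_def)
  have n: "real (2 * k) + 1 + al = 2 * (real k + b)" "real (2 * k) + 2 = 2 * (real k + 1)" "2 * Suc k = Suc (Suc (2 * k))"
    by (simp_all add: b_def field_simps)
  define D where "D = real k + b"
  define K where "K = real k + 1"
  have c: "bcoef al (2 * Suc k) = bcoef al (2 * k) / (2 * K * (2 * D))"
    unfolding K_def D_def by (simp only: n bcoef.simps)
  have nz: "D \<noteq> 0" "K \<noteq> 0" using b_pos by (simp_all add: D_def K_def)
  have g: "Gamma (real (Suc k) + b) = D * Gamma D" using G by (simp add: D_def add_ac)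
  have f: "fact (Suc k) = K * fact k" by (simp add: K_def)
  have "bcoef al (2 * Suc k) * (4 ^ Suc k * fact (Suc k) * Gamma (real (Suc k) + b)) = bcoef al (2 * k) * (4 ^ k * fact k * Gamma (real k + b))"
    unfolding c g f D_def[symmetric] using nz by (simp add: field_simps del: bcoef.simps)
  then show ?case using Suc by simp
qed simp

text \<open>Integrated term by term, the even powers give moments whose Gamma factors cancel by
  \<open>bcoef_even\<close>. What remains is the exponential series of
  \<open>y\<^sup>2 / (4 * s)\<close>, which cancels the Gaussian factor in \<open>y\<close>. For an
  \<open>x\<close>-variable the kernel is a multiple of the normal density of variance
  \<open>2 * s\<close>.\<close>

lemma heat1_mass:
  assumes s: "0 < s"
  shows "(\<integral>\<^sup>+\<eta>. ennreal (weight1 h al \<eta> * heat1 h al s y \<eta>) \<partial>lborel) = ennreal mass"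
proof (cases h)
  case False
  have "weight1 h al \<eta> * heat1 h al s y \<eta> = (2 * sqrt pi) * normal_density y (sqrt (2 * s)) \<eta>" for \<eta>
  proof -
    have e: "exp (- (y\<^sup>2 + \<eta>\<^sup>2) / (4 * s)) * exp (y * \<eta> / (2 * s)) = exp (- (\<eta> - y)\<^sup>2 / (4 * s))"
      using s by (simp add: field_simps power2_eq_square flip: exp_add)
    have "s powr (- (1/2)) = 1 / sqrt s" using s by (simp add: powr_minus powr_half_sqrt field_simps)
    then show ?thesis using False flat s e
      by (simp add: weight1_def heat1_def bexp_def normal_density_def real_sqrt_mult mult.assoc field_simps)
  qed
  then have "(\<integral>\<^sup>+\<eta>. ennreal (weight1 h al \<eta> * heat1 h al s y \<eta>) \<partial>lborel) =
      ennreal (2 * sqrt pi) * (\<integral>\<^sup>+\<eta>. ennreal (normal_density y (sqrt (2 * s)) \<eta>) \<partial>lborel)"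
    by (simp add: ennreal_mult' nn_integral_cmult)
  also have "(\<integral>\<^sup>+\<eta>. ennreal (normal_density y (sqrt (2 * s)) \<eta>) \<partial>lborel) = 1"
    using s by (subst nn_integral_eq_integral) auto
  finally show ?thesis unfolding mass_def using False by simp
next
  case True
  define A where "A = s powr (- b) * exp (- y\<^sup>2 / (4 * s))"
  have A: "0 \<le> A" by (simp add: A_def)
  define x where "x = y\<^sup>2 / (4 * s)"
  have x: "0 \<le> x" using s by (simp add: x_def)
  define t where "t = (\<lambda>k \<eta>. A * bcoef al (2 * k) * (y / (2 * s)) ^ (2 * k) * (indicator {0<..} \<eta> * (\<eta> powr (al + 2 * real k) * exp (- \<eta>\<^sup>2 / (4 * s)))))"
  have t: "0 \<le> t k \<eta>" for k \<eta> unfolding t_def using A by (intro mult_nonneg_nonneg bcoef_nonneg) auto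
  have sums: "(\<lambda>k. t k \<eta>) sums (weight1 h al \<eta> * heat1 h al s y \<eta>)" for \<eta>
  proof (cases "0 < \<eta>")
    case e: True
    have "(\<lambda>n. bcoef al n * (y * \<eta> / (2 * s)) ^ n) sums bexp h al 0 (y * \<eta> / (2 * s))"
      using summable_sums[OF diffs_bcoef_summable[of 0]] True by (simp add: bexp_def)
    then have "(\<lambda>k. bcoef al (2 * k) * (y * \<eta> / (2 * s)) ^ (2 * k)) sums bexp h al 0 (y * \<eta> / (2 * s))"
      by (subst sums_mono_reindex[of "\<lambda>k. 2 * k"]) (auto simp: strict_mono_def bcoef_odd elim!: evenE intro!: bcoef_odd)
    from sums_mult[OF this, of "\<eta> powr al * (A * exp (- \<eta>\<^sup>2 / (4 * s)))"]
    have "(\<lambda>k. \<eta> powr al * (A * exp (- \<eta>\<^sup>2 / (4 * s))) * (bcoef al (2 * k) * (y * \<eta> / (2 * s)) ^ (2 * k))) sums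
       (\<eta> powr al * (A * exp (- \<eta>\<^sup>2 / (4 * s))) * bexp h al 0 (y * \<eta> / (2 * s)))" .
    moreover have "\<eta> powr al * (A * exp (- \<eta>\<^sup>2 / (4 * s))) * (bcoef al (2 * k) * (y * \<eta> / (2 * s)) ^ (2 * k)) = t k \<eta>" for k
    proof -
      have "\<eta> powr (al + 2 * real k) = \<eta> powr al * \<eta> ^ (2 * k)"
        using e by (simp add: powr_add flip: powr_realpow)
      moreover have "(y * \<eta> / (2 * s)) ^ (2 * k) = (y / (2 * s)) ^ (2 * k) * \<eta> ^ (2 * k)"
        by (simp flip: power_mult_distrib)
      ultimately show ?thesis using e by (simp add: t_def mult_ac)
    qed
    moreover have "\<eta> powr al * (A * exp (- \<eta>\<^sup>2 / (4 * s))) * bexp h al 0 (y * \<eta> / (2 * s)) = weight1 h al \<eta> * heat1 h al s y \<eta>"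
    proof -
      have "exp (- y\<^sup>2 / (4 * s)) * exp (- \<eta>\<^sup>2 / (4 * s)) = exp (- (y\<^sup>2 + \<eta>\<^sup>2) / (4 * s))"
        by (simp add: diff_divide_distrib flip: exp_add)
      then show ?thesis using e True by (simp add: weight1_def heat1_def A_def b_def mult.assoc)
    qed
    ultimately show ?thesis by simp
  next
    case False
    then show ?thesis using True by (simp add: t_def weight1_def)
  qed
  have [measurable]: "t k \<in> borel_measurable borel" for k unfolding t_def by measurable
  have int: "(\<integral>\<^sup>+\<eta>. ennreal (t k \<eta>) \<partial>lborel) = ennreal (mass * exp (- x) * (x ^ k / fact k))" for k
  proof -
    define c where "c = A * bcoef al (2 * k) * (y / (2 * s)) ^ (2 * k)"
    have c: "0 \<le> c" unfolding c_def using A by (intro mult_nonneg_nonneg bcoef_nonneg) auto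
    have qq: "(al + 2 * real k + 1) / 2 = real k + b" by (simp add: b_def field_simps)
    have "(\<integral>\<^sup>+\<eta>. ennreal (t k \<eta>) \<partial>lborel) = ennreal c * (\<integral>\<^sup>+\<eta>. ennreal (indicator {0<..} \<eta> * (\<eta> powr (al + 2 * real k) * exp (- \<eta>\<^sup>2 / (4 * s)))) \<partial>lborel)"
      unfolding t_def c_def[symmetric] using c by (simp add: ennreal_mult' nn_integral_cmult)
    also have "\<dots> = ennreal (c * (1/2 * (4 * s) powr (real k + b) * Gamma (real k + b)))"
      using al c by (subst moment_half_line[OF s]) (simp, simp only: qq ennreal_mult'[OF c])
    also have "c * (1/2 * (4 * s) powr (real k + b) * Gamma (real k + b)) = mass * exp (- x) * (x ^ k / fact k)"
    proof -
      have 1: "(4 * s) powr (real k + b) = (4 * s) ^ k * (4 powr b * s powr b)"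
        using s by (simp add: powr_add powr_realpow powr_mult)
      have 2: "(y / (2 * s)) ^ (2 * k) * (4 * s) ^ k = x ^ k * 4 ^ k"
      proof -
        have "(y / (2 * s)) ^ (2 * k) * (4 * s) ^ k = ((y / (2 * s))\<^sup>2 * (4 * s)) ^ k" by (simp add: power_mult power_mult_distrib)
        also have "(y / (2 * s))\<^sup>2 * (4 * s) = x * 4" using s by (simp add: x_def field_simps power2_eq_square)
        finally show ?thesis by (simp add: power_mult_distrib)
      qed
      have 3: "s powr b * s powr (- b) = 1" using s by (simp flip: powr_add)
      have 4: "bcoef al (2 * k) * 4 ^ k * Gamma (real k + b) = Gamma b / fact k"
        using bcoef_even[of k] by (simp add: field_simps)
      have "c * (1/2 * (4 * s) powr (real k + b) * Gamma (real k + b)) =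
         1/2 * 4 powr b * exp (- y\<^sup>2 / (4 * s)) * (s powr b * s powr (- b)) * ((y / (2 * s)) ^ (2 * k) * (4 * s) ^ k) * (bcoef al (2 * k) * Gamma (real k + b))"
        unfolding c_def A_def 1 by (simp only: mult_ac)
      also have "\<dots> = 1/2 * 4 powr b * exp (- x) * x ^ k * (bcoef al (2 * k) * 4 ^ k * Gamma (real k + b))"
        unfolding 2 3 by (simp add: x_def mult_ac)
      also have "\<dots> = mass * exp (- x) * (x ^ k / fact k)"
        unfolding 4 mass_def using True by simp
      finally show ?thesis .
    qed
    finally show ?thesis .
  qed
  have "(\<integral>\<^sup>+\<eta>. ennreal (weight1 h al \<eta> * heat1 h al s y \<eta>) \<partial>lborel) = (\<integral>\<^sup>+\<eta>. (\<Sum>k. ennreal (t k \<eta>)) \<partial>lborel)"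
    by (intro nn_integral_cong) (metis sums t sums_iff suminf_ennreal2)
  also have "\<dots> = (\<Sum>k. \<integral>\<^sup>+\<eta>. ennreal (t k \<eta>) \<partial>lborel)"
    by (rule nn_integral_suminf) measurable
  also have "\<dots> = (\<Sum>k. ennreal (mass * exp (- x) * (x ^ k / fact k)))" by (simp only: int)
  also have "\<dots> = ennreal mass"
  proof -
    have "(\<lambda>k. x ^ k / fact k) sums exp x"
      using exp_converges[of x] by (simp add: divide_inverse mult.commute)
    from sums_mult[OF this, of "mass * exp (- x)"]
    have S: "(\<lambda>k. mass * exp (- x) * (x ^ k / fact k)) sums mass"
      by (simp only: mult.assoc mult_exp_exp) simp
    show ?thesis
      by (subst suminf_ennreal2) (use S x mass_pos in \<open>auto simp: sums_iff less_imp_le\<close>)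
  qed
  finally show ?thesis .
qed

lemma heat1_measurable [measurable]: "heat1 h al s y \<in> borel_measurable borel"
  by (rule kerfun_measurable[OF kerfun_heat1]) measurable

lemma gauss_weight_finite: "(\<integral>\<^sup>+\<eta>. ennreal (weight1 h al \<eta> * exp (- \<eta>\<^sup>2 / 32)) \<partial>lborel) < \<infinity>"
proof -
  \<comment> \<open>\<open>32 = 4 * 8\<close>: up to a constant this Gaussian is the kernel at time
    8 with \<open>y = 0\<close>, whose mass is known.\<close>
  have "weight1 h al \<eta> * exp (- \<eta>\<^sup>2 / 32) = 8 powr b * (weight1 h al \<eta> * heat1 h al 8 0 \<eta>)" for \<eta>
    by (simp add: heat1_def bexp_0_0 b_def[symmetric] powr_minus)
  then have "(\<integral>\<^sup>+\<eta>. ennreal (weight1 h al \<eta> * exp (- \<eta>\<^sup>2 / 32)) \<partial>lborel) =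
      (\<integral>\<^sup>+\<eta>. ennreal (8 powr b) * ennreal (weight1 h al \<eta> * heat1 h al 8 0 \<eta>) \<partial>lborel)"
    by (simp only: ennreal_mult'[OF powr_ge_zero])
  also have "\<dots> = ennreal (8 powr b) * ennreal mass"
    by (subst nn_integral_cmult) (auto simp: heat1_mass)
  finally show ?thesis by (simp add: ennreal_mult_less_top)
qed

lemma linear_gauss_finite:
  "(\<integral>\<^sup>+\<eta>. ennreal (weight1 h al \<eta> * ((1 + \<bar>\<eta>\<bar>) * exp (- (y - \<eta>)\<^sup>2 / 8))) \<partial>lborel) < \<infinity>"
proof -
  define K where "K = 9 * exp (y\<^sup>2 / 8)"
  have le: "(1 + \<bar>\<eta>\<bar>) * exp (- (y - \<eta>)\<^sup>2 / 8) \<le> K * exp (- \<eta>\<^sup>2 / 32)" for \<eta>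
  proof -
    \<comment> \<open>The 16 yields \<open>\<bar>\<eta>\<bar> \<le> 8 + \<eta>\<^sup>2 / 32\<close>.
      The Gaussian is spent in two steps: centring it at 0 costs half of the rate 1/8, absorbing the
      linear factor costs half of the remaining 1/16.\<close>
    have "0 \<le> (\<bar>\<eta>\<bar> - 16)\<^sup>2" by simp
    then have "1 + \<bar>\<eta>\<bar> \<le> 9 + \<eta>\<^sup>2 / 32" by (simp add: power2_eq_square algebra_simps)
    also have "\<dots> \<le> 9 * exp (\<eta>\<^sup>2 / 32)" using exp_ge_add_one_self[of "\<eta>\<^sup>2 / 32"] zero_le_power2[of \<eta>] by linarith
    finally have 1: "1 + \<bar>\<eta>\<bar> \<le> 9 * exp (\<eta>\<^sup>2 / 32)" .
    have "0 \<le> (\<eta> - 2 * y)\<^sup>2" by simp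
    moreover have "y\<^sup>2 / 8 + - \<eta>\<^sup>2 / 16 + (y - \<eta>)\<^sup>2 / 8 = (\<eta> - 2 * y)\<^sup>2 / 16"
      by (simp add: power2_eq_square field_simps)
    ultimately have "- (y - \<eta>)\<^sup>2 / 8 \<le> y\<^sup>2 / 8 + - \<eta>\<^sup>2 / 16" by linarith
    then have 2: "exp (- (y - \<eta>)\<^sup>2 / 8) \<le> exp (y\<^sup>2 / 8 + - \<eta>\<^sup>2 / 16)" by simp
    have "(1 + \<bar>\<eta>\<bar>) * exp (- (y - \<eta>)\<^sup>2 / 8) \<le> 9 * exp (\<eta>\<^sup>2 / 32) * exp (y\<^sup>2 / 8 + - \<eta>\<^sup>2 / 16)"
      using 1 2 by (intro mult_mono) auto
    also have "\<dots> = K * exp (- \<eta>\<^sup>2 / 32)" by (simp add: K_def mult.assoc flip: exp_add)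
    finally show ?thesis .
  qed
  have "(\<integral>\<^sup>+\<eta>. ennreal (weight1 h al \<eta> * ((1 + \<bar>\<eta>\<bar>) * exp (- (y - \<eta>)\<^sup>2 / 8))) \<partial>lborel)
     \<le> (\<integral>\<^sup>+\<eta>. ennreal K * ennreal (weight1 h al \<eta> * exp (- \<eta>\<^sup>2 / 32)) \<partial>lborel)"
  proof (rule nn_integral_mono)
    fix \<eta>
    have "weight1 h al \<eta> * ((1 + \<bar>\<eta>\<bar>) * exp (- (y - \<eta>)\<^sup>2 / 8)) \<le> weight1 h al \<eta> * (K * exp (- \<eta>\<^sup>2 / 32))"
      using le by (intro mult_left_mono weight1_nonneg)
    then show "ennreal (weight1 h al \<eta> * ((1 + \<bar>\<eta>\<bar>) * exp (- (y - \<eta>)\<^sup>2 / 8))) \<le> ennreal K * ennreal (weight1 h al \<eta> * exp (- \<eta>\<^sup>2 / 32))"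
      by (subst ennreal_mult'[symmetric]) (auto simp: K_def mult.left_commute intro!: ennreal_leI)
  qed
  also have "\<dots> = ennreal K * (\<integral>\<^sup>+\<eta>. ennreal (weight1 h al \<eta> * exp (- \<eta>\<^sup>2 / 32)) \<partial>lborel)"
    by (rule nn_integral_cmult) measurable
  also have "\<dots> < \<infinity>" using gauss_weight_finite by (simp add: ennreal_mult_less_top)
  finally show ?thesis .
qed

text \<open>On the tail, half of the Gaussian exponent is at least
  \<open>\<delta>\<^sup>2 / (8 * s)\<close> and beats every power of \<open>1 / s\<close>. The other
  half, for \<open>s < 1\<close>, is dominated by a fixed Gaussian that is integrable against the
  weight.\<close>

lemma heat1_tail:
  assumes y: "h \<Longrightarrow> 0 \<le> y" and d: "0 < \<delta>"
  shows "((\<lambda>s. \<integral>\<^sup>+\<eta>. ennreal (indicator {\<eta>. \<delta> \<le> \<bar>y - \<eta>\<bar>} \<eta> * (weight1 h al \<eta> * heat1 h al s y \<eta>)) \<partial>lborel) \<longlongrightarrow> 0) (at_right 0)"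
proof -
  define J where "J = (\<integral>\<^sup>+\<eta>. ennreal (weight1 h al \<eta> * ((1 + \<bar>\<eta>\<bar>) * exp (- (y - \<eta>)\<^sup>2 / 8))) \<partial>lborel)"
  define e where "e = \<delta>\<^sup>2 / 8"
  have e: "0 < e" using d by (simp add: e_def)
  define K where "K = (1 + C0) * (1 + \<bar>y\<bar>)"
  have K: "0 \<le> K" using C0_pos by (simp add: K_def)
  \<comment> \<open>The power \<open>- b\<close> is the normalisation of the kernel; the further
    \<open>- 1\<close> pays for the linear growth of the \<open>bexp\<close> bound in its
    argument.\<close>
  define q where "q = (\<lambda>s. K * (s powr (- b - 1) * exp (- e / s)))"
  have le: "(\<integral>\<^sup>+\<eta>. ennreal (indicator {\<eta>. \<delta> \<le> \<bar>y - \<eta>\<bar>} \<eta> * (weight1 h al \<eta> * heat1 h al s y \<eta>)) \<partial>lborel) \<le> ennreal (q s) * J"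
    if s: "0 < s" "s < 1" for s
  proof -
    have q0: "0 \<le> q s" using K by (simp add: q_def)
    have pw: "indicator {\<eta>. \<delta> \<le> \<bar>y - \<eta>\<bar>} \<eta> * (weight1 h al \<eta> * heat1 h al s y \<eta>) \<le> q s * (weight1 h al \<eta> * ((1 + \<bar>\<eta>\<bar>) * exp (- (y - \<eta>)\<^sup>2 / 8)))" for \<eta>
    proof (cases "\<delta> \<le> \<bar>y - \<eta>\<bar> \<and> (h \<longrightarrow> 0 < \<eta>)")
      case False
      then have "indicator {\<eta>. \<delta> \<le> \<bar>y - \<eta>\<bar>} \<eta> * (weight1 h al \<eta> * heat1 h al s y \<eta>) = 0"
        by (auto simp: weight1_def)
      moreover have "0 \<le> q s * (weight1 h al \<eta> * ((1 + \<bar>\<eta>\<bar>) * exp (- (y - \<eta>)\<^sup>2 / 8)))"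
        by (intro mult_nonneg_nonneg q0 weight1_nonneg) auto
      ultimately show ?thesis by linarith
    next
      case True
      define t where "t = y * \<eta> / (2 * s)"
      have "\<bar>bexp h al 0 t\<bar> \<le> (1 + C0) * (real 0 + 1) * (1 + \<bar>t\<bar>) * exp t"
        using y True s by (intro bexp_bound) (auto simp: t_def)
      moreover have "1 + \<bar>t\<bar> \<le> (1 + \<bar>y\<bar>) * (1 + \<bar>\<eta>\<bar>) / s"
      proof -
        have "1 \<le> 1 / s" using s by simp
        moreover have "\<bar>t\<bar> \<le> \<bar>y\<bar> * \<bar>\<eta>\<bar> / s"
          using s by (simp add: t_def abs_mult divide_left_mono)
        ultimately have "1 + \<bar>t\<bar> \<le> 1 / s + \<bar>y\<bar> * \<bar>\<eta>\<bar> / s" by simp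
        also have "\<dots> \<le> (1 + \<bar>y\<bar>) * (1 + \<bar>\<eta>\<bar>) / s" using s by (simp add: field_simps)
        finally show ?thesis .
      qed
      then have "(1 + C0) * (1 + \<bar>t\<bar>) * exp t \<le> (1 + C0) * ((1 + \<bar>y\<bar>) * (1 + \<bar>\<eta>\<bar>) / s) * exp t"
        using C0_pos by (intro mult_right_mono mult_left_mono) auto
      ultimately have B: "bexp h al 0 t \<le> K * (1 + \<bar>\<eta>\<bar>) / s * exp t"
        by (simp add: K_def)
      have ex: "exp (- (y\<^sup>2 + \<eta>\<^sup>2) / (4 * s)) * exp t = exp (- (y - \<eta>)\<^sup>2 / (4 * s))"
        using s by (simp add: t_def field_simps power2_eq_square flip: exp_add)
      have "\<delta>\<^sup>2 \<le> (y - \<eta>)\<^sup>2" using True d by (metis abs_of_pos power2_abs power_mono less_imp_le)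
      then have "\<delta>\<^sup>2 / (8 * s) \<le> (y - \<eta>)\<^sup>2 / (8 * s)" using s by (intro divide_right_mono) auto
      moreover have "(y - \<eta>)\<^sup>2 / 8 \<le> (y - \<eta>)\<^sup>2 / (8 * s)" using s by (intro divide_left_mono) auto
      moreover have "e / s = \<delta>\<^sup>2 / (8 * s)" "(y - \<eta>)\<^sup>2 / (4 * s) = (y - \<eta>)\<^sup>2 / (8 * s) + (y - \<eta>)\<^sup>2 / (8 * s)"
        by (simp_all add: e_def)
      ultimately have "- (y - \<eta>)\<^sup>2 / (4 * s) \<le> - e / s + - (y - \<eta>)\<^sup>2 / 8" by simp
      then have ex2: "exp (- (y - \<eta>)\<^sup>2 / (4 * s)) \<le> exp (- e / s) * exp (- (y - \<eta>)\<^sup>2 / 8)"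
        by (simp flip: exp_add)
      have "heat1 h al s y \<eta> \<le> s powr (- b) * exp (- (y\<^sup>2 + \<eta>\<^sup>2) / (4 * s)) * (K * (1 + \<bar>\<eta>\<bar>) / s * exp t)"
        unfolding heat1_def b_def[symmetric] t_def[symmetric] using B by (intro mult_left_mono) auto
      also have "\<dots> = K * (1 + \<bar>\<eta>\<bar>) * (s powr (- b) / s) * (exp (- (y\<^sup>2 + \<eta>\<^sup>2) / (4 * s)) * exp t)" by simp
      also have "s powr (- b) / s = s powr (- b - 1)" using s by (simp add: powr_diff)
      also have "K * (1 + \<bar>\<eta>\<bar>) * s powr (- b - 1) * (exp (- (y\<^sup>2 + \<eta>\<^sup>2) / (4 * s)) * exp t) \<le> K * (1 + \<bar>\<eta>\<bar>) * s powr (- b - 1) * (exp (- e / s) * exp (- (y - \<eta>)\<^sup>2 / 8))"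
        unfolding ex using ex2 K by (intro mult_left_mono) auto
      also have "\<dots> = q s * ((1 + \<bar>\<eta>\<bar>) * exp (- (y - \<eta>)\<^sup>2 / 8))" by (simp add: q_def)
      finally have "heat1 h al s y \<eta> \<le> q s * ((1 + \<bar>\<eta>\<bar>) * exp (- (y - \<eta>)\<^sup>2 / 8))" .
      then have "weight1 h al \<eta> * heat1 h al s y \<eta> \<le> weight1 h al \<eta> * (q s * ((1 + \<bar>\<eta>\<bar>) * exp (- (y - \<eta>)\<^sup>2 / 8)))"
        by (intro mult_left_mono weight1_nonneg)
      then show ?thesis using True by (simp add: mult.left_commute)
    qed
    have "(\<integral>\<^sup>+\<eta>. ennreal (indicator {\<eta>. \<delta> \<le> \<bar>y - \<eta>\<bar>} \<eta> * (weight1 h al \<eta> * heat1 h al s y \<eta>)) \<partial>lborel)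
      \<le> (\<integral>\<^sup>+\<eta>. ennreal (q s) * ennreal (weight1 h al \<eta> * ((1 + \<bar>\<eta>\<bar>) * exp (- (y - \<eta>)\<^sup>2 / 8))) \<partial>lborel)"
      using pw q0 by (intro nn_integral_mono) (simp add: ennreal_mult'[symmetric] ennreal_leI)
    also have "\<dots> = ennreal (q s) * J" unfolding J_def by (rule nn_integral_cmult) measurable
    finally show ?thesis .
  qed
  have "((\<lambda>s. s powr (- b - 1) * exp (- e / s)) \<longlongrightarrow> 0) (at_right 0)"
    using e by real_asymp
  then have "(q \<longlongrightarrow> 0) (at_right 0)" unfolding q_def by (rule tendsto_mult_right_zero)
  then have "((\<lambda>s. ennreal (q s)) \<longlongrightarrow> ennreal 0) (at_right 0)" by (rule tendsto_ennrealI)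
  then have lim: "((\<lambda>s. J * ennreal (q s)) \<longlongrightarrow> J * 0) (at_right 0)"
    using linear_gauss_finite[of y] by (intro ennreal_tendsto_cmult) (auto simp: J_def)
  show ?thesis
  proof (rule tendsto_sandwich[OF _ _ tendsto_const lim[unfolded mult_zero_right]])
    show "\<forall>\<^sub>F s in at_right 0. (\<integral>\<^sup>+\<eta>. ennreal (indicator {\<eta>. \<delta> \<le> \<bar>y - \<eta>\<bar>} \<eta> * (weight1 h al \<eta> * heat1 h al s y \<eta>)) \<partial>lborel) \<le> J * ennreal (q s)"
      using le by (intro eventually_at_rightI[of 0 1]) (auto simp: mult.commute)
  qed auto
qed

end

section \<open>Integrals of products of one-variable functions\<close>

lemma prod_Basis_vec: "(\<Prod>b\<in>Basis. g b) = (\<Prod>i\<in>UNIV. g (axis i (1::real) :: real^'d::finite))"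
proof -
  have "Basis = range (\<lambda>i. axis i (1::real) :: real^'d)" by (auto simp: Basis_vec_def)
  moreover have "inj (\<lambda>i. axis i (1::real) :: real^'d)" by (auto simp: inj_def axis_eq_axis)
  ultimately show ?thesis by (metis (no_types, lifting) prod.reindex_cong)
qed

lemma nn_integral_prod_vec:
  fixes f :: "'d::finite \<Rightarrow> real \<Rightarrow> ennreal"
  assumes "\<And>i. f i \<in> borel_measurable borel"
  shows "(\<integral>\<^sup>+w. (\<Prod>i\<in>UNIV. f i ((w :: real^'d) $ i)) \<partial>lborel) = (\<Prod>i\<in>UNIV. \<integral>\<^sup>+t. f i t \<partial>lborel)"
proof -
  define F where "F = (\<lambda>b :: real^'d. f (THE i. b = axis i 1))"
  have F: "F (axis i 1) = f i" for i by (simp add: F_def axis_eq_axis)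
  have "(\<integral>\<^sup>+w. (\<Prod>b\<in>Basis. F b ((w :: real^'d) \<bullet> b)) \<partial>lborel) = (\<Prod>b\<in>Basis. \<integral>\<^sup>+t. F b t \<partial>lborel)"
    by (rule nn_integral_lborel_prod) (auto simp: F_def assms)
  then show ?thesis by (simp add: prod_Basis_vec F inner_axis)
qed

lemma borel_measurable_vec_nth [measurable (raw)]:
  "f \<in> borel_measurable M \<Longrightarrow> (\<lambda>x. (f x :: real^'d::finite) $ i) \<in> borel_measurable M"
  by (rule measurable_compose[where N=borel]) (auto intro!: borel_measurable_continuous_onI continuous_intros)

subsection \<open>The product heat kernel\<close>


locale bessel_weight =
  fixes Y :: "'d::finite set" and a :: "'d \<Rightarrow> real"
  assumes a: "\<And>i. i \<in> Y \<Longrightarrow> -1 < a i"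
begin

definition al :: "'d \<Rightarrow> real" where "al i = (if i \<in> Y then a i else 0)"

sublocale B: bessel1 "i \<in> Y" "al i" for i
  by unfold_locales (auto simp: al_def a)

abbreviation w1 :: "'d \<Rightarrow> real \<Rightarrow> real" where "w1 i \<equiv> weight1 (i \<in> Y) (al i)"
abbreviation hk :: "'d \<Rightarrow> real \<Rightarrow> real \<Rightarrow> real \<Rightarrow> real" where "hk i \<equiv> heat1 (i \<in> Y) (al i)"

text \<open>Agrees with \<open>weight\<close> on the orthant and vanishes off it. Hence
  \<open>N\<close>, a measure on the whole space, is \<omega>^a dz on the orthant, and translations
  and Fubini apply without domains.\<close>

definition Wt :: "real^'d \<Rightarrow> real" where "Wt w = (\<Prod>i\<in>UNIV. w1 i (w $ i))"

definition N :: "(real^'d) measure" where "N = density lborel (\<lambda>w. ennreal (Wt w))"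

definition orthant :: "(real^'d) set" where "orthant = {w. \<forall>i\<in>Y. 0 < w $ i}"

definition heat :: "real \<Rightarrow> real^'d \<Rightarrow> real^'d \<Rightarrow> real" where
  "heat s z w = (\<Prod>i\<in>UNIV. hk i s (z $ i) (w $ i))"

definition cmass :: real where "cmass = (\<Prod>i\<in>UNIV. B.mass i)"

lemma cmass_pos: "0 < cmass"
  unfolding cmass_def by (intro prod_pos B.mass_pos)

lemma Wt_nonneg: "0 \<le> Wt w"
  unfolding Wt_def by (intro prod_nonneg) (simp add: weight1_nonneg)

lemma Wt_measurable [measurable]: "Wt \<in> borel_measurable borel"
  unfolding Wt_def[abs_def] by measurable

lemma sets_N [simp, measurable_cong]: "sets N = sets borel"
  by (simp add: N_def)

lemma space_N [simp]: "space N = UNIV"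
  by (simp add: N_def)

sublocale N: sigma_finite_measure N
  unfolding N_def by (subst sigma_finite_measure.sigma_finite_iff_density_finite'[OF sigma_finite_lborel]) auto

sublocale NN: pair_sigma_finite N N ..

lemma Wt_outside: "w \<notin> orthant \<Longrightarrow> Wt w = 0"
  by (auto simp: Wt_def orthant_def weight1_def intro!: prod_zero)

lemma Wt_orthant: "w \<in> orthant \<Longrightarrow> Wt w = weight Y a w"
proof -
  assume w: "w \<in> orthant"
  have "Wt w = (\<Prod>i\<in>UNIV. if i \<in> Y then (w $ i) powr a i else 1)"
    using w unfolding Wt_def by (intro prod.cong) (auto simp: weight1_def orthant_def al_def)
  then show ?thesis by (simp add: weight_def prod.If_cases)
qed

lemma AE_N_orthant: "AE w in N. w \<in> orthant"
proof -
  have "0 < ennreal (Wt w) \<longrightarrow> w \<in> orthant" for w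
    using Wt_outside[of w] by (cases "w \<in> orthant") simp_all
  then show ?thesis unfolding N_def by (simp add: AE_density)
qed

lemma heat_nonneg: "0 \<le> heat s z w"
  unfolding heat_def by (intro prod_nonneg) (simp add: B.heat1_nonneg)

lemma heat_sym: "heat s z w = heat s w z"
  unfolding heat_def by (intro prod.cong B.heat1_sym) auto

lemma heat_measurable [measurable (raw)]:
  assumes [measurable]: "S \<in> borel_measurable M" "Z \<in> borel_measurable M" "W \<in> borel_measurable M"
  shows "(\<lambda>x. heat (S x) (Z x) (W x)) \<in> borel_measurable M"
  unfolding heat_def by (intro borel_measurable_prod B.kerfun_measurable[OF B.kerfun_heat1]) measurable

lemma nn_integral_N_prod:
  assumes "\<And>i. f i \<in> borel_measurable borel" "\<And>i t. 0 \<le> f i t"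
  shows "(\<integral>\<^sup>+w. ennreal (\<Prod>i\<in>UNIV. f i (w $ i)) \<partial>N) = (\<Prod>i\<in>UNIV. \<integral>\<^sup>+t. ennreal (w1 i t * f i t) \<partial>lborel)"
proof -
  have f: "(\<lambda>w::real^'d. f i (w $ i)) \<in> borel_measurable borel" for i
    by (rule measurable_compose[OF borel_measurable_vec_nth assms(1)]) simp
  have "(\<integral>\<^sup>+w. ennreal (\<Prod>i\<in>UNIV. f i (w $ i)) \<partial>N) = (\<integral>\<^sup>+w. ennreal (Wt w) * ennreal (\<Prod>i\<in>UNIV. f i (w $ i)) \<partial>lborel)"
    unfolding N_def by (rule nn_integral_density) (simp, intro measurable_compose[OF _ measurable_ennreal] borel_measurable_prod, simp add: f)
  also have "\<dots> = (\<integral>\<^sup>+w. (\<Prod>i\<in>UNIV. ennreal (w1 i (w $ i) * f i (w $ i))) \<partial>lborel)"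
  proof (rule nn_integral_cong)
    fix w
    have "ennreal (Wt w) * ennreal (\<Prod>i\<in>UNIV. f i (w $ i)) = ennreal (\<Prod>i\<in>UNIV. w1 i (w $ i) * f i (w $ i))"
      unfolding Wt_def prod.distrib by (rule ennreal_mult'[symmetric]) (simp add: prod_nonneg weight1_nonneg)
    also have "\<dots> = (\<Prod>i\<in>UNIV. ennreal (w1 i (w $ i) * f i (w $ i)))"
      by (rule prod_ennreal[symmetric]) (simp add: weight1_nonneg assms(2))
    finally show "ennreal (Wt w) * ennreal (\<Prod>i\<in>UNIV. f i (w $ i)) = (\<Prod>i\<in>UNIV. ennreal (w1 i (w $ i) * f i (w $ i)))" .
  qed
  also have "\<dots> = (\<Prod>i\<in>UNIV. \<integral>\<^sup>+t. ennreal (w1 i t * f i t) \<partial>lborel)"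
    by (rule nn_integral_prod_vec) (intro measurable_compose[OF _ measurable_ennreal] borel_measurable_times weight1_measurable assms(1))
  finally show ?thesis .
qed

lemma heat_mass: "0 < s \<Longrightarrow> (\<integral>\<^sup>+w. ennreal (heat s z w) \<partial>N) = ennreal cmass"
  unfolding heat_def cmass_def
  by (subst nn_integral_N_prod) (simp_all add: B.heat1_mass B.heat1_nonneg prod_ennreal B.mass_pos less_imp_le)

lemma heat_tail:
  assumes z: "\<And>i. i \<in> Y \<Longrightarrow> 0 \<le> z $ i" and d: "0 < \<delta>"
  shows "((\<lambda>s. \<integral>\<^sup>+w. ennreal (indicator {w. \<delta> \<le> dist z w} w * heat s z w) \<partial>N) \<longlongrightarrow> 0) (at_right 0)"
proof -
  \<comment> \<open>If every coordinate differed by less than this, the l1 bound on the norm would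
    put the distance below \<open>\<delta>\<close>. So the tail is covered by one-coordinate tails,
    and the remaining coordinates integrate to their masses.\<close>
  define \<delta>' where "\<delta>' = \<delta> / CARD('d)"
  have d': "0 < \<delta>'" using d by (simp add: \<delta>'_def)
  define T where "T = (\<lambda>i s. \<integral>\<^sup>+\<eta>. ennreal (indicator {\<eta>. \<delta>' \<le> \<bar>z $ i - \<eta>\<bar>} \<eta> * (w1 i \<eta> * hk i s (z $ i) \<eta>)) \<partial>lborel)"
  define S where "S = (\<lambda>s. \<Sum>i\<in>UNIV. T i s * (\<Prod>j\<in>UNIV - {i}. ennreal (B.mass j)))"
  have T: "(T i \<longlongrightarrow> 0) (at_right 0)" for i
    unfolding T_def by (rule B.heat1_tail[OF _ d']) (use z in auto)
  have "((\<lambda>s. (\<Prod>j\<in>UNIV - {i}. ennreal (B.mass j)) * T i s) \<longlongrightarrow> (\<Prod>j\<in>UNIV - {i}. ennreal (B.mass j)) * 0) (at_right 0)" for i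
    by (rule ennreal_tendsto_cmult[OF _ T]) (simp add: prod_ennreal B.mass_pos less_imp_le)
  then have S: "(S \<longlongrightarrow> 0) (at_right 0)"
    unfolding S_def by (intro tendsto_null_sum) (simp add: mult.commute)
  have le: "(\<integral>\<^sup>+w. ennreal (indicator {w. \<delta> \<le> dist z w} w * heat s z w) \<partial>N) \<le> S s" if s: "0 < s" for s
  proof -
    define g where "g = (\<lambda>i w. \<Prod>j\<in>UNIV. (if j = i then indicator {\<eta>. \<delta>' \<le> \<bar>z $ i - \<eta>\<bar>} (w $ j) else 1) * hk j s (z $ j) (w $ j))"
    have g: "g i w = indicator {\<eta>. \<delta>' \<le> \<bar>z $ i - \<eta>\<bar>} (w $ i) * heat s z w" for i w
      unfolding g_def heat_def prod.distrib by (simp add: prod.delta)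
    have g0: "0 \<le> g i w" for i w by (simp add: g heat_nonneg)
    have [measurable]: "g i \<in> borel_measurable N" for i unfolding g_def by measurable
    have "indicator {w. \<delta> \<le> dist z w} w * heat s z w \<le> (\<Sum>i\<in>UNIV. g i w)" for w
    proof (cases "\<delta> \<le> dist z w")
      case True
      have "\<exists>i. \<delta>' \<le> \<bar>z $ i - w $ i\<bar>"
      proof (rule ccontr)
        assume "\<not> ?thesis"
        then have lt: "\<bar>(z - w) $ i\<bar> < \<delta>'" for i by (simp add: not_le)
        have "dist z w \<le> (\<Sum>i\<in>UNIV. \<bar>(z - w) $ i\<bar>)" unfolding dist_norm by (rule norm_le_l1_cart)
        also have "\<dots> < (\<Sum>i\<in>(UNIV::'d set). \<delta>')" by (rule sum_strict_mono) (use lt in auto)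
        also have "\<dots> = \<delta>" by (simp add: \<delta>'_def)
        finally show False using True by simp
      qed
      then obtain i where "\<delta>' \<le> \<bar>z $ i - w $ i\<bar>" by blast
      then have "heat s z w = g i w" by (simp add: g)
      also have "\<dots> \<le> (\<Sum>i\<in>UNIV. g i w)" by (rule member_le_sum) (use g0 in auto)
      finally show ?thesis using True by simp
    qed (simp add: g0 sum_nonneg)
    then have "(\<integral>\<^sup>+w. ennreal (indicator {w. \<delta> \<le> dist z w} w * heat s z w) \<partial>N) \<le> (\<integral>\<^sup>+w. (\<Sum>i\<in>UNIV. ennreal (g i w)) \<partial>N)"
      by (intro nn_integral_mono) (simp add: sum_ennreal g0 ennreal_leI)
    also have "\<dots> = (\<Sum>i\<in>UNIV. \<integral>\<^sup>+w. ennreal (g i w) \<partial>N)" by (rule nn_integral_sum) measurable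
    also have "\<dots> = S s"
      unfolding S_def
    proof (rule sum.cong[OF refl])
      fix i
      have "(\<integral>\<^sup>+w. ennreal (g i w) \<partial>N) = (\<Prod>j\<in>UNIV. \<integral>\<^sup>+t. ennreal (w1 j t * ((if j = i then indicator {\<eta>. \<delta>' \<le> \<bar>z $ i - \<eta>\<bar>} t else 1) * hk j s (z $ j) t)) \<partial>lborel)"
        unfolding g_def by (rule nn_integral_N_prod) (auto simp: B.heat1_nonneg)
      also have "\<dots> = (\<integral>\<^sup>+t. ennreal (w1 i t * (indicator {\<eta>. \<delta>' \<le> \<bar>z $ i - \<eta>\<bar>} t * hk i s (z $ i) t)) \<partial>lborel) *
          (\<Prod>j\<in>UNIV - {i}. \<integral>\<^sup>+t. ennreal (w1 j t * hk j s (z $ j) t) \<partial>lborel)"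
        by (subst prod.remove[of _ i]) (auto intro!: prod.cong arg_cong2[where f="(*)"])
      finally show "(\<integral>\<^sup>+w. ennreal (g i w) \<partial>N) = T i s * (\<Prod>j\<in>UNIV - {i}. ennreal (B.mass j))"
        using s by (simp add: B.heat1_mass T_def mult.left_commute)
    qed
    finally show ?thesis .
  qed
  show ?thesis
    by (rule tendsto_sandwich[OF _ _ tendsto_const S]) (use le in \<open>auto intro!: eventually_at_rightI[of 0 1]\<close>)
qed

text \<open>The kernel at time 1 centred at 0 is the Gaussian \<open>exp (- (norm w)^2 / 4)\<close>,
  bounded below on the ball and of finite mass.\<close>

lemma emeasure_N_ball_finite: "emeasure N (ball 0 R) < \<infinity>"
proof -
  define K where "K = exp (R\<^sup>2 / 4)"
  have p: "heat 1 0 w = exp (- (norm w)\<^sup>2 / 4)" for w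
    by (simp add: heat_def heat1_def B.bexp_0_0 norm_sq_vec exp_sum[symmetric] sum_negf sum_divide_distrib)
  have "indicator (ball 0 R) w \<le> ennreal K * ennreal (heat 1 0 w)" for w :: "real^'d"
  proof (cases "w \<in> ball 0 R")
    case True
    then have "(norm w)\<^sup>2 \<le> R\<^sup>2" by (intro power_mono) auto
    then have "1 \<le> K * heat 1 0 w" by (simp add: K_def p flip: exp_add)
    then have "ennreal 1 \<le> ennreal (K * heat 1 0 w)" by (rule ennreal_leI)
    then show ?thesis using True by (simp add: K_def ennreal_mult' flip: ennreal_1)
  qed simp
  then have "(\<integral>\<^sup>+w. indicator (ball 0 R) w \<partial>N) \<le> (\<integral>\<^sup>+w. ennreal K * ennreal (heat 1 0 w) \<partial>N)"
    by (intro nn_integral_mono)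
  also have "\<dots> = ennreal K * ennreal cmass"
    by (subst nn_integral_cmult) (auto simp: heat_mass)
  also have "\<dots> < \<infinity>" by (simp add: ennreal_mult_less_top)
  finally show ?thesis by simp
qed

text \<open>Schur's test for the symmetric kernel \<open>heat\<close>.\<close>

lemma heat_L1_contraction:
  assumes [measurable]: "f \<in> borel_measurable borel" and s: "0 < s"
  shows "(\<integral>\<^sup>+z. ennreal \<bar>\<integral>w. f w * heat s z w \<partial>N\<bar> \<partial>N) \<le> ennreal cmass * (\<integral>\<^sup>+w. ennreal \<bar>f w\<bar> \<partial>N)"
proof -
  have "(\<integral>\<^sup>+z. ennreal \<bar>\<integral>w. f w * heat s z w \<partial>N\<bar> \<partial>N) \<le> (\<integral>\<^sup>+z. (\<integral>\<^sup>+w. ennreal \<bar>f w\<bar> * ennreal (heat s z w) \<partial>N) \<partial>N)"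
  proof (rule nn_integral_mono)
    fix z
    show "ennreal \<bar>\<integral>w. f w * heat s z w \<partial>N\<bar> \<le> (\<integral>\<^sup>+w. ennreal \<bar>f w\<bar> * ennreal (heat s z w) \<partial>N)"
    proof (cases "integrable N (\<lambda>w. f w * heat s z w)")
      case True
      from integral_norm_bound_ennreal[OF this] show ?thesis
        by (simp add: abs_mult heat_nonneg ennreal_mult')
    qed (simp add: not_integrable_integral_eq)
  qed
  also have "\<dots> = (\<integral>\<^sup>+w. (\<integral>\<^sup>+z. ennreal \<bar>f w\<bar> * ennreal (heat s z w) \<partial>N) \<partial>N)"
    by (rule NN.Fubini'[symmetric]) measurable
  also have "\<dots> = (\<integral>\<^sup>+w. ennreal \<bar>f w\<bar> * ennreal cmass \<partial>N)"
  proof (rule nn_integral_cong)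
    fix w
    have "(\<integral>\<^sup>+z. ennreal \<bar>f w\<bar> * ennreal (heat s z w) \<partial>N) = ennreal \<bar>f w\<bar> * (\<integral>\<^sup>+z. ennreal (heat s w z) \<partial>N)"
      by (subst nn_integral_cmult[symmetric]) (auto simp: heat_sym)
    then show "(\<integral>\<^sup>+z. ennreal \<bar>f w\<bar> * ennreal (heat s z w) \<partial>N) = ennreal \<bar>f w\<bar> * ennreal cmass"
      by (simp add: heat_mass s)
  qed
  also have "\<dots> = ennreal cmass * (\<integral>\<^sup>+w. ennreal \<bar>f w\<bar> \<partial>N)"
    by (subst nn_integral_multc) (auto simp: mult.commute)
  finally show ?thesis .
qed

lemma integrable_heat: "0 < s \<Longrightarrow> integrable N (heat s z)"
  by (rule integrableI_nonneg) (auto simp: heat_nonneg heat_mass)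

lemma integral_heat: "0 < s \<Longrightarrow> (\<integral>w. heat s z w \<partial>N) = cmass"
  by (subst integral_eq_nn_integral) (auto simp: heat_nonneg heat_mass cmass_pos less_imp_le)

lemma integrable_bounded_heat:
  assumes [measurable]: "f \<in> borel_measurable borel" and M: "\<And>w. \<bar>f w\<bar> \<le> M" and s: "0 < s"
  shows "integrable N (\<lambda>w. f w * heat s z w)"
proof (rule Bochner_Integration.integrable_bound[OF integrable_mult_right[OF integrable_heat[OF s], of M]])
  have "0 \<le> M" using M[of 0] by linarith
  then show "AE w in N. norm (f w * heat s z w) \<le> norm (M * heat s z w)"
    using M by (auto simp: abs_mult heat_nonneg intro!: AE_I2 mult_right_mono)
qed measurable

lemma heat_approx_identity:
  assumes [measurable]: "f \<in> borel_measurable borel" and M: "\<And>w. \<bar>f w\<bar> \<le> M" and c: "isCont f z"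
    and z: "\<And>i. i \<in> Y \<Longrightarrow> 0 \<le> z $ i"
  shows "((\<lambda>s. \<integral>w. f w * heat s z w \<partial>N) \<longlongrightarrow> cmass * f z) (at_right 0)"
proof (rule tendstoI)
  fix e :: real assume e: "0 < e"
  \<comment> \<open>Near \<open>z\<close> the error is at most \<open>e' * cmass = e / 2\<close>;
    the tail contributes at most \<open>2 * M * r\<close>, which is below \<open>e / 2\<close>. The
    \<open>M + 1\<close> in \<open>r\<close> covers the case \<open>M = 0\<close>.\<close>
  define e' where "e' = e / (2 * cmass)"
  have e': "0 < e'" using e cmass_pos by (simp add: e'_def)
  obtain d where d: "0 < d" and fd: "\<And>w. dist w z < d \<Longrightarrow> dist (f w) (f z) < e'"
    using c e' unfolding continuous_at_eps_delta by blast
  have M0: "0 \<le> M" using M[of 0] by linarith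
  define r where "r = e / (4 * (M + 1))"
  have r: "0 < r" using e M0 by (simp add: r_def)
  have "\<forall>\<^sub>F s in at_right 0. (\<integral>\<^sup>+w. ennreal (indicator {w. d \<le> dist z w} w * heat s z w) \<partial>N) < ennreal r"
    using heat_tail[OF z d] r by (intro order_tendstoD(2)) auto
  moreover have "\<forall>\<^sub>F s in at_right 0. (0::real) < s" by (rule eventually_at_right_less)
  ultimately show "\<forall>\<^sub>F s in at_right 0. dist (\<integral>w. f w * heat s z w \<partial>N) (cmass * f z) < e"
  proof eventually_elim
    case (elim s)
    note s = elim(2)
    let ?t = "\<lambda>w. indicator {w. d \<le> dist z w} w * heat s z w"
    have it: "integrable N ?t"
      by (rule Bochner_Integration.integrable_bound[OF integrable_heat[OF s]]) (auto simp: heat_nonneg indicator_def)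
    have "ennreal (\<integral>w. ?t w \<partial>N) = (\<integral>\<^sup>+w. ennreal (?t w) \<partial>N)"
      by (rule nn_integral_eq_integral[symmetric, OF it]) (simp add: heat_nonneg)
    then have "ennreal (\<integral>w. ?t w \<partial>N) < ennreal r" using elim(1) by (simp only:)
    moreover have "0 \<le> (\<integral>w. ?t w \<partial>N)" by (rule Bochner_Integration.integral_nonneg) (simp add: heat_nonneg)
    ultimately have tr: "(\<integral>w. ?t w \<partial>N) < r" by (simp only: ennreal_less_iff)
    have i1: "integrable N (\<lambda>w. f w * heat s z w)" by (rule integrable_bounded_heat[OF _ M s]) simp
    have "(\<integral>w. f w * heat s z w \<partial>N) - cmass * f z = (\<integral>w. f w * heat s z w - f z * heat s z w \<partial>N)"
      using i1 integrable_heat[OF s] by (simp add: integral_heat s mult.commute)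
    also have "\<bar>\<dots>\<bar> \<le> (\<integral>w. e' * heat s z w + 2 * M * ?t w \<partial>N)"
    proof (rule integral_abs_bound[THEN order_trans], rule integral_mono)
      show "integrable N (\<lambda>w. \<bar>f w * heat s z w - f z * heat s z w\<bar>)"
        using i1 integrable_heat[OF s] by auto
      show "integrable N (\<lambda>w. e' * heat s z w + 2 * M * ?t w)"
        using it integrable_heat[OF s] by auto
      fix w
      have "\<bar>f w - f z\<bar> \<le> e' + 2 * M * indicator {w. d \<le> dist z w} w"
      proof (cases "d \<le> dist z w")
        case True
        then show ?thesis using M[of w] M[of z] e' by simp
      next
        case False
        then show ?thesis using fd[of w] by (simp add: dist_commute dist_real_def)
      qed
      then have "\<bar>f w - f z\<bar> * heat s z w \<le> (e' + 2 * M * indicator {w. d \<le> dist z w} w) * heat s z w"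
        by (rule mult_right_mono) (rule heat_nonneg)
      moreover have "\<bar>f w * heat s z w - f z * heat s z w\<bar> = \<bar>f w - f z\<bar> * heat s z w"
        unfolding left_diff_distrib[symmetric] abs_mult by (simp add: heat_nonneg)
      ultimately show "\<bar>f w * heat s z w - f z * heat s z w\<bar> \<le> e' * heat s z w + 2 * M * ?t w"
        by (simp add: distrib_right mult.assoc)
    qed
    also have "\<dots> = e' * cmass + 2 * M * (\<integral>w. ?t w \<partial>N)"
      using it integrable_heat[OF s] by (simp add: integral_heat s)
    also have "\<dots> \<le> e / 2 + 2 * M * r"
      using tr M0 cmass_pos by (intro add_mono mult_left_mono) (auto simp: e'_def)
    also have "\<dots> < e"
    proof -
      have "2 * M * r = e / 2 * (M / (M + 1))" using M0 by (simp add: r_def field_simps)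
      also have "\<dots> < e / 2 * 1" using M0 e by (intro mult_strict_left_mono) auto
      finally show ?thesis by simp
    qed
    finally show ?case by (simp add: dist_real_def)
  qed
qed

end

subsection \<open>Integration by parts\<close>


text \<open>By translation invariance of Lebesgue measure every difference quotient of
  \<open>F\<close> has integral 0, and dominated convergence passes to the derivative. The bound
  along segments of length 1 feeds the mean value theorem at the step sizes
  \<open>1 / (n + 1)\<close>.\<close>

lemma integral_deriv_direction_zero:
  fixes F F' G :: "real^'d::finite \<Rightarrow> real" and e :: "real^'d"
  assumes F: "integrable lborel F" and [measurable]: "F' \<in> borel_measurable borel" and G: "integrable lborel G"
    and der: "\<And>w t. ((\<lambda>t. F (w + t *\<^sub>R e)) has_real_derivative F' (w + t *\<^sub>R e)) (at t)"
    and bnd: "\<And>w t. 0 \<le> t \<Longrightarrow> t \<le> 1 \<Longrightarrow> \<bar>F' (w + t *\<^sub>R e)\<bar> \<le> G w"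
  shows "(\<integral>w. F' w \<partial>lborel) = 0"
proof -
  define D where "D = (\<lambda>n w. real (Suc n) * (F (w + (1 / real (Suc n)) *\<^sub>R e) - F w))"
  have Fm [measurable]: "F \<in> borel_measurable borel" using F by auto
  have shift: "integrable lborel (\<lambda>w. F (w + c)) \<and> (\<integral>w. F (w + c) \<partial>lborel) = (\<integral>w. F w \<partial>lborel)" for c
  proof -
    have "distr lborel borel ((+) c) = (lborel :: (real^'d) measure)" by (rule lborel_distr_plus)
    moreover have "integrable (distr lborel borel ((+) c)) F \<longleftrightarrow> integrable lborel (\<lambda>w. F (c + w))"
      by (rule integrable_distr_eq) auto
    moreover have "integral\<^sup>L (distr lborel borel ((+) c)) F = (\<integral>w. F (c + w) \<partial>lborel)"
      by (rule integral_distr) auto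
    ultimately show ?thesis using F by (simp add: add.commute)
  qed
  have D0: "(\<integral>w. D n w \<partial>lborel) = 0" for n
    unfolding D_def using shift F by (simp add: Bochner_Integration.integral_diff)
  have "(\<lambda>n. \<integral>w. D n w \<partial>lborel) \<longlonglongrightarrow> (\<integral>w. F' w \<partial>lborel)"
  proof (rule integral_dominated_convergence[where w=G])
    show "AE w in lborel. (\<lambda>n. D n w) \<longlonglongrightarrow> F' w"
    proof (rule AE_I2)
      fix w
      have "((\<lambda>h. (F (w + h *\<^sub>R e) - F w) / h) \<longlongrightarrow> F' w) (at 0)"
        using der[of w 0] by (simp add: DERIV_def)
      then have "((\<lambda>h. (F (w + h *\<^sub>R e) - F w) / h) \<longlongrightarrow> F' w) (at_right 0)"
        by (rule filterlim_mono) (auto simp: at_le)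
      moreover have "filterlim (\<lambda>n. 1 / real (Suc n)) (at_right 0) sequentially"
        by real_asymp
      ultimately have "(\<lambda>n. (F (w + (1 / real (Suc n)) *\<^sub>R e) - F w) / (1 / real (Suc n))) \<longlonglongrightarrow> F' w"
        by (rule filterlim_compose)
      then show "(\<lambda>n. D n w) \<longlonglongrightarrow> F' w" by (simp add: D_def mult.commute)
    qed
    show "AE w in lborel. norm (D n w) \<le> G w" for n
    proof (rule AE_I2)
      fix w
      define h where "h = 1 / real (Suc n)"
      have h: "0 < h" "h \<le> 1" by (auto simp: h_def)
      have "\<exists>t. 0 < t \<and> t < h \<and> F (w + h *\<^sub>R e) - F (w + 0 *\<^sub>R e) = (h - 0) * F' (w + t *\<^sub>R e)"
        by (rule MVT2[OF h(1)]) (rule der)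
      then obtain t where t: "0 < t" "t < h" "F (w + h *\<^sub>R e) - F w = h * F' (w + t *\<^sub>R e)" by auto
      have "D n w = F' (w + t *\<^sub>R e)"
        using t(3) h by (simp add: D_def h_def)
      then show "norm (D n w) \<le> G w" using bnd[of t w] t h by simp
    qed
  qed (auto simp: G D_def)
  then show ?thesis by (simp add: D0 LIMSEQ_const_iff)
qed

text \<open>The flat factor \<open>exp (- 1 / (n t))\<close> removes the singularity of the weight at \<open>t = 0\<close>, so that no boundary
  term arises; it tends to \<open>1\<close> as \<open>n\<close> grows.\<close>

lemma (in bessel1) flat_powr_derivative:
  assumes h: h and n: "0 < (n::real)"
  defines "k \<equiv> \<lambda>t. flat_fun 1 (n * t) * weight1 h al t"
    and "k' \<equiv> \<lambda>t. weight1 h al t * flat_fun 1 (n * t) * (al / t + 1 / (n * t\<^sup>2))"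
  shows "(k has_real_derivative k' t) (at t)" "\<exists>K. \<forall>t. \<bar>t\<bar> \<le> 2 \<longrightarrow> \<bar>k t\<bar> \<le> K \<and> \<bar>k' t\<bar> \<le> K"
proof -
  \<comment> \<open>The functions \<open>t powr p * exp (- 1 / (n * t))\<close>, extended by 0, are
    closed under differentiation: the exponents become \<open>p - 1\<close> and
    \<open>p - 2\<close>. The flat factor makes each of them continuous at 0 for every real
    \<open>p\<close>.\<close>
  define q where "q = (\<lambda>p t. if 0 < t then t powr p * exp (- (1 / (n * t))) else 0)"
  have k: "k = q al" using h n by (auto simp: k_def q_def weight1_def flat_fun_def fun_eq_iff mult_le_0_iff)
  have k': "k' = (\<lambda>t. al * q (al - 1) t + 1 / n * q (al - 2) t)"
  proof
    fix t show "k' t = al * q (al - 1) t + 1 / n * q (al - 2) t"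
    proof (cases "0 < t")
      case True
      have "t powr (al - 1) = t powr al / t" "t powr (al - 2) = t powr al / t\<^sup>2"
        using True by (simp_all add: powr_diff powr_numeral)
      then have "al * q (al - 1) t + 1 / n * q (al - 2) t = t powr al * exp (- (1 / (n * t))) * (al / t + 1 / (n * t\<^sup>2))"
        using True by (simp add: q_def distrib_left)
      then show ?thesis using True h n
        by (simp add: k'_def weight1_def flat_fun_def mult_le_0_iff not_less)
    qed (simp add: k'_def q_def weight1_def h)
  qed
  have lim: "((\<lambda>t. t powr p * exp (- (1 / (n * t)))) \<longlongrightarrow> 0) (at_right 0)" for p
    using n by real_asymp
  have q0: "(q p \<longlongrightarrow> 0) (at 0)" for p
  proof -
    have "(q p \<longlongrightarrow> 0) (at_right 0)"
      by (rule Lim_transform_eventually[OF lim[of p]]) (auto simp: eventually_at_right_field q_def intro!: exI[of _ 1])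
    moreover have "(q p \<longlongrightarrow> 0) (at_left 0)"
      by (rule Lim_transform_eventually[OF tendsto_const]) (auto simp: eventually_at_left_field q_def intro!: exI[of _ "-1"])
    ultimately show ?thesis using filterlim_split_at by blast
  qed
  have qd: "(q p has_real_derivative (p * q (p - 1) t + 1 / n * q (p - 2) t)) (at t)" for p t
  proof -
    consider "t < 0" | "t = 0" | "t > 0" by linarith
    then show ?thesis
    proof cases
      case 1
      have "\<forall>\<^sub>F x in nhds t. q p x = 0"
        using eventually_nhds_in_open[of "{..<0}" t] 1 by (auto simp: q_def elim!: eventually_mono)
      then show ?thesis using 1
        by (subst DERIV_cong_ev[OF refl _ refl, where g="\<lambda>t. 0"]) (auto simp: q_def)
    next
      case 2
      have "((\<lambda>x. q (p - 1) x) \<longlongrightarrow> 0) (at 0)" by (rule q0)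
      moreover have "q p x / x = q (p - 1) x" for x by (simp add: q_def powr_diff)
      ultimately show ?thesis using 2 by (simp add: DERIV_def) (simp add: q_def)
    next
      case 3
      have "\<forall>\<^sub>F x in nhds t. q p x = x powr p * exp (- (1 / (n * x)))"
        using eventually_nhds_in_open[of "{0<..}" t] 3 by (auto simp: q_def elim!: eventually_mono)
      moreover have "((\<lambda>x. x powr p * exp (- (1 / (n * x)))) has_real_derivative (p * q (p - 1) t + 1 / n * q (p - 2) t)) (at t)"
        using 3 n by (auto intro!: derivative_eq_intros simp: q_def powr_diff powr_numeral power2_eq_square field_simps)
      ultimately show ?thesis by (subst DERIV_cong_ev[OF refl _ refl]) auto
    qed
  qed
  show "(k has_real_derivative k' t) (at t)" unfolding k k' by (rule qd)
  have cont: "continuous_on {-2..2} (q p)" for p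
    by (rule DERIV_continuous_on[OF has_field_derivative_at_within[OF qd]])
  have "\<exists>B. \<forall>t\<in>{-2..2}. \<bar>q p t\<bar> \<le> B" for p
    using compact_imp_bounded[OF compact_continuous_image[OF cont[of p] compact_Icc]]
    by (auto simp: bounded_iff)
  then obtain B where B: "\<And>p t. t \<in> {-2..2} \<Longrightarrow> \<bar>q p t\<bar> \<le> B p" by metis
  show "\<exists>K. \<forall>t. \<bar>t\<bar> \<le> 2 \<longrightarrow> \<bar>k t\<bar> \<le> K \<and> \<bar>k' t\<bar> \<le> K"
  proof (intro exI allI impI)
    fix t :: real assume "\<bar>t\<bar> \<le> 2"
    then have t: "t \<in> {-2..2}" by auto
    have nn: "0 \<le> B p" for p using B[OF t, of p] by linarith
    have "\<bar>k' t\<bar> \<le> \<bar>al * q (al - 1) t\<bar> + \<bar>1 / n * q (al - 2) t\<bar>" unfolding k' by (rule abs_triangle_ineq)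
    also have "\<dots> \<le> \<bar>al\<bar> * B (al - 1) + 1 / n * B (al - 2)"
      unfolding abs_mult using B[OF t] n by (intro add_mono mult_mono) auto
    finally show "\<bar>k t\<bar> \<le> B al + (\<bar>al\<bar> * B (al - 1) + 1 / n * B (al - 2)) \<and> \<bar>k' t\<bar> \<le> B al + (\<bar>al\<bar> * B (al - 1) + 1 / n * B (al - 2))"
      using B[OF t, of al] nn[of al] mult_nonneg_nonneg[OF abs_ge_zero nn, of al "al - 1"] divide_nonneg_pos[OF nn n, of "al - 2"]
      unfolding k by auto
  qed
qed

lemma bounded_of_compact_support:
  fixes g :: "real^'d::finite \<Rightarrow> real"
  assumes "continuous_on UNIV g" "\<And>w. R < norm w \<Longrightarrow> g w = 0"
  obtains B where "0 \<le> B" "\<And>w. \<bar>g w\<bar> \<le> B"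
proof -
  have "bounded (g ` cball 0 R)"
    by (rule compact_imp_bounded[OF compact_continuous_image[OF continuous_on_subset[OF assms(1)]]]) auto
  then obtain B where "\<forall>w\<in>cball 0 R. \<bar>g w\<bar> \<le> B" by (auto simp: bounded_iff)
  then have B: "\<bar>g w\<bar> \<le> B" if "w \<in> cball 0 R" for w using that by blast
  have "\<bar>g w\<bar> \<le> max B 0" for w
    using B[of w] assms(2)[of w] by (cases "norm w \<le> R") auto
  then show ?thesis using that[of "max B 0"] by simp
qed

context bessel_weight
begin

lemma integrable_N_bounded:
  fixes f :: "real^'d \<Rightarrow> real"
  assumes [measurable]: "f \<in> borel_measurable borel" and b: "\<And>w. w \<in> orthant \<Longrightarrow> \<bar>f w\<bar> \<le> B" and z: "\<And>w. w \<in> orthant \<Longrightarrow> R < norm w \<Longrightarrow> f w = 0"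
  shows "integrable N f"
proof -
  have i: "integrable N (\<lambda>w. max B 0 * indicator (ball 0 (R + 1)) w)"
    using emeasure_N_ball_finite[of "R + 1"] by (intro integrable_mult_right integrable_real_indicator) auto
  have "AE w in N. norm (f w) \<le> norm (max B 0 * indicator (ball 0 (R + 1)) w)"
    using AE_N_orthant
  proof eventually_elim
    case (elim w)
    show ?case using b[OF elim] z[OF elim] by (cases "norm w < R + 1") (auto simp: indicator_def)
  qed
  then show ?thesis by (intro Bochner_Integration.integrable_bound[OF i]) simp_all
qed

lemma integral_N: "(\<integral>w. f w \<partial>N) = (\<integral>w. Wt w * f w \<partial>lborel)" if "f \<in> borel_measurable borel" for f :: "real^'d \<Rightarrow> real"
  unfolding N_def using that by (subst integral_density) (auto simp: Wt_nonneg)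

text \<open>\<open>W\<close> does not depend on coordinate \<open>i\<close>, so translation in that
  direction passes through it. Only \<open>k\<close>, which stands in for the weight in that
  coordinate, has to be differentiable.\<close>

lemma weighted_translation_zero:
  fixes g :: "real^'d \<Rightarrow> real"
  assumes k: "\<And>t. (k has_real_derivative k' t) (at t)" and K: "\<And>t. \<bar>t\<bar> \<le> 2 \<Longrightarrow> \<bar>k t\<bar> \<le> K \<and> \<bar>k' t\<bar> \<le> K"
    and k'm: "k' \<in> borel_measurable borel"
    and g: "\<And>w. g differentiable (at w)" and g': "continuous_on UNIV (partial_deriv i g)"
    and supp: "\<And>w. 1 < norm w \<Longrightarrow> g w = 0"
  defines "W \<equiv> \<lambda>w. \<Prod>j\<in>UNIV - {i}. w1 j (w $ j)"
  shows "(\<integral>w. W w * (k' (w $ i) * g w + k (w $ i) * partial_deriv i g w) \<partial>lborel) = 0"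
proof -
  have gc: "continuous_on UNIV g"
    by (meson continuous_at_imp_continuous_on differentiable_imp_continuous_within g)
  have supp': "partial_deriv i g w = 0" if "1 < norm w" for w by (rule partial_deriv_zero_outside[OF supp that])
  obtain M where M: "0 \<le> M" "\<And>w. \<bar>g w\<bar> \<le> M" by (rule bounded_of_compact_support[OF gc supp]) auto
  obtain M' where M': "0 \<le> M'" "\<And>w. \<bar>partial_deriv i g w\<bar> \<le> M'" by (rule bounded_of_compact_support[OF g' supp']) auto
  have [measurable]: "g \<in> borel_measurable borel" "partial_deriv i g \<in> borel_measurable borel"
    using gc g' by (auto intro: borel_measurable_continuous_onI)
  have [measurable]: "k \<in> borel_measurable borel"
    using k by (intro borel_measurable_continuous_onI DERIV_continuous_on[OF has_field_derivative_at_within])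
  note [measurable] = k'm
  have [measurable]: "W \<in> borel_measurable borel" unfolding W_def by measurable
  have W0: "0 \<le> W w" for w unfolding W_def by (intro prod_nonneg) (simp add: weight1_nonneg)
  have K0: "0 \<le> K" using K[of 0] by auto
  \<comment> \<open>A dominating function independent of the shift: the weights of the other
    coordinates times a Gaussian, so that its integral factors over the coordinates.\<close>
  define P where "P = (\<lambda>w::real^'d. \<Prod>j\<in>UNIV. weight1 (if j = i then False else j \<in> Y) (if j = i then 0 else al j) (w $ j) * exp (- (w $ j)\<^sup>2 / 32))"
  have P: "P w = W w * exp (- (norm w)\<^sup>2 / 32)" for w
  proof -
    have "P w = (\<Prod>j\<in>UNIV. weight1 (if j = i then False else j \<in> Y) (if j = i then 0 else al j) (w $ j)) * exp (- (norm w)\<^sup>2 / 32)"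
      unfolding P_def prod.distrib norm_sq_vec by (simp add: exp_sum[symmetric] sum_negf sum_divide_distrib)
    also have "(\<Prod>j\<in>UNIV. weight1 (if j = i then False else j \<in> Y) (if j = i then 0 else al j) (w $ j)) = W w"
      unfolding W_def by (subst prod.remove[of _ i]) (auto simp: weight1_def[of False] intro!: prod.cong)
    finally show ?thesis .
  qed
  have P0: "0 \<le> P w" for w by (simp add: P W0)
  have [measurable]: "P \<in> borel_measurable borel" unfolding P by measurable
  have Pint: "integrable lborel P"
  proof (rule integrableI_nonneg)
    have "bessel1 (if j = i then False else j \<in> Y) (if j = i then 0 else al j)" for j
      using B.bessel1_axioms[of j] by (auto simp: bessel1_def)
    then have fin: "(\<integral>\<^sup>+t. ennreal (weight1 (if j = i then False else j \<in> Y) (if j = i then 0 else al j) t * exp (- t\<^sup>2 / 32)) \<partial>lborel) < \<infinity>" for j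
      by (rule bessel1.gauss_weight_finite)
    have "(\<integral>\<^sup>+w. ennreal (P w) \<partial>lborel) = (\<integral>\<^sup>+w. (\<Prod>j\<in>UNIV. ennreal (weight1 (if j = i then False else j \<in> Y) (if j = i then 0 else al j) ((w::real^'d) $ j) * exp (- (w $ j)\<^sup>2 / 32))) \<partial>lborel)"
      unfolding P_def by (intro nn_integral_cong prod_ennreal[symmetric]) (simp add: weight1_nonneg)
    also have "\<dots> = (\<Prod>j\<in>UNIV. (\<integral>\<^sup>+t. ennreal (weight1 (if j = i then False else j \<in> Y) (if j = i then 0 else al j) t * exp (- t\<^sup>2 / 32)) \<partial>lborel))"
      by (rule nn_integral_prod_vec) measurable
    also have "\<dots> < top"
      by (rule finite_induct[OF finite[of "UNIV :: 'd set"]]) (use fin in \<open>auto simp: ennreal_mult_less_top\<close>)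
    finally show "(\<integral>\<^sup>+w. ennreal (P w) \<partial>lborel) < \<infinity>" by simp
  qed (auto simp: P0)
  \<comment> \<open>If a shifted point lies in the unit ball then \<open>norm w \<le> 2\<close>,
    where the Gaussian in \<open>P\<close> is at least \<open>exp (- 4 / 32)\<close>; hence the
    factor \<open>exp (1/8)\<close>.\<close>
  define C where "C = K * (M + M') * exp (1/8)"
  define F where "F = (\<lambda>w. k (w $ i) * W w * g w)"
  define F' where "F' = (\<lambda>w. W w * (k' (w $ i) * g w + k (w $ i) * partial_deriv i g w))"
  have Wshift: "W (w + t *\<^sub>R axis i 1) = W w" for w t
    unfolding W_def by (intro prod.cong) (auto simp: axis_def)
  have base: "\<bar>W w * (x * g (w + t *\<^sub>R axis i 1) + y * partial_deriv i g (w + t *\<^sub>R axis i 1))\<bar> \<le> C * P w"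
    if t: "0 \<le> t" "t \<le> 1" and x: "\<bar>w $ i + t\<bar> \<le> 2 \<Longrightarrow> \<bar>x\<bar> \<le> K \<and> \<bar>y\<bar> \<le> K" for w t x y
  proof (cases "1 < norm (w + t *\<^sub>R axis i 1)")
    case True
    then show ?thesis using supp supp' P0[of w] K0 M M' by (simp add: C_def)
  next
    case False
    have "norm w \<le> norm (w + t *\<^sub>R axis i 1) + norm (t *\<^sub>R axis i 1 :: real^'d)"
      by (metis add_diff_cancel_right' norm_triangle_ineq4)
    also have "\<dots> \<le> 2" using False t by simp
    finally have "(norm w)\<^sup>2 \<le> 2\<^sup>2" by (intro power_mono) auto
    then have ex: "1 \<le> exp (1/8) * exp (- (norm w)\<^sup>2 / 32)" by (simp flip: exp_add)
    have "\<bar>(w + t *\<^sub>R axis i 1) $ i\<bar> \<le> norm (w + t *\<^sub>R axis i 1)" by (rule component_le_norm_cart)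
    then have xy: "\<bar>x\<bar> \<le> K" "\<bar>y\<bar> \<le> K" using x False by auto
    have "\<bar>x * g (w + t *\<^sub>R axis i 1) + y * partial_deriv i g (w + t *\<^sub>R axis i 1)\<bar> \<le> K * M + K * M'"
      by (rule order_trans[OF abs_triangle_ineq]) (unfold abs_mult, intro add_mono mult_mono xy M M' K0, auto)
    then have "W w * \<bar>x * g (w + t *\<^sub>R axis i 1) + y * partial_deriv i g (w + t *\<^sub>R axis i 1)\<bar> \<le> W w * (K * M + K * M')"
      by (intro mult_left_mono W0)
    also have "\<dots> \<le> W w * (K * M + K * M') * (exp (1/8) * exp (- (norm w)\<^sup>2 / 32))"
    proof -
      have "0 \<le> W w * (K * M + K * M')" using W0 K0 M M' by simp
      from mult_left_mono[OF ex this] show ?thesis by simp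
    qed
    also have "\<dots> = C * P w" by (simp add: C_def P distrib_left mult.commute)
    finally show ?thesis by (simp add: abs_mult W0)
  qed
  have "(\<integral>w. F' w \<partial>lborel) = 0"
  proof (rule integral_deriv_direction_zero[where F=F and G="\<lambda>w. C * P w" and e="axis i 1"])
    show "integrable lborel F"
    proof (rule Bochner_Integration.integrable_bound[OF integrable_mult_right[OF Pint, of C]])
      show "F \<in> borel_measurable lborel" unfolding F_def by measurable
      show "AE w in lborel. norm (F w) \<le> norm (C * P w)"
      proof (rule AE_I2)
        fix w
        have "\<bar>W w * (k (w $ i) * g (w + 0 *\<^sub>R axis i 1) + 0 * partial_deriv i g (w + 0 *\<^sub>R axis i 1))\<bar> \<le> C * P w"
          by (rule base) (use K K0 in auto)
        moreover have "F w = W w * (k (w $ i) * g (w + 0 *\<^sub>R axis i 1) + 0 * partial_deriv i g (w + 0 *\<^sub>R axis i 1))"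
          by (simp add: F_def)
        ultimately show "norm (F w) \<le> norm (C * P w)" by simp
      qed
    qed
    show "F' \<in> borel_measurable borel" unfolding F'_def by measurable
    show "integrable lborel (\<lambda>w. C * P w)" using Pint by simp
    show "((\<lambda>t. F (w + t *\<^sub>R axis i 1)) has_real_derivative F' (w + t *\<^sub>R axis i 1)) (at t)" for w t
    proof -
      have "((\<lambda>t. k (w $ i + t)) has_real_derivative k' (w $ i + t)) (at t)"
        by (rule DERIV_cong[OF DERIV_chain2[OF k]]) (auto intro!: derivative_eq_intros)
      from DERIV_mult[OF DERIV_cmult_right[OF this, of "W w"] has_real_derivative_along_axis[OF g]]
      show ?thesis unfolding F_def F'_def Wshift by (simp add: axis_def algebra_simps)
    qed
    show "\<bar>F' (w + t *\<^sub>R axis i 1)\<bar> \<le> C * P w" if "0 \<le> t" "t \<le> 1" for w t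
      unfolding F'_def Wshift using K by (intro base that) (simp add: axis_def)
  qed
  then show ?thesis unfolding F'_def .
qed

text \<open>The logarithmic derivative of the weight in direction \<open>i\<close> is
  \<open>al i / w $ i\<close>. The linear bound on \<open>g\<close> keeps the quotient bounded and
  kills the boundary term, even where \<open>al i < 0\<close> and the weight blows up. For
  \<open>i \<in> Y\<close> the weight is first regularised by the flat factor, which is then removed
  by dominated convergence.\<close>

lemma weighted_divergence_zero:
  fixes g :: "real^'d \<Rightarrow> real"
  assumes g: "\<And>w. g differentiable (at w)" and g': "continuous_on UNIV (partial_deriv i g)"
    and supp: "\<And>w. 1 < norm w \<Longrightarrow> g w = 0"
    and C: "\<And>w. i \<in> Y \<Longrightarrow> \<bar>g w\<bar> \<le> C * \<bar>w $ i\<bar>"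
  shows "(\<integral>w. partial_deriv i g w + al i / w $ i * g w \<partial>N) = 0" 
    "integrable N (\<lambda>w. partial_deriv i g w)" "integrable N (\<lambda>w. al i / w $ i * g w)"
proof -
  have gc: "continuous_on UNIV g"
    by (meson continuous_at_imp_continuous_on differentiable_imp_continuous_within g)
  have [measurable]: "g \<in> borel_measurable borel" "partial_deriv i g \<in> borel_measurable borel"
    using gc g' by (auto intro: borel_measurable_continuous_onI)
  have supp': "partial_deriv i g w = 0" if "1 < norm w" for w by (rule partial_deriv_zero_outside[OF supp that])
  obtain M' where M': "0 \<le> M'" "\<And>w. \<bar>partial_deriv i g w\<bar> \<le> M'" by (rule bounded_of_compact_support[OF g' supp']) auto
  have q: "\<bar>al i / w $ i * g w\<bar> \<le> \<bar>al i\<bar> * \<bar>C\<bar>" for w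
  proof (cases "i \<in> Y \<and> w $ i \<noteq> 0")
    case True
    have "\<bar>g w\<bar> / \<bar>w $ i\<bar> \<le> C" using C[of w] True by (simp add: divide_le_eq)
    then have "\<bar>al i\<bar> * (\<bar>g w\<bar> / \<bar>w $ i\<bar>) \<le> \<bar>al i\<bar> * \<bar>C\<bar>" by (intro mult_left_mono) auto
    then show ?thesis by (simp add: abs_mult)
  qed (auto simp: al_def)
  show i1: "integrable N (\<lambda>w. partial_deriv i g w)"
    by (rule integrable_N_bounded[OF _ M'(2), where R=1]) (auto simp: supp')
  show i2: "integrable N (\<lambda>w. al i / w $ i * g w)"
    by (rule integrable_N_bounded[OF _ q, where R=1]) (auto simp: supp)
  define W where "W = (\<lambda>w::real^'d. \<Prod>j\<in>UNIV - {i}. w1 j (w $ j))"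
  have Wt: "Wt w = w1 i (w $ i) * W w" for w
    unfolding Wt_def W_def by (subst prod.remove[of _ i]) auto
  show "(\<integral>w. partial_deriv i g w + al i / w $ i * g w \<partial>N) = 0"
  proof (cases "i \<in> Y")
    case False
    have "(\<integral>w. W w * (0 * g w + 1 * partial_deriv i g w) \<partial>lborel) = 0"
      unfolding W_def by (rule weighted_translation_zero[where K=1 and k="\<lambda>t. 1" and k'="\<lambda>t. 0"]) (use g g' supp in auto)
    then show ?thesis using False
      by (subst integral_N) (simp_all add: Wt weight1_def[of False] al_def)
  next
    case True
    \<comment> \<open>The regularised integrand divided by \<open>Wt\<close>; the term with
      \<open>(w $ i)\<^sup>2\<close> in the denominator is the derivative of the flat factor and
      disappears in the limit.\<close>
    define s where "s = (\<lambda>n w. exp (- (1 / (real (Suc n) * w $ i))) * ((al i / w $ i + 1 / (real (Suc n) * (w $ i)\<^sup>2)) * g w + partial_deriv i g w))"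
    have z: "(\<integral>w. s n w \<partial>N) = 0" for n
    proof -
      define m where "m = real (Suc n)"
      have m: "0 < m" by (simp add: m_def)
      note k = B.flat_powr_derivative[OF True m]
      obtain K where K: "\<And>t. \<bar>t\<bar> \<le> 2 \<Longrightarrow> \<bar>flat_fun 1 (m * t) * w1 i t\<bar> \<le> K \<and> \<bar>w1 i t * flat_fun 1 (m * t) * (al i / t + 1 / (m * t\<^sup>2))\<bar> \<le> K"
        using k(2) by blast
      have [measurable]: "flat_fun 1 \<in> borel_measurable borel"
        by (intro borel_measurable_continuous_onI DERIV_continuous_on[OF has_field_derivative_at_within[OF flat_fun_has_derivative]])
      have "(\<integral>w. W w * ((w1 i (w $ i) * flat_fun 1 (m * w $ i) * (al i / w $ i + 1 / (m * (w $ i)\<^sup>2))) * g w + (flat_fun 1 (m * w $ i) * w1 i (w $ i)) * partial_deriv i g w) \<partial>lborel) = 0"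
        unfolding W_def by (rule weighted_translation_zero[OF k(1) K _ g g' supp]) measurable
      moreover have "W w * ((w1 i (w $ i) * flat_fun 1 (m * w $ i) * (al i / w $ i + 1 / (m * (w $ i)\<^sup>2))) * g w + (flat_fun 1 (m * w $ i) * w1 i (w $ i)) * partial_deriv i g w) = Wt w * s n w" for w
      proof (cases "0 < w $ i")
        case True
        then have "flat_fun 1 (m * w $ i) = exp (- (1 / (m * w $ i)))" using m by (simp add: flat_fun_def mult_le_0_iff)
        then show ?thesis unfolding Wt s_def m_def[symmetric] by (simp add: algebra_simps)
      next
        case False
        then show ?thesis using True by (simp add: Wt weight1_def)
      qed
      ultimately show ?thesis by (subst integral_N) (simp_all add: s_def)
    qed
    have "(\<lambda>n. \<integral>w. s n w \<partial>N) \<longlonglongrightarrow> (\<integral>w. partial_deriv i g w + al i / w $ i * g w \<partial>N)"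
    proof (rule integral_dominated_convergence[where w="\<lambda>w. \<bar>partial_deriv i g w\<bar> + \<bar>al i / w $ i * g w\<bar> + \<bar>C\<bar> * indicator (ball 0 2) w"])
      show "integrable N (\<lambda>w. \<bar>partial_deriv i g w\<bar> + \<bar>al i / w $ i * g w\<bar> + \<bar>C\<bar> * indicator (ball 0 2) w)"
        using i1 i2 emeasure_N_ball_finite[of 2] by (intro Bochner_Integration.integrable_add integrable_abs integrable_mult_right integrable_real_indicator) auto
      show "AE w in N. (\<lambda>n. s n w) \<longlonglongrightarrow> partial_deriv i g w + al i / w $ i * g w"
        using AE_N_orthant
      proof eventually_elim
        case (elim w)
        then have p: "0 < w $ i" using True by (simp add: orthant_def)
        have "(\<lambda>n. exp (- (1 / (real (Suc n) * w $ i)))) \<longlonglongrightarrow> 1" "(\<lambda>n. 1 / (real (Suc n) * (w $ i)\<^sup>2)) \<longlonglongrightarrow> 0"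
          using p by real_asymp+
        then have "(\<lambda>n. s n w) \<longlonglongrightarrow> 1 * ((al i / w $ i + 0) * g w + partial_deriv i g w)"
          unfolding s_def by (intro tendsto_intros)
        then show ?case by (simp add: add.commute)
      qed
      show "AE w in N. norm (s n w) \<le> \<bar>partial_deriv i g w\<bar> + \<bar>al i / w $ i * g w\<bar> + \<bar>C\<bar> * indicator (ball 0 2) w" for n
        using AE_N_orthant
      proof eventually_elim
        case (elim w)
        then have p: "0 < w $ i" using True by (simp add: orthant_def)
        define x where "x = 1 / (real (Suc n) * w $ i)"
        have x: "0 < x" using p by (simp add: x_def)
        \<comment> \<open>The term from the flat factor is \<open>exp (- x) * x\<close> times
          \<open>g w / w $ i\<close>; with the linear bound on \<open>g\<close> it is bounded
          uniformly in \<open>n\<close>.\<close>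
        have ex: "exp (- x) * x \<le> 1"
          using exp_ge_add_one_self[of x] order_trans[OF _ exp_ge_add_one_self[of x], of x]
          by (simp add: exp_minus field_simps)
        have "\<bar>1 / w $ i * g w\<bar> \<le> \<bar>C\<bar> * indicator (ball 0 2) w"
        proof (cases "1 < norm w")
          case False
          have "\<bar>g w\<bar> / w $ i \<le> C" using C[OF True, of w] p by (simp add: divide_le_eq)
          then show ?thesis using False p by (simp add: abs_mult)
        qed (simp add: supp)
        then have "(exp (- x) * x) * \<bar>1 / w $ i * g w\<bar> \<le> 1 * (\<bar>C\<bar> * indicator (ball 0 2) w)"
          using ex x by (intro mult_mono) auto
        moreover have "exp (- x) * \<bar>al i / w $ i * g w\<bar> \<le> 1 * \<bar>al i / w $ i * g w\<bar>" "exp (- x) * \<bar>partial_deriv i g w\<bar> \<le> 1 * \<bar>partial_deriv i g w\<bar>"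
          using x by (intro mult_right_mono; simp)+
        moreover have sn: "s n w = exp (- x) * (al i / w $ i * g w) + (exp (- x) * x) * (1 / w $ i * g w) + exp (- x) * partial_deriv i g w"
          using p by (simp add: s_def x_def power2_eq_square algebra_simps)
        have "\<bar>s n w\<bar> \<le> exp (- x) * \<bar>al i / w $ i * g w\<bar> + (exp (- x) * x) * \<bar>1 / w $ i * g w\<bar> + exp (- x) * \<bar>partial_deriv i g w\<bar>"
        proof -
          have tri: "\<bar>p + q + r\<bar> \<le> \<bar>p\<bar> + \<bar>q\<bar> + \<bar>r\<bar>" for p q r :: real by linarith
          have "\<bar>c * p\<bar> = c * \<bar>p\<bar>" if "0 < c" for c p :: real using that by (simp add: abs_mult)
          from this[of "exp (- x)"] this[of "exp (- x) * x"] x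
          show ?thesis unfolding sn by (intro order_trans[OF tri]) simp
        qed
        ultimately show ?case by simp
      qed
    qed (simp_all add: s_def)
    then show ?thesis by (simp add: z LIMSEQ_const_iff)
  qed
qed

end


section \<open>Green's identity against Neumann test functions\<close>

text \<open>The weight has finite mass, so the pointwise inequality
  \<open>\<bar>t\<bar> \<le> \<epsilon> + t\<^sup>2 / \<epsilon>\<close> can replace Cauchy-Schwarz;
  it works directly in \<open>ennreal\<close>, where some of the integrals may be infinite.\<close>

lemma weighted_L2_tendsto_imp_L1:
  fixes \<omega> :: "'a \<Rightarrow> real" and h :: "nat \<Rightarrow> 'a \<Rightarrow> real"
  assumes [measurable]: "\<omega> \<in> borel_measurable M" "\<And>k. h k \<in> borel_measurable M"
    and \<omega>: "\<And>x. 0 \<le> \<omega> x" and fin: "(\<integral>\<^sup>+x. ennreal (\<omega> x) \<partial>M) < \<infinity>"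
    and L2: "(\<lambda>k. \<integral>\<^sup>+x. ennreal (\<omega> x * (h k x)\<^sup>2) \<partial>M) \<longlonglongrightarrow> 0"
  shows "(\<lambda>k. \<integral>\<^sup>+x. ennreal (\<omega> x * \<bar>h k x\<bar>) \<partial>M) \<longlonglongrightarrow> 0"
proof (rule order_tendstoI)
  fix r :: ennreal assume "0 < r"
  then obtain r' :: real where r': "0 < r'" "ennreal r' < r"
    by (metis dense ennreal_cases ennreal_less_iff ennreal_0 less_top not_less_iff_gr_or_eq order_less_trans zero_less_iff_neq_zero ennreal_eq_0_iff linorder_not_le)
  define A where "A = (\<integral>\<^sup>+x. ennreal (\<omega> x) \<partial>M)"
  obtain A' where A': "A = ennreal A'" "0 \<le> A'" using fin unfolding A_def[symmetric] by (cases A) auto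
  define \<epsilon> where "\<epsilon> = r' / (2 * (A' + 1))"
  have e: "0 < \<epsilon>" using r' A' by (simp add: \<epsilon>_def)
  have le: "(\<integral>\<^sup>+x. ennreal (\<omega> x * \<bar>h k x\<bar>) \<partial>M) \<le> ennreal \<epsilon> * A + ennreal (1 / \<epsilon>) * (\<integral>\<^sup>+x. ennreal (\<omega> x * (h k x)\<^sup>2) \<partial>M)" for k
  proof -
    have "(\<integral>\<^sup>+x. ennreal (\<omega> x * \<bar>h k x\<bar>) \<partial>M) \<le> (\<integral>\<^sup>+x. ennreal \<epsilon> * ennreal (\<omega> x) + ennreal (1 / \<epsilon>) * ennreal (\<omega> x * (h k x)\<^sup>2) \<partial>M)"
    proof (rule nn_integral_mono)
      fix x
      have "\<bar>t\<bar> \<le> \<epsilon> + 1 / \<epsilon> * t\<^sup>2" for t :: real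
      proof (cases "\<bar>t\<bar> \<le> \<epsilon>")
        case True
        then show ?thesis using e by (simp add: add_increasing2)
      next
        case False
        then have "\<epsilon> * \<bar>t\<bar> \<le> \<bar>t\<bar> * \<bar>t\<bar>" by (intro mult_right_mono) auto
        then have "\<bar>t\<bar> \<le> t\<^sup>2 / \<epsilon>" using e by (simp add: field_simps power2_eq_square)
        then show ?thesis using e by simp
      qed
      then have "\<omega> x * \<bar>h k x\<bar> \<le> \<omega> x * (\<epsilon> + 1 / \<epsilon> * (h k x)\<^sup>2)" by (intro mult_left_mono \<omega>)
      also have "\<dots> = \<epsilon> * \<omega> x + 1 / \<epsilon> * (\<omega> x * (h k x)\<^sup>2)" by (simp add: algebra_simps)
      finally have "ennreal (\<omega> x * \<bar>h k x\<bar>) \<le> ennreal (\<epsilon> * \<omega> x + 1 / \<epsilon> * (\<omega> x * (h k x)\<^sup>2))" by (rule ennreal_leI)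
      also have "\<dots> = ennreal \<epsilon> * ennreal (\<omega> x) + ennreal (1 / \<epsilon>) * ennreal (\<omega> x * (h k x)\<^sup>2)"
        using e \<omega>[of x] by (subst ennreal_plus) (simp_all only: ennreal_mult mult_nonneg_nonneg zero_le_power2 less_imp_le zero_le_divide_1_iff)
      finally show "ennreal (\<omega> x * \<bar>h k x\<bar>) \<le> ennreal \<epsilon> * ennreal (\<omega> x) + ennreal (1 / \<epsilon>) * ennreal (\<omega> x * (h k x)\<^sup>2)" .
    qed
    also have "\<dots> = ennreal \<epsilon> * A + ennreal (1 / \<epsilon>) * (\<integral>\<^sup>+x. ennreal (\<omega> x * (h k x)\<^sup>2) \<partial>M)"
      unfolding A_def by (subst nn_integral_add) (auto simp: nn_integral_cmult)
    finally show ?thesis .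
  qed
  have "(\<lambda>k. ennreal \<epsilon> * A + ennreal (1 / \<epsilon>) * (\<integral>\<^sup>+x. ennreal (\<omega> x * (h k x)\<^sup>2) \<partial>M)) \<longlonglongrightarrow> ennreal \<epsilon> * A + ennreal (1 / \<epsilon>) * 0"
    by (intro tendsto_add tendsto_const ennreal_tendsto_cmult L2) auto
  moreover have "ennreal \<epsilon> * A + ennreal (1 / \<epsilon>) * 0 < r"
  proof -
    have "\<epsilon> * A' \<le> r'" using r' A' by (simp add: \<epsilon>_def field_simps)
    then have "ennreal \<epsilon> * A \<le> ennreal r'" using A' e by (simp add: ennreal_mult'[symmetric] ennreal_leI)
    then show ?thesis using r' by simp
  qed
  ultimately have "\<forall>\<^sub>F k in sequentially. ennreal \<epsilon> * A + ennreal (1 / \<epsilon>) * (\<integral>\<^sup>+x. ennreal (\<omega> x * (h k x)\<^sup>2) \<partial>M) < r"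
    by (rule order_tendstoD(2))
  then show "\<forall>\<^sub>F k in sequentially. (\<integral>\<^sup>+x. ennreal (\<omega> x * \<bar>h k x\<bar>) \<partial>M) < r"
    by eventually_elim (rule le_less_trans[OF le])
qed simp

lemma continuous_gradient: "smooth f \<Longrightarrow> continuous_on UNIV (gradient f)"
  unfolding gradient_def[abs_def] by (intro continuous_on_vec_lambda smooth_continuous_partial)

text \<open>Mean value inequality along direction \<open>i\<close>, starting from the projection of
  \<open>w\<close> to the hyperplane. Applied to the derivative of a test function in direction
  \<open>i\<close>, it supplies the linear bound required by
  \<open>weighted_divergence_zero\<close>.\<close>

lemma vanishing_on_hyperplane_bound:
  fixes f :: "real^'d::finite \<Rightarrow> real"
  assumes f: "elem_smooth f" and supp: "\<And>w. \<rho> < norm w \<Longrightarrow> f w = 0" and z: "\<And>w. w $ i = 0 \<Longrightarrow> f w = 0"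
  obtains C where "0 \<le> C" "\<And>w. \<bar>f w\<bar> \<le> C * \<bar>w $ i\<bar>"
proof -
  obtain B where B: "0 \<le> B" "\<And>w. \<bar>partial_deriv i f w\<bar> \<le> B"
    by (rule bounded_of_compact_support[OF elem_smooth_continuous[OF elem_smooth_partial[OF f]] partial_deriv_zero_outside[OF supp]]) auto
  have "\<bar>f w\<bar> \<le> B * \<bar>w $ i\<bar>" for w
  proof -
    define w' where "w' = w - (w $ i) *\<^sub>R axis i 1"
    have "w' $ i = 0" by (simp add: w'_def axis_def)
    then have f0: "f (w' + 0 *\<^sub>R axis i 1) = 0" using z by simp
    have w: "w' + (w $ i) *\<^sub>R axis i 1 = w" by (simp add: w'_def)
    have "norm (f (w' + (w $ i) *\<^sub>R axis i 1) - f (w' + 0 *\<^sub>R axis i 1)) \<le> B * norm (w $ i - 0)"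
      by (rule field_differentiable_bound[of UNIV "\<lambda>t. f (w' + t *\<^sub>R axis i 1)" "\<lambda>t. partial_deriv i f (w' + t *\<^sub>R axis i 1)"])
         (use B(2) in \<open>auto intro!: has_real_derivative_along_axis elem_smooth_differentiable[OF f]\<close>)
    then show ?thesis unfolding f0 w by simp
  qed
  then show ?thesis using that B(1) by blast
qed

context bessel_weight
begin

text \<open>The operator \<open>\<omega>\<^sup>-\<^sup>1 div (\<omega> \<nabla> \<psi>)\<close>, a sum of Bessel operators.\<close>

definition bessel_op :: "(real^'d \<Rightarrow> real) \<Rightarrow> real^'d \<Rightarrow> real" where
  "bessel_op \<psi> w = (\<Sum>i\<in>UNIV. partial_deriv i (partial_deriv i \<psi>) w + al i / w $ i * partial_deriv i \<psi> w)"

text \<open>Support in a ball of radius below 1 makes \<open>\<psi>\<close> admissible for the weak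
  equation. The last clause keeps the singular terms of \<open>bessel_op \<psi>\<close> bounded,
  while \<open>\<psi>\<close> itself may be nonzero on the hyperplanes.\<close>

definition neumann_test :: "(real^'d \<Rightarrow> real) \<Rightarrow> bool" where
  "neumann_test \<psi> \<longleftrightarrow> elem_smooth \<psi> \<and> (\<exists>\<rho>. 0 < \<rho> \<and> \<rho> < 1 \<and> (\<forall>w. \<rho> < norm w \<longrightarrow> \<psi> w = 0)) \<and>
     (\<forall>i\<in>Y. \<forall>w. w $ i = 0 \<longrightarrow> partial_deriv i \<psi> w = 0)"

text \<open>\<open>weighted_divergence_zero\<close> applied, for each \<open>i\<close>, to
  \<open>\<phi>\<close> times the derivative of \<open>\<psi>\<close> in direction \<open>i\<close>.
  The factor \<open>\<psi>\<close> supplies both the compact support and the vanishing on the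
  hyperplane, so that \<open>\<phi>\<close> may be any smooth function.\<close>

lemma green_identity:
  assumes \<psi>: "neumann_test \<psi>" and \<phi>: "smooth \<phi>"
  shows "(\<integral>w. gradient \<phi> w \<bullet> gradient \<psi> w \<partial>N) = - (\<integral>w. \<phi> w * bessel_op \<psi> w \<partial>N)"
    "integrable N (\<lambda>w. \<phi> w * bessel_op \<psi> w)"
proof -
  obtain \<rho> where es: "elem_smooth \<psi>" and \<rho>: "0 < \<rho>" "\<rho> < 1" and z0: "\<And>w. \<rho> < norm w \<Longrightarrow> \<psi> w = 0" and
    ne: "\<And>i w. i \<in> Y \<Longrightarrow> w $ i = 0 \<Longrightarrow> partial_deriv i \<psi> w = 0"
    using \<psi> unfolding neumann_test_def by blast
  define f where "f = (\<lambda>i. partial_deriv i \<psi>)"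
  have fi: "partial_deriv i \<psi> = f i" for i by (simp add: f_def)
  have fs: "elem_smooth (f i)" for i unfolding f_def by (rule elem_smooth_partial[OF es])
  have f0: "f i w = 0" if "\<rho> < norm w" for i w unfolding f_def by (rule partial_deriv_zero_outside[OF z0 that])
  have phid: "\<phi> differentiable (at w)" for w by (rule smooth_differentiable[OF \<phi>])
  have fd: "f i differentiable (at w)" for w i by (rule elem_smooth_differentiable[OF fs])
  define g where "g = (\<lambda>i w. \<phi> w * f i w)"
  have gD: "(g i has_derivative (\<lambda>h. \<Sum>j\<in>UNIV. h $ j * (\<phi> w * partial_deriv j (f i) w + partial_deriv j \<phi> w * f i w))) (at w)" for i w
    unfolding g_def by (rule has_partials_mult[OF phid fd])
  have gp: "partial_deriv i (g i) = (\<lambda>w. \<phi> w * partial_deriv i (f i) w + partial_deriv i \<phi> w * f i w)" for i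
    using partial_deriv_eqI[OF gD] by auto
  have cont: "continuous_on UNIV \<phi>" "continuous_on UNIV (partial_deriv i \<phi>)" "continuous_on UNIV (f i)" "continuous_on UNIV (partial_deriv i (f i))" for i
    using smooth_continuous[OF \<phi>] smooth_continuous_partial[OF \<phi>] elem_smooth_continuous[OF fs] elem_smooth_continuous[OF elem_smooth_partial[OF fs]] by auto
  have gC: "\<exists>C. \<forall>w. i \<in> Y \<longrightarrow> \<bar>g i w\<bar> \<le> C * \<bar>w $ i\<bar>" for i
  proof (cases "i \<in> Y")
    case True
    obtain C where C: "0 \<le> C" "\<And>w. \<bar>f i w\<bar> \<le> C * \<bar>w $ i\<bar>"
      by (rule vanishing_on_hyperplane_bound[where f="f i" and i=i, OF fs f0]) (use ne[OF True] in \<open>auto simp: f_def\<close>)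
    have "bounded (\<phi> ` cball 0 \<rho>)"
      by (rule compact_imp_bounded[OF compact_continuous_image[OF continuous_on_subset[OF cont(1)]]]) auto
    then obtain B where B: "\<forall>w\<in>cball 0 \<rho>. \<bar>\<phi> w\<bar> \<le> B" by (auto simp: bounded_iff)
    have "\<bar>g i w\<bar> \<le> (B * C) * \<bar>w $ i\<bar>" for w
    proof (cases "norm w \<le> \<rho>")
      case True
      then have "\<bar>\<phi> w\<bar> * \<bar>f i w\<bar> \<le> B * (C * \<bar>w $ i\<bar>)" using B C by (intro mult_mono) force+
      then show ?thesis by (simp add: g_def abs_mult mult.assoc)
    next
      case False
      have "0 \<le> B" using B \<rho> by (metis abs_ge_zero dual_order.trans centre_in_cball less_imp_le)
      then show ?thesis using False C by (simp add: g_def f0)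
    qed
    then show ?thesis by blast
  qed auto
  then obtain C where C: "\<And>i w. i \<in> Y \<Longrightarrow> \<bar>g i w\<bar> \<le> C i * \<bar>w $ i\<bar>" by metis
  have gs: "g i w = 0" if "1 < norm w" for i w using that \<rho> by (simp add: g_def f0)
  have gdiff: "g i differentiable (at w)" for i w using gD by (auto simp: differentiable_def)
  have gpc: "continuous_on UNIV (partial_deriv i (g i))" for i unfolding gp by (intro continuous_intros cont)
  note div = weighted_divergence_zero[OF gdiff gpc gs C]
  have [measurable]: "\<phi> \<in> borel_measurable borel" "partial_deriv i \<phi> \<in> borel_measurable borel" "f i \<in> borel_measurable borel" "partial_deriv i (f i) \<in> borel_measurable borel" for i
    using cont by (auto intro: borel_measurable_continuous_onI)
  have i1: "integrable N (\<lambda>w. partial_deriv i \<phi> w * f i w)" for i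
  proof -
    obtain B where "\<And>w. \<bar>partial_deriv i \<phi> w * f i w\<bar> \<le> B"
      by (rule bounded_of_compact_support[of "\<lambda>w. partial_deriv i \<phi> w * f i w" \<rho>]) (auto intro!: continuous_intros cont simp: f0)
    then show ?thesis by (intro integrable_N_bounded[where R=\<rho>]) (auto simp: f0)
  qed
  have i2: "integrable N (\<lambda>w. \<phi> w * partial_deriv i (f i) w + al i / w $ i * (\<phi> w * f i w))" for i
    using Bochner_Integration.integrable_add[OF Bochner_Integration.integrable_diff[OF div(2)[of i] i1[of i]] div(3)[of i]]
    unfolding gp by (simp add: g_def)
  have L: "\<phi> w * bessel_op \<psi> w = (\<Sum>i\<in>UNIV. \<phi> w * partial_deriv i (f i) w + al i / w $ i * (\<phi> w * f i w))" for w
    unfolding bessel_op_def fi by (simp add: sum_distrib_left distrib_left mult.left_commute)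
  show "integrable N (\<lambda>w. \<phi> w * bessel_op \<psi> w)" unfolding L using i2 by auto
  have "(\<integral>w. gradient \<phi> w \<bullet> gradient \<psi> w \<partial>N) = (\<integral>w. (\<Sum>i\<in>UNIV. partial_deriv i \<phi> w * f i w) \<partial>N)"
    by (simp add: inner_vec_def gradient_def f_def)
  also have "\<dots> = (\<Sum>i\<in>UNIV. \<integral>w. partial_deriv i \<phi> w * f i w \<partial>N)" by (rule Bochner_Integration.integral_sum[OF i1])
  also have "\<dots> = (\<Sum>i\<in>UNIV. - (\<integral>w. \<phi> w * partial_deriv i (f i) w + al i / w $ i * (\<phi> w * f i w) \<partial>N))"
  proof (rule sum.cong[OF refl])
    fix i
    have "0 = (\<integral>w. partial_deriv i \<phi> w * f i w + (\<phi> w * partial_deriv i (f i) w + al i / w $ i * (\<phi> w * f i w)) \<partial>N)"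
      using div(1)[of i] unfolding gp by (simp add: g_def algebra_simps)
    also have "\<dots> = (\<integral>w. partial_deriv i \<phi> w * f i w \<partial>N) + (\<integral>w. \<phi> w * partial_deriv i (f i) w + al i / w $ i * (\<phi> w * f i w) \<partial>N)"
      by (rule Bochner_Integration.integral_add[OF i1 i2])
    finally show "(\<integral>w. partial_deriv i \<phi> w * f i w \<partial>N) = - (\<integral>w. \<phi> w * partial_deriv i (f i) w + al i / w $ i * (\<phi> w * f i w) \<partial>N)" by simp
  qed
  also have "\<dots> = - (\<integral>w. \<phi> w * bessel_op \<psi> w \<partial>N)"
    unfolding L by (subst Bochner_Integration.integral_sum[OF i2]) (simp add: sum_negf)
  finally show "(\<integral>w. gradient \<phi> w \<bullet> gradient \<psi> w \<partial>N) = - (\<integral>w. \<phi> w * bessel_op \<psi> w \<partial>N)" .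
qed

text \<open>Being bounded and supported in the unit ball, \<open>bessel_op \<psi>\<close> can be
  paired with functions controlled only in L^1 of the half ball.\<close>

lemma bessel_op_bounded:
  assumes \<psi>: "neumann_test \<psi>"
  obtains B where "0 \<le> B" "\<And>w. \<bar>bessel_op \<psi> w\<bar> \<le> B" "bessel_op \<psi> \<in> borel_measurable borel"
    "\<And>w. 1 \<le> norm w \<Longrightarrow> bessel_op \<psi> w = 0" "\<And>w. 1 \<le> norm w \<Longrightarrow> gradient \<psi> w = 0"
proof -
  obtain \<rho> where es: "elem_smooth \<psi>" and \<rho>: "0 < \<rho>" "\<rho> < 1" and z0: "\<And>w. \<rho> < norm w \<Longrightarrow> \<psi> w = 0" and
    ne: "\<And>i w. i \<in> Y \<Longrightarrow> w $ i = 0 \<Longrightarrow> partial_deriv i \<psi> w = 0"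
    using \<psi> unfolding neumann_test_def by blast
  define f where "f = (\<lambda>i. partial_deriv i \<psi>)"
  have fi: "partial_deriv i \<psi> = f i" for i by (simp add: f_def)
  have fs: "elem_smooth (f i)" for i unfolding f_def by (rule elem_smooth_partial[OF es])
  have f0: "f i w = 0" if "\<rho> < norm w" for i w unfolding f_def by (rule partial_deriv_zero_outside[OF z0 that])
  have ff0: "partial_deriv i (f i) w = 0" if "\<rho> < norm w" for i w by (rule partial_deriv_zero_outside[OF f0 that])
  have "\<exists>B. \<forall>w. \<bar>partial_deriv i (f i) w + al i / w $ i * f i w\<bar> \<le> B" for i
  proof -
    obtain B where B: "\<And>w. \<bar>partial_deriv i (f i) w\<bar> \<le> B"
      by (rule bounded_of_compact_support[OF elem_smooth_continuous[OF elem_smooth_partial[OF fs]] ff0]) auto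
    show ?thesis
    proof (cases "i \<in> Y")
      case True
      obtain C where C: "0 \<le> C" "\<And>w. \<bar>f i w\<bar> \<le> C * \<bar>w $ i\<bar>"
        by (rule vanishing_on_hyperplane_bound[where f="f i" and i=i, OF fs f0]) (use ne[OF True] in \<open>auto simp: f_def\<close>)
      have "\<bar>al i / w $ i * f i w\<bar> \<le> \<bar>al i\<bar> * C" for w
      proof (cases "w $ i = 0")
        case False
        then have "\<bar>f i w\<bar> / \<bar>w $ i\<bar> \<le> C" using C(2)[of w] by (simp add: divide_le_eq)
        then have "\<bar>al i\<bar> * (\<bar>f i w\<bar> / \<bar>w $ i\<bar>) \<le> \<bar>al i\<bar> * C" by (intro mult_left_mono) auto
        then show ?thesis by (simp add: abs_mult)
      qed (simp add: C)
      then show ?thesis using B by (intro exI[of _ "B + \<bar>al i\<bar> * C"]) (metis abs_triangle_ineq add_mono order_trans)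
    next
      case False
      then show ?thesis using B by (auto simp: al_def)
    qed
  qed
  then obtain B where B: "\<And>i w. \<bar>partial_deriv i (f i) w + al i / w $ i * f i w\<bar> \<le> B i" by metis
  have b: "\<bar>bessel_op \<psi> w\<bar> \<le> (\<Sum>i\<in>UNIV. B i)" for w
    unfolding bessel_op_def using B by (intro order_trans[OF sum_abs sum_mono]) (simp add: f_def)
  have [measurable]: "f i \<in> borel_measurable borel" "partial_deriv i (f i) \<in> borel_measurable borel" for i
    using elem_smooth_continuous[OF fs] elem_smooth_continuous[OF elem_smooth_partial[OF fs]] by (auto intro: borel_measurable_continuous_onI)
  have m: "bessel_op \<psi> \<in> borel_measurable borel"
    unfolding bessel_op_def[abs_def] fi by measurable
  have z: "bessel_op \<psi> w = 0" "gradient \<psi> w = 0" if "1 \<le> norm w" for w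
    using that \<rho> f0 ff0 unfolding bessel_op_def fi gradient_def by (auto simp: vec_eq_iff)
  show ?thesis by (rule that[OF order_trans[OF abs_ge_zero b] b m z])
qed

end

subsection \<open>Weak solutions\<close>


context bessel_weight
begin

abbreviation D :: "(real^'d) set" where "D \<equiv> half_ball Y 1"
abbreviation M :: "(real^'d) measure" where "M \<equiv> lebesgue_on D"

lemma half_ball_eq: "half_ball Y R = ball 0 R \<inter> orthant"
  by (simp add: half_ball_def orthant_def)

lemma open_half_ball: "open (half_ball Y R)"
proof -
  have "orthant = (\<Inter>i\<in>Y. {w. 0 < w $ i})" by (auto simp: orthant_def)
  then have "open orthant" by (auto intro!: open_INT open_Collect_less continuous_intros)
  then show ?thesis by (auto simp: half_ball_eq)
qed

lemma half_ball_sets [measurable]: "half_ball Y R \<in> sets borel"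
  using open_half_ball by (rule borel_open)

lemma borel_imp_M: "f \<in> borel_measurable borel \<Longrightarrow> f \<in> borel_measurable M"
  by (intro measurable_restrict_space1 measurable_completion) simp

lemma borel_measurable_N: "borel_measurable N = borel_measurable borel"
  by (rule measurable_cong_sets[OF sets_N refl])

lemma weight_measurable [measurable]: "weight Y a \<in> borel_measurable borel"
  unfolding weight_def[abs_def] by measurable

lemma weight_nonneg: "0 \<le> weight Y a z"
  unfolding weight_def by (intro prod_nonneg) auto

lemma nn_integral_M:
  assumes [measurable]: "F \<in> borel_measurable borel"
  shows "(\<integral>\<^sup>+z. ennreal (weight Y a z * \<bar>F z\<bar>) \<partial>M) = (\<integral>\<^sup>+z. ennreal (indicator D z * \<bar>F z\<bar>) \<partial>N)"
proof -
  have "(\<integral>\<^sup>+z. ennreal (weight Y a z * \<bar>F z\<bar>) \<partial>M) = (\<integral>\<^sup>+z. ennreal (weight Y a z * \<bar>F z\<bar>) * indicator D z \<partial>lborel)"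
    by (subst nn_integral_restrict_space) (simp_all add: nn_integral_completion)
  also have "\<dots> = (\<integral>\<^sup>+z. ennreal (Wt z) * ennreal (indicator D z * \<bar>F z\<bar>) \<partial>lborel)"
    by (intro nn_integral_cong) (auto simp: indicator_def half_ball_eq Wt_orthant ennreal_mult' weight_nonneg)
  also have "\<dots> = (\<integral>\<^sup>+z. ennreal (indicator D z * \<bar>F z\<bar>) \<partial>N)"
    unfolding N_def by (rule nn_integral_density[symmetric]) measurable
  finally show ?thesis .
qed

lemma integral_M:
  assumes [measurable]: "F \<in> borel_measurable borel"
  shows "(\<integral>z. weight Y a z * F z \<partial>M) = (\<integral>z. indicator D z * F z \<partial>N)"
proof -
  have "(\<integral>z. weight Y a z * F z \<partial>M) = (\<integral>z. indicator D z *\<^sub>R (weight Y a z * F z) \<partial>lebesgue)"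
    by (rule integral_restrict_space) simp
  also have "\<dots> = (\<integral>z. indicator D z *\<^sub>R (weight Y a z * F z) \<partial>lborel)"
    by (rule integral_completion) measurable
  also have "\<dots> = (\<integral>z. Wt z * (indicator D z * F z) \<partial>lborel)"
    by (intro Bochner_Integration.integral_cong) (auto simp: indicator_def half_ball_eq Wt_orthant)
  also have "\<dots> = (\<integral>z. indicator D z * F z \<partial>N)" by (rule integral_N[symmetric]) measurable
  finally show ?thesis .
qed

lemma nn_integral_weight_M: "(\<integral>\<^sup>+z. ennreal (weight Y a z) \<partial>M) < \<infinity>"
proof -
  have "(\<integral>\<^sup>+z. ennreal (weight Y a z) \<partial>M) = (\<integral>\<^sup>+z. ennreal (indicator D z * \<bar>1\<bar>) \<partial>N)"
    using nn_integral_M[of "\<lambda>z. 1"] by simp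
  also have "\<dots> \<le> (\<integral>\<^sup>+z. indicator (ball 0 1) z \<partial>N)"
    by (intro nn_integral_mono) (auto simp: indicator_def half_ball_eq)
  also have "\<dots> < \<infinity>" using emeasure_N_ball_finite[of 1] by simp
  finally show ?thesis .
qed

text \<open>Everything the sequel uses of a weak solution. \<open>U\<close> is a Borel version
  extended by 0; the gradient has disappeared, since Green's identity puts both derivatives on
  \<open>\<psi>\<close>; of the \<open>H1\<close> approximation only convergence in weighted L^1 is
  kept.\<close>

lemma weak_solution_imp:
  assumes "weak_solution Y a u"
  obtains U \<phi> where "U \<in> borel_measurable borel" "\<And>z. z \<notin> D \<Longrightarrow> U z = 0" "AE z in M. u z = U z"
    "integrable N U" "\<And>k::nat. smooth (\<phi> k)"
    "(\<lambda>k. \<integral>\<^sup>+z. ennreal (indicator D z * \<bar>\<phi> k z - U z\<bar>) \<partial>N) \<longlonglongrightarrow> 0"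
    "\<And>\<psi>. neumann_test \<psi> \<Longrightarrow> (\<integral>z. U z * bessel_op \<psi> z \<partial>N) = 0"
proof -
  obtain G where H: "H1 Y a u G" and ws: "\<And>\<phi>. test_function (ball 0 1) \<phi> \<Longrightarrow> (\<integral> z. weight Y a z * (G z \<bullet> gradient \<phi> z) \<partial>M) = 0"
    using assms unfolding weak_solution_def by blast
  obtain \<phi> where um: "u \<in> borel_measurable M" and Gm: "G \<in> borel_measurable M" and fin: "H1_norm_sq Y a u G < \<infinity>" and sm: "\<And>k. smooth (\<phi> k)"
    and lim: "(\<lambda>k::nat. H1_norm_sq Y a (\<lambda>z. \<phi> k z - u z) (\<lambda>z. gradient (\<phi> k) z - G z)) \<longlonglongrightarrow> 0"
    using H unfolding H1_def by blast
  have wm: "weight Y a \<in> borel_measurable M" by (rule borel_imp_M) simp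
  have \<phi>m: "\<phi> k \<in> borel_measurable borel" for k by (intro borel_measurable_continuous_onI smooth_continuous sm)
  have \<phi>gm: "gradient (\<phi> k) \<in> borel_measurable borel" for k by (intro borel_measurable_continuous_onI continuous_gradient sm)
  note [measurable] = um Gm wm borel_imp_M[OF \<phi>m]
  have [measurable]: "gradient (\<phi> k) \<in> borel_measurable M" for k
    by (intro measurable_restrict_space1 measurable_completion) (use \<phi>gm in simp)
  have dom: "(\<lambda>k. \<integral>\<^sup>+z. ennreal (weight Y a z * (h k z)\<^sup>2) \<partial>M) \<longlonglongrightarrow> 0"
    if "\<And>k z. (h k z)\<^sup>2 \<le> (\<phi> k z - u z)\<^sup>2 + (norm (gradient (\<phi> k) z - G z))\<^sup>2" for h
  proof (rule tendsto_sandwich[OF _ _ tendsto_const lim])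
    show "\<forall>\<^sub>F k in sequentially. (\<integral>\<^sup>+z. ennreal (weight Y a z * (h k z)\<^sup>2) \<partial>M) \<le> H1_norm_sq Y a (\<lambda>z. \<phi> k z - u z) (\<lambda>z. gradient (\<phi> k) z - G z)"
      unfolding H1_norm_sq_def using that
      by (intro always_eventually allI nn_integral_mono ennreal_leI mult_left_mono weight_nonneg)
  qed auto
  have uL: "(\<lambda>k. \<integral>\<^sup>+z. ennreal (weight Y a z * \<bar>\<phi> k z - u z\<bar>) \<partial>M) \<longlonglongrightarrow> 0"
    by (rule weighted_L2_tendsto_imp_L1[OF _ _ weight_nonneg nn_integral_weight_M dom]) auto
  have gL: "(\<lambda>k. \<integral>\<^sup>+z. ennreal (weight Y a z * \<bar>norm (gradient (\<phi> k) z - G z)\<bar>) \<partial>M) \<longlonglongrightarrow> 0"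
    by (rule weighted_L2_tendsto_imp_L1[OF _ _ weight_nonneg nn_integral_weight_M dom]) auto
  have finL: "(\<integral>\<^sup>+z. ennreal (weight Y a z * h z) \<partial>M) < \<infinity>"
    if h: "\<And>z. 0 \<le> h z" "\<And>z. (h z)\<^sup>2 \<le> (u z)\<^sup>2 + (norm (G z))\<^sup>2" for h
  proof -
    have "(\<integral>\<^sup>+z. ennreal (weight Y a z * h z) \<partial>M) \<le> (\<integral>\<^sup>+z. ennreal (weight Y a z) + ennreal (weight Y a z * ((u z)\<^sup>2 + (norm (G z))\<^sup>2)) \<partial>M)"
    proof (rule nn_integral_mono)
      fix z
      \<comment> \<open>Finite mass of the weight again turns square integrability into
        integrability.\<close>
      have "h z \<le> 1 + (h z)\<^sup>2"
      proof (cases "h z \<le> 1")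
        case False
        then have "h z * 1 \<le> h z * h z" using h(1) by (intro mult_left_mono) auto
        then show ?thesis by (simp add: power2_eq_square)
      qed (simp add: add_increasing2)
      then have "weight Y a z * h z \<le> weight Y a z * (1 + ((u z)\<^sup>2 + (norm (G z))\<^sup>2))"
        using h(2)[of z] by (intro mult_left_mono weight_nonneg) auto
      then have "ennreal (weight Y a z * h z) \<le> ennreal (weight Y a z + weight Y a z * ((u z)\<^sup>2 + (norm (G z))\<^sup>2))"
        by (intro ennreal_leI) (simp add: distrib_left)
      then show "ennreal (weight Y a z * h z) \<le> ennreal (weight Y a z) + ennreal (weight Y a z * ((u z)\<^sup>2 + (norm (G z))\<^sup>2))"
        by (subst (asm) ennreal_plus) (auto intro!: mult_nonneg_nonneg weight_nonneg)
    qed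
    also have "\<dots> = (\<integral>\<^sup>+z. ennreal (weight Y a z) \<partial>M) + H1_norm_sq Y a u G"
      unfolding H1_norm_sq_def by (rule nn_integral_add) measurable
    also have "\<dots> < \<infinity>" using fin nn_integral_weight_M by (simp add: ennreal_add_less_top)
    finally show ?thesis .
  qed
  have ufin: "(\<integral>\<^sup>+z. ennreal (weight Y a z * \<bar>u z\<bar>) \<partial>M) < \<infinity>" by (rule finL) auto
  have Gfin: "(\<integral>\<^sup>+z. ennreal (weight Y a z * norm (G z)) \<partial>M) < \<infinity>" by (rule finL) auto
  \<comment> \<open>\<open>u\<close> is only Lebesgue measurable, whereas the products with kernels
    and Fubini on \<open>N\<close> call for a Borel function.\<close>
  have "(\<lambda>z. if z \<in> D then u z else 0) \<in> borel_measurable lebesgue"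
    by (rule borel_measurable_if_I[OF um]) simp
  from completion_ex_borel_measurable_real[OF this] obtain g where gm: "g \<in> borel_measurable borel" and ge: "AE z in lborel. (if z \<in> D then u z else 0) = g z" by auto
  define U where "U = (\<lambda>z. if z \<in> D then g z else 0)"
  have Um [measurable]: "U \<in> borel_measurable borel" unfolding U_def using gm by measurable
  have U0: "U z = 0" if "z \<notin> D" for z using that by (simp add: U_def)
  have uU: "AE z in M. u z = U z"
    by (subst AE_restrict_space_iff, simp, rule AE_completion, use ge in eventually_elim) (auto simp: U_def split: if_splits)
  have UN: "(\<integral>\<^sup>+z. ennreal (indicator D z * \<bar>\<phi> k z - U z\<bar>) \<partial>N) = (\<integral>\<^sup>+z. ennreal (weight Y a z * \<bar>\<phi> k z - u z\<bar>) \<partial>M)" for k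
  proof -
    have "(\<integral>\<^sup>+z. ennreal (weight Y a z * \<bar>\<phi> k z - u z\<bar>) \<partial>M) = (\<integral>\<^sup>+z. ennreal (weight Y a z * \<bar>\<phi> k z - U z\<bar>) \<partial>M)"
      by (rule nn_integral_cong_AE, use uU in eventually_elim) simp
    also have "\<dots> = (\<integral>\<^sup>+z. ennreal (indicator D z * \<bar>\<phi> k z - U z\<bar>) \<partial>N)"
      by (intro nn_integral_M borel_measurable_diff \<phi>m Um)
    finally show ?thesis ..
  qed
  have intU: "integrable N U"
  proof (rule integrableI_bounded)
    have "(\<integral>\<^sup>+z. ennreal (norm (U z)) \<partial>N) = (\<integral>\<^sup>+z. ennreal (indicator D z * \<bar>U z\<bar>) \<partial>N)"
      by (intro nn_integral_cong) (auto simp: indicator_def U0)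
    also have "\<dots> = (\<integral>\<^sup>+z. ennreal (weight Y a z * \<bar>U z\<bar>) \<partial>M)" by (rule nn_integral_M[symmetric]) simp
    also have "\<dots> = (\<integral>\<^sup>+z. ennreal (weight Y a z * \<bar>u z\<bar>) \<partial>M)"
      by (rule nn_integral_cong_AE, use uU in eventually_elim) simp
    finally show "(\<integral>\<^sup>+z. ennreal (norm (U z)) \<partial>N) < \<infinity>" using ufin by simp
  qed simp
  have Ulim: "(\<lambda>k. \<integral>\<^sup>+z. ennreal (indicator D z * \<bar>\<phi> k z - U z\<bar>) \<partial>N) \<longlonglongrightarrow> 0" unfolding UN by (rule uL)
  have weak: "(\<integral>z. U z * bessel_op \<psi> z \<partial>N) = 0" if \<psi>: "neumann_test \<psi>" for \<psi>
  proof -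
    obtain \<rho> where es: "elem_smooth \<psi>" and \<rho>: "0 < \<rho>" "\<rho> < 1" and z0: "\<And>w. \<rho> < norm w \<Longrightarrow> \<psi> w = 0"
      using \<psi> unfolding neumann_test_def by blast
    obtain B where B: "0 \<le> B" "\<And>w. \<bar>bessel_op \<psi> w\<bar> \<le> B" and Lm [measurable]: "bessel_op \<psi> \<in> borel_measurable borel"
      and L0: "\<And>w. 1 \<le> norm w \<Longrightarrow> bessel_op \<psi> w = 0" and g0: "\<And>w. 1 \<le> norm w \<Longrightarrow> gradient \<psi> w = 0"
      by (rule bessel_op_bounded[OF \<psi>]) blast
    have "{z. \<psi> z \<noteq> 0} \<subseteq> cball 0 \<rho>" using z0 by force
    then have cl: "closure {z. \<psi> z \<noteq> 0} \<subseteq> cball 0 \<rho>" by (rule closure_minimal) simp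
    have "test_function (ball 0 1) \<psi>"
      unfolding test_function_def
    proof (intro conjI)
      show "smooth \<psi>" by (rule elem_smooth_imp_smooth[OF es])
      show "compact (closure {z. \<psi> z \<noteq> 0})" using cl by (meson bounded_cball bounded_subset closed_closure compact_eq_bounded_closed)
      show "closure {z. \<psi> z \<noteq> 0} \<subseteq> ball 0 1" using cl \<rho> by auto
    qed
    from ws[OF this] have G0: "(\<integral> z. weight Y a z * (G z \<bullet> gradient \<psi> z) \<partial>M) = 0" .
    have gc: "continuous_on UNIV (gradient \<psi>)" by (rule continuous_gradient[OF elem_smooth_imp_smooth[OF es]])
    have \<psi>gm: "gradient \<psi> \<in> borel_measurable borel" by (rule borel_measurable_continuous_onI[OF gc])
    have [measurable]: "gradient \<psi> \<in> borel_measurable M"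
      by (intro measurable_restrict_space1 measurable_completion) (use \<psi>gm in simp)
    obtain K where K: "0 \<le> K" "\<And>w. \<bar>norm (gradient \<psi> w)\<bar> \<le> K"
      by (rule bounded_of_compact_support[of "\<lambda>w. norm (gradient \<psi> w)" 1]) (use gc g0 in \<open>auto intro!: continuous_intros\<close>)
    have K': "\<bar>x \<bullet> gradient \<psi> z\<bar> \<le> K * norm x" for x z
    proof -
      have "\<bar>x \<bullet> gradient \<psi> z\<bar> \<le> norm x * norm (gradient \<psi> z)" by (rule Cauchy_Schwarz_ineq2)
      also have "\<dots> \<le> norm x * K" using K(2)[of z] by (intro mult_left_mono) auto
      finally show ?thesis by (simp add: mult.commute)
    qed
    have bound: "(\<integral>\<^sup>+z. ennreal (norm (weight Y a z * (X z \<bullet> gradient \<psi> z))) \<partial>M) \<le> ennreal K * (\<integral>\<^sup>+z. ennreal (weight Y a z * norm (X z)) \<partial>M)"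
      if [measurable]: "X \<in> borel_measurable M" for X :: "real^'d \<Rightarrow> real^'d"
    proof -
      have "(\<integral>\<^sup>+z. ennreal (norm (weight Y a z * (X z \<bullet> gradient \<psi> z))) \<partial>M) \<le> (\<integral>\<^sup>+z. ennreal K * ennreal (weight Y a z * norm (X z)) \<partial>M)"
      proof (rule nn_integral_mono)
        fix z
        have "weight Y a z * \<bar>X z \<bullet> gradient \<psi> z\<bar> \<le> weight Y a z * (K * norm (X z))" by (intro mult_left_mono K' weight_nonneg)
        then have "norm (weight Y a z * (X z \<bullet> gradient \<psi> z)) \<le> K * (weight Y a z * norm (X z))"
          by (simp add: abs_mult weight_nonneg mult.left_commute)
        then show "ennreal (norm (weight Y a z * (X z \<bullet> gradient \<psi> z))) \<le> ennreal K * ennreal (weight Y a z * norm (X z))"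
          using K by (simp add: ennreal_mult'[symmetric] ennreal_leI)
      qed
      also have "\<dots> = ennreal K * (\<integral>\<^sup>+z. ennreal (weight Y a z * norm (X z)) \<partial>M)" by (rule nn_integral_cmult) measurable
      finally show ?thesis .
    qed
    have intG: "integrable M (\<lambda>z. weight Y a z * (G z \<bullet> gradient \<psi> z))"
    proof (rule integrableI_bounded)
      show "(\<integral>\<^sup>+z. ennreal (norm (weight Y a z * (G z \<bullet> gradient \<psi> z))) \<partial>M) < \<infinity>"
        using Gfin by (intro le_less_trans[OF bound]) (auto simp: ennreal_mult_less_top)
    qed measurable
    \<comment> \<open>\<open>I k\<close> tends to the weak form of \<open>G\<close> tested with
      \<open>\<psi>\<close>, which is 0. By Green's identity it also tends to minus the integral of
      \<open>U * bessel_op \<psi>\<close>, and comparing the two limits gives the claim.\<close>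
    define I where "I = (\<lambda>k. \<integral>z. weight Y a z * (gradient (\<phi> k) z \<bullet> gradient \<psi> z) \<partial>M)"
    have I1: "(\<lambda>k. ennreal \<bar>I k\<bar>) \<longlonglongrightarrow> 0"
    proof (rule tendsto_sandwich[OF _ _ tendsto_const])
      show "(\<lambda>k. ennreal K * (\<integral>\<^sup>+z. ennreal (weight Y a z * \<bar>norm (gradient (\<phi> k) z - G z)\<bar>) \<partial>M)) \<longlonglongrightarrow> 0"
        using ennreal_tendsto_cmult[OF _ gL, of "ennreal K"] by simp
      have "\<forall>\<^sub>F k in sequentially. (\<integral>\<^sup>+z. ennreal (weight Y a z * \<bar>norm (gradient (\<phi> k) z - G z)\<bar>) \<partial>M) < \<infinity>"
        by (rule order_tendstoD(2)[OF gL]) simp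
      then show "\<forall>\<^sub>F k in sequentially. ennreal \<bar>I k\<bar> \<le> ennreal K * (\<integral>\<^sup>+z. ennreal (weight Y a z * \<bar>norm (gradient (\<phi> k) z - G z)\<bar>) \<partial>M)"
      proof eventually_elim
        case (elim k)
        have b: "(\<integral>\<^sup>+z. ennreal (norm (weight Y a z * ((gradient (\<phi> k) z - G z) \<bullet> gradient \<psi> z))) \<partial>M) \<le> ennreal K * (\<integral>\<^sup>+z. ennreal (weight Y a z * \<bar>norm (gradient (\<phi> k) z - G z)\<bar>) \<partial>M)"
          using bound[of "\<lambda>z. gradient (\<phi> k) z - G z"] by simp
        have int: "integrable M (\<lambda>z. weight Y a z * ((gradient (\<phi> k) z - G z) \<bullet> gradient \<psi> z))"
          by (rule integrableI_bounded) (measurable, use b elim in \<open>auto simp: ennreal_mult_less_top intro: le_less_trans\<close>)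
        have "I k = (\<integral>z. weight Y a z * (G z \<bullet> gradient \<psi> z) + weight Y a z * ((gradient (\<phi> k) z - G z) \<bullet> gradient \<psi> z) \<partial>M)"
          unfolding I_def by (intro Bochner_Integration.integral_cong) (auto simp: inner_diff_left algebra_simps)
        also have "\<dots> = (\<integral>z. weight Y a z * ((gradient (\<phi> k) z - G z) \<bullet> gradient \<psi> z) \<partial>M)"
          using G0 by (simp add: Bochner_Integration.integral_add[OF intG int])
        finally show ?case using integral_norm_bound_ennreal[OF int] b by simp
      qed
    qed simp
    have gr: "(\<lambda>z. gradient (\<phi> k) z \<bullet> gradient \<psi> z) \<in> borel_measurable borel" for k
      by (intro borel_measurable_inner \<phi>gm \<psi>gm)
    have IN: "I k = - (\<integral>z. \<phi> k z * bessel_op \<psi> z \<partial>N)" for k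
    proof -
      have "I k = (\<integral>z. indicator D z * (gradient (\<phi> k) z \<bullet> gradient \<psi> z) \<partial>N)"
        unfolding I_def by (intro integral_M gr)
      also have "\<dots> = (\<integral>z. gradient (\<phi> k) z \<bullet> gradient \<psi> z \<partial>N)"
      proof (rule integral_cong_AE)
        show "AE z in N. indicator D z * (gradient (\<phi> k) z \<bullet> gradient \<psi> z) = gradient (\<phi> k) z \<bullet> gradient \<psi> z"
          using AE_N_orthant by eventually_elim (auto simp: indicator_def half_ball_eq g0)
      qed (unfold borel_measurable_N, intro borel_measurable_times borel_measurable_indicator half_ball_sets gr, rule gr)
      finally show ?thesis by (simp add: green_identity(1)[OF \<psi> sm])
    qed
    have intUL: "integrable N (\<lambda>z. U z * bessel_op \<psi> z)"
      by (rule Bochner_Integration.integrable_bound[OF integrable_mult_right[OF intU, of B]])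
         (auto intro!: AE_I2 simp: abs_mult B mult.commute[of B] mult_left_mono)
    have est: "ennreal \<bar>(\<integral>z. \<phi> k z * bessel_op \<psi> z \<partial>N) - (\<integral>z. U z * bessel_op \<psi> z \<partial>N)\<bar> \<le> ennreal B * (\<integral>\<^sup>+z. ennreal (indicator D z * \<bar>\<phi> k z - U z\<bar>) \<partial>N)" for k
    proof -
      have i: "integrable N (\<lambda>z. \<phi> k z * bessel_op \<psi> z - U z * bessel_op \<psi> z)"
        by (intro Bochner_Integration.integrable_diff green_identity(2)[OF \<psi> sm] intUL)
      have "ennreal \<bar>\<integral>z. \<phi> k z * bessel_op \<psi> z - U z * bessel_op \<psi> z \<partial>N\<bar> \<le> (\<integral>\<^sup>+z. ennreal (norm (\<phi> k z * bessel_op \<psi> z - U z * bessel_op \<psi> z)) \<partial>N)"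
        using integral_norm_bound_ennreal[OF i] by simp
      also have "\<dots> \<le> (\<integral>\<^sup>+z. ennreal B * ennreal (indicator D z * \<bar>\<phi> k z - U z\<bar>) \<partial>N)"
      proof (rule nn_integral_mono_AE, use AE_N_orthant in eventually_elim)
        case (elim z)
        have "\<bar>\<phi> k z - U z\<bar> * \<bar>bessel_op \<psi> z\<bar> \<le> B * (indicator D z * \<bar>\<phi> k z - U z\<bar>)"
        proof (cases "z \<in> D")
          case True
          then show ?thesis using mult_left_mono[OF B(2)[of z] abs_ge_zero[of "\<phi> k z - U z"]] by (simp add: mult.commute)
        next
          case False
          then show ?thesis using elim L0 by (simp add: half_ball_eq)
        qed
        then show ?case
          using B(1) by (simp add: ennreal_mult'[symmetric] ennreal_leI abs_mult left_diff_distrib[symmetric])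
      qed
      also have "\<dots> = ennreal B * (\<integral>\<^sup>+z. ennreal (indicator D z * \<bar>\<phi> k z - U z\<bar>) \<partial>N)"
        by (intro nn_integral_cmult, unfold borel_measurable_N)
           (intro measurable_compose[OF _ measurable_ennreal] borel_measurable_times borel_measurable_indicator half_ball_sets borel_measurable_abs borel_measurable_diff \<phi>m Um)
      finally show ?thesis
        by (simp add: Bochner_Integration.integral_diff[OF green_identity(2)[OF \<psi> sm] intUL])
    qed
    have "(\<lambda>k. ennreal B * (\<integral>\<^sup>+z. ennreal (indicator D z * \<bar>\<phi> k z - U z\<bar>) \<partial>N)) \<longlonglongrightarrow> 0"
      using ennreal_tendsto_cmult[OF _ Ulim, of "ennreal B"] by simp
    then have "(\<lambda>k. ennreal \<bar>(\<integral>z. \<phi> k z * bessel_op \<psi> z \<partial>N) - (\<integral>z. U z * bessel_op \<psi> z \<partial>N)\<bar>) \<longlonglongrightarrow> 0"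
      by (rule tendsto_sandwich[OF _ _ tendsto_const, rotated 2]) (use est in auto)
    then have "(\<lambda>k. (\<integral>z. \<phi> k z * bessel_op \<psi> z \<partial>N) - (\<integral>z. U z * bessel_op \<psi> z \<partial>N)) \<longlonglongrightarrow> 0"
      by (simp add: tendsto_rabs_zero_iff ennreal_tendsto_0_iff)
    moreover have "I \<longlonglongrightarrow> 0" using I1 by (simp add: tendsto_rabs_zero_iff ennreal_tendsto_0_iff)
    ultimately have "(\<lambda>k. ((\<integral>z. \<phi> k z * bessel_op \<psi> z \<partial>N) - (\<integral>z. U z * bessel_op \<psi> z \<partial>N)) + I k) \<longlonglongrightarrow> 0 + 0"
      by (rule tendsto_add)
    then show ?thesis by (simp add: IN LIMSEQ_const_iff)
  qed
  show ?thesis by (rule that[OF Um U0 uU intU sm Ulim weak])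
qed

end

subsection \<open>Differentiation under the integral sign\<close>


text \<open>The mean value inequality bounds increments by \<open>g x * norm (q - p)\<close>, hence
  the normalised linearisation errors by \<open>2 * g x\<close>. Dominated convergence along
  sequences then gives the full Frechet derivative, not only directional ones.\<close>

lemma has_derivative_integral:
  fixes f :: "'p::{real_normed_vector,perfect_space} \<Rightarrow> 'x \<Rightarrow> real" and f' :: "'p \<Rightarrow> 'x \<Rightarrow> 'p \<Rightarrow> real"
  assumes S: "open S" "convex S" "p \<in> S"
    and int: "\<And>q. q \<in> S \<Longrightarrow> integrable \<mu> (f q)"
    and der: "\<And>q x. q \<in> S \<Longrightarrow> x \<in> space \<mu> \<Longrightarrow> ((\<lambda>q. f q x) has_derivative f' q x) (at q)"
    and meas: "\<And>h. (\<lambda>x. f' p x h) \<in> borel_measurable \<mu>"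
    and g: "integrable \<mu> g"
    and bnd: "\<And>q x h. q \<in> S \<Longrightarrow> x \<in> space \<mu> \<Longrightarrow> \<bar>f' q x h\<bar> \<le> g x * norm h"
  shows "((\<lambda>q. \<integral>x. f q x \<partial>\<mu>) has_derivative (\<lambda>h. \<integral>x. f' p x h \<partial>\<mu>)) (at p)"
proof -
  have lin: "linear (f' q x)" if "q \<in> S" "x \<in> space \<mu>" for q x
    using der[OF that] by (rule has_derivative_linear)
  have int': "integrable \<mu> (\<lambda>x. f' p x h)" for h
  proof (rule Bochner_Integration.integrable_bound[OF integrable_mult_left[OF g, of "norm h"] meas])
    show "AE x in \<mu>. norm (f' p x h) \<le> norm (g x * norm h)"
    proof (rule AE_I2)
      fix x assume "x \<in> space \<mu>"
      from bnd[OF S(3) this, of h] show "norm (f' p x h) \<le> norm (g x * norm h)" by simp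
    qed
  qed
  have bl: "bounded_linear (\<lambda>h. \<integral>x. f' p x h \<partial>\<mu>)"
  proof (rule bounded_linear_intro)
    fix h k :: 'p and c :: real
    show "(\<integral>x. f' p x (h + k) \<partial>\<mu>) = (\<integral>x. f' p x h \<partial>\<mu>) + (\<integral>x. f' p x k \<partial>\<mu>)"
      by (subst Bochner_Integration.integral_add[OF int' int', symmetric])
         (intro Bochner_Integration.integral_cong refl linear_add[OF lin[OF S(3)]])
    show "(\<integral>x. f' p x (c *\<^sub>R h) \<partial>\<mu>) = c *\<^sub>R (\<integral>x. f' p x h \<partial>\<mu>)"
    proof -
      have "(\<integral>x. f' p x (c *\<^sub>R h) \<partial>\<mu>) = (\<integral>x. c * f' p x h \<partial>\<mu>)"
        by (intro Bochner_Integration.integral_cong refl) (simp add: linear_scale[OF lin[OF S(3)]])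
      then show ?thesis by simp
    qed
    have "norm (\<integral>x. f' p x h \<partial>\<mu>) \<le> (\<integral>x. g x * norm h \<partial>\<mu>)"
      unfolding real_norm_def
      by (rule order_trans[OF integral_abs_bound integral_mono[OF integrable_abs[OF int'] integrable_mult_left[OF g]]])
         (rule bnd[OF S(3)])
    then show "norm (\<integral>x. f' p x h \<partial>\<mu>) \<le> norm h * (\<integral>x. g x \<partial>\<mu>)" by (simp add: mult.commute)
  qed
  have lip: "\<bar>f q x - f p x\<bar> \<le> g x * norm (q - p)" if q: "q \<in> S" and x: "x \<in> space \<mu>" for q x
  proof -
    have "norm (f q x - f p x) \<le> g x * norm (q - p)"
    proof (rule differentiable_bound[OF S(2) _ _ q S(3)])
      show "((\<lambda>q. f q x) has_derivative f' q x) (at q within S)" if "q \<in> S" for q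
        using der[OF that x] by (rule has_derivative_at_withinI)
      show "onorm (f' q x) \<le> g x" if "q \<in> S" for q
        by (rule onorm_le) (use bnd[OF that x] in simp)
    qed
    then show ?thesis by simp
  qed
  have quot: "\<bar>f q x - f p x - f' p x (q - p)\<bar> / norm (q - p) \<le> 2 * g x" if q: "q \<in> S" "q \<noteq> p" and x: "x \<in> space \<mu>" for q x
  proof -
    have "\<bar>f q x - f p x - f' p x (q - p)\<bar> \<le> 2 * g x * norm (q - p)"
      using lip[OF q(1) x] bnd[OF S(3) x, of "q - p"] by linarith
    then show ?thesis using q(2) by (simp add: divide_le_eq)
  qed
  have "((\<lambda>q. norm ((\<integral>x. f q x \<partial>\<mu>) - (\<integral>x. f p x \<partial>\<mu>) - (\<integral>x. f' p x (q - p) \<partial>\<mu>)) / norm (q - p)) \<longlongrightarrow> 0) (at p)"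
    unfolding tendsto_at_iff_sequentially o_def
  proof (intro allI impI)
    fix X assume X: "\<forall>i. X i \<in> UNIV - {p}" "X \<longlonglongrightarrow> p"
    have "\<forall>\<^sub>F n in sequentially. X n \<in> S" using X(2) S(1,3) by (rule topological_tendstoD)
    then obtain m where m: "\<And>n. m \<le> n \<Longrightarrow> X n \<in> S" by (auto simp: eventually_sequentially)
    \<comment> \<open>Dropping the first \<open>m\<close> terms puts the whole sequence into
      \<open>S\<close>, where the bounds hold.\<close>
    define Z where "Z = (\<lambda>n. X (n + m))"
    have Z: "Z n \<in> S" "Z n \<noteq> p" for n using m X(1) by (auto simp: Z_def)
    have Zl: "filterlim Z (at p) sequentially"
      unfolding filterlim_at using Z LIMSEQ_ignore_initial_segment[OF X(2), of m] by (auto simp: Z_def)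
    define q where "q = (\<lambda>n x. \<bar>f (Z n) x - f p x - f' p x (Z n - p)\<bar> / norm (Z n - p))"
    have qi: "integrable \<mu> (\<lambda>x. f (Z n) x - f p x - f' p x (Z n - p))" for n
      by (intro Bochner_Integration.integrable_diff int int' Z S)
    have "(\<lambda>n. \<integral>x. q n x \<partial>\<mu>) \<longlonglongrightarrow> (\<integral>x. 0 \<partial>\<mu>)"
    proof (rule integral_dominated_convergence[where w="\<lambda>x. 2 * g x"])
      show "AE x in \<mu>. (\<lambda>n. q n x) \<longlonglongrightarrow> 0"
      proof (rule AE_I2)
        fix x assume "x \<in> space \<mu>"
        from der[OF S(3) this] have "((\<lambda>y. norm (f y x - f p x - f' p x (y - p)) / norm (y - p)) \<longlongrightarrow> 0) (at p)"
          by (simp add: has_derivative_iff_norm)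
        from filterlim_compose[OF this Zl] show "(\<lambda>n. q n x) \<longlonglongrightarrow> 0" by (simp add: q_def)
      qed
      show "AE x in \<mu>. norm (q n x) \<le> 2 * g x" for n
        by (rule AE_I2) (use quot Z in \<open>simp add: q_def\<close>)
      show "q n \<in> borel_measurable \<mu>" for n unfolding q_def using borel_measurable_integrable[OF qi[of n]] by measurable
    qed (use g in auto)
    then have lim0: "(\<lambda>n. \<integral>x. q n x \<partial>\<mu>) \<longlonglongrightarrow> 0" by simp
    have "norm ((\<integral>x. f (Z n) x \<partial>\<mu>) - (\<integral>x. f p x \<partial>\<mu>) - (\<integral>x. f' p x (Z n - p) \<partial>\<mu>)) / norm (Z n - p) \<le> (\<integral>x. q n x \<partial>\<mu>)" for n
    proof -
      have "(\<integral>x. f (Z n) x \<partial>\<mu>) - (\<integral>x. f p x \<partial>\<mu>) - (\<integral>x. f' p x (Z n - p) \<partial>\<mu>) = (\<integral>x. f (Z n) x - f p x - f' p x (Z n - p) \<partial>\<mu>)"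
        using int[OF Z(1)] int[OF S(3)] int' by simp
      also have "norm \<dots> \<le> (\<integral>x. \<bar>f (Z n) x - f p x - f' p x (Z n - p)\<bar> \<partial>\<mu>)" by simp
      also have "\<dots> = (\<integral>x. q n x * norm (Z n - p) \<partial>\<mu>)" using Z by (simp add: q_def)
      also have "\<dots> = (\<integral>x. q n x \<partial>\<mu>) * norm (Z n - p)" by simp
      finally show ?thesis using Z by (simp add: divide_le_eq)
    qed
    then have "(\<lambda>n. norm ((\<integral>x. f (Z n) x \<partial>\<mu>) - (\<integral>x. f p x \<partial>\<mu>) - (\<integral>x. f' p x (Z n - p) \<partial>\<mu>)) / norm (Z n - p)) \<longlonglongrightarrow> 0"
      by (intro tendsto_sandwich[OF _ _ tendsto_const lim0]) auto
    then show "(\<lambda>n. norm ((\<integral>x. f (X n) x \<partial>\<mu>) - (\<integral>x. f p x \<partial>\<mu>) - (\<integral>x. f' p x (X n - p) \<partial>\<mu>)) / norm (X n - p)) \<longlonglongrightarrow> 0"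
      unfolding Z_def by (rule LIMSEQ_offset)
  qed
  then show ?thesis using bl by (simp add: has_derivative_iff_norm)
qed

lemma has_real_derivative_integral:
  fixes f f' :: "real \<Rightarrow> 'x \<Rightarrow> real"
  assumes p: "c < p" "p < d"
    and int: "\<And>q. c < q \<Longrightarrow> q < d \<Longrightarrow> integrable \<mu> (f q)"
    and der: "\<And>q x. c < q \<Longrightarrow> q < d \<Longrightarrow> x \<in> space \<mu> \<Longrightarrow> ((\<lambda>q. f q x) has_real_derivative f' q x) (at q)"
    and meas: "f' p \<in> borel_measurable \<mu>"
    and g: "integrable \<mu> g"
    and bnd: "\<And>q x. c < q \<Longrightarrow> q < d \<Longrightarrow> x \<in> space \<mu> \<Longrightarrow> \<bar>f' q x\<bar> \<le> g x"
  shows "((\<lambda>q. \<integral>x. f q x \<partial>\<mu>) has_real_derivative (\<integral>x. f' p x \<partial>\<mu>)) (at p)"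
proof -
  have "((\<lambda>q. \<integral>x. f q x \<partial>\<mu>) has_derivative (\<lambda>h. \<integral>x. f' p x * h \<partial>\<mu>)) (at p)"
    by (rule has_derivative_integral[where S="{c<..<d}" and g=g])
       (use assms in \<open>auto simp: abs_mult mult_right_mono has_field_derivative_def\<close>)
  then show ?thesis by (simp add: has_field_derivative_def)
qed

text \<open>\<open>K is\<close> plays the role of the iterated partial derivative of \<open>K []\<close> in the directions \<open>is\<close>.\<close>

definition deriv_family :: "(real^'d::finite) set \<Rightarrow> ('d list \<Rightarrow> real^'d \<Rightarrow> real) \<Rightarrow> bool" where
  "deriv_family S K \<longleftrightarrow> (\<forall>is. \<forall>z\<in>S. (K is has_derivative (\<lambda>h. \<Sum>i\<in>UNIV. h $ i * K (i # is) z)) (at z))"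

definition bounded_family :: "(real^'d::finite) set \<Rightarrow> ('d list \<Rightarrow> real^'d \<Rightarrow> real) \<Rightarrow> bool" where
  "bounded_family S K \<longleftrightarrow> (\<forall>is. \<exists>B. \<forall>z\<in>S. \<bar>K is z\<bar> \<le> B)"

text \<open>Stated for an arbitrary measure because it is applied twice: with \<open>N\<close> to
  the integral over \<open>w\<close>, and with \<open>T\<close> to the integral over time.\<close>

lemma deriv_family_integral:
  fixes K :: "'d::finite list \<Rightarrow> real^'d \<Rightarrow> 'x \<Rightarrow> real"
  assumes S: "open S" "convex S"
    and fam: "\<And>x. x \<in> space \<mu> \<Longrightarrow> deriv_family S (\<lambda>is z. K is z x)"
    and meas: "\<And>is z. z \<in> S \<Longrightarrow> K is z \<in> borel_measurable \<mu>"
    and g: "\<And>is. integrable \<mu> (g is)"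
    and bnd: "\<And>is z x. z \<in> S \<Longrightarrow> x \<in> space \<mu> \<Longrightarrow> \<bar>K is z x\<bar> \<le> g is x"
  shows "deriv_family S (\<lambda>is z. \<integral>x. K is z x \<partial>\<mu>)" "bounded_family S (\<lambda>is z. \<integral>x. K is z x \<partial>\<mu>)"
proof -
  have int: "integrable \<mu> (K is z)" if "z \<in> S" for z "is"
  proof (rule Bochner_Integration.integrable_bound[OF g[of "is"] meas[OF that]])
    show "AE x in \<mu>. norm (K is z x) \<le> norm (g is x)"
    proof (rule AE_I2)
      fix x assume "x \<in> space \<mu>"
      from bnd[OF that this, of "is"] show "norm (K is z x) \<le> norm (g is x)" by simp
    qed
  qed
  show "deriv_family S (\<lambda>is z. \<integral>x. K is z x \<partial>\<mu>)"
    unfolding deriv_family_def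
  proof (intro allI ballI)
    fix "is" z assume z: "z \<in> S"
    have "((\<lambda>z. \<integral>x. K is z x \<partial>\<mu>) has_derivative (\<lambda>h. \<integral>x. (\<Sum>i\<in>UNIV. h $ i * K (i # is) z x) \<partial>\<mu>)) (at z)"
    proof (rule has_derivative_integral[where g="\<lambda>x. \<Sum>i\<in>UNIV. g (i # is) x" and f'="\<lambda>z x h. \<Sum>i\<in>UNIV. h $ i * K (i # is) z x", OF S z])
      show "integrable \<mu> (K is q)" if "q \<in> S" for q by (rule int[OF that])
      show "((\<lambda>q. K is q x) has_derivative (\<lambda>h. \<Sum>i\<in>UNIV. h $ i * K (i # is) q x)) (at q)" if "q \<in> S" "x \<in> space \<mu>" for q x
        using fam[OF that(2)] that(1) by (simp add: deriv_family_def)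
      show "(\<lambda>x. \<Sum>i\<in>UNIV. h $ i * K (i # is) z x) \<in> borel_measurable \<mu>" for h
        using meas[OF z] by (intro borel_measurable_sum borel_measurable_times borel_measurable_const)
      show "integrable \<mu> (\<lambda>x. \<Sum>i\<in>UNIV. g (i # is) x)" using g by auto
      show "\<bar>\<Sum>i\<in>UNIV. h $ i * K (i # is) q x\<bar> \<le> (\<Sum>i\<in>UNIV. g (i # is) x) * norm h" if "q \<in> S" "x \<in> space \<mu>" for q x h
      proof -
        have "\<bar>\<Sum>i\<in>UNIV. h $ i * K (i # is) q x\<bar> \<le> (\<Sum>i\<in>UNIV. norm h * g (i # is) x)"
          by (rule order_trans[OF sum_abs sum_mono])
             (unfold abs_mult, intro mult_mono bnd that component_le_norm_cart, auto)
        then show ?thesis by (simp add: sum_distrib_left mult.commute)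
      qed
    qed
    then show "((\<lambda>z. \<integral>x. K is z x \<partial>\<mu>) has_derivative (\<lambda>h. \<Sum>i\<in>UNIV. h $ i * (\<integral>x. K (i # is) z x \<partial>\<mu>))) (at z)"
      using int[OF z] by simp
  qed
  show "bounded_family S (\<lambda>is z. \<integral>x. K is z x \<partial>\<mu>)"
    unfolding bounded_family_def
  proof (intro allI exI ballI)
    fix "is" z assume z: "z \<in> S"
    show "\<bar>\<integral>x. K is z x \<partial>\<mu>\<bar> \<le> (\<integral>x. g is x \<partial>\<mu>)"
      by (rule order_trans[OF integral_abs_bound integral_mono[OF integrable_abs[OF int[OF z]] g]]) (rule bnd[OF z])
  qed
qed

lemma deriv_family_scale: "deriv_family S K \<Longrightarrow> deriv_family S (\<lambda>is z. c * K is z)"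
  unfolding deriv_family_def
proof (intro allI ballI)
  fix "is" z assume "\<forall>is. \<forall>z\<in>S. (K is has_derivative (\<lambda>h. \<Sum>i\<in>UNIV. h $ i * K (i # is) z)) (at z)" "z \<in> S"
  then have "((\<lambda>z. c * K is z) has_derivative (\<lambda>h. c * (\<Sum>i\<in>UNIV. h $ i * K (i # is) z))) (at z)"
    by (intro has_derivative_mult_right) auto
  then show "((\<lambda>z. c * K is z) has_derivative (\<lambda>h. \<Sum>i\<in>UNIV. h $ i * (c * K (i # is) z))) (at z)"
    by (simp add: sum_distrib_left mult.left_commute)
qed

lemma deriv_family_add: "deriv_family S K \<Longrightarrow> deriv_family S L \<Longrightarrow> deriv_family S (\<lambda>is z. K is z + L is z)"
  unfolding deriv_family_def by (fastforce dest: has_derivative_add simp: sum.distrib distrib_left)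

lemma deriv_family_sum: "finite I \<Longrightarrow> (\<And>j. j \<in> I \<Longrightarrow> deriv_family S (K j)) \<Longrightarrow> deriv_family S (\<lambda>is z. \<Sum>j\<in>I. K j is z)"
proof (induction rule: finite_induct)
  case empty
  then show ?case by (simp add: deriv_family_def)
next
  case (insert j I)
  then show ?case using deriv_family_add[of S "K j" "\<lambda>is z. \<Sum>j\<in>I. K j is z"] by simp
qed

lemma bounded_family_scale: "bounded_family S K \<Longrightarrow> bounded_family S (\<lambda>is z. c * K is z)"
  unfolding bounded_family_def abs_mult by (metis abs_ge_zero mult_left_mono)

lemma bounded_family_add: "bounded_family S K \<Longrightarrow> bounded_family S L \<Longrightarrow> bounded_family S (\<lambda>is z. K is z + L is z)"
  unfolding bounded_family_def by (metis abs_triangle_ineq add_mono order_trans)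

lemma partial_deriv_cong_open:
  assumes "open S" "z \<in> S" "\<And>w. w \<in> S \<Longrightarrow> f w = g w"
  shows "f differentiable (at z) \<longleftrightarrow> g differentiable (at z)" "partial_deriv i f z = partial_deriv i g z"
proof -
  have "(f has_derivative f') (at z) \<longleftrightarrow> (g has_derivative f') (at z)" for f'
    using has_derivative_transform_within_open[OF _ assms(1,2), of f f' UNIV g] has_derivative_transform_within_open[OF _ assms(1,2), of g f' UNIV f] assms(3)
    by auto
  then show "f differentiable (at z) \<longleftrightarrow> g differentiable (at z)" "partial_deriv i f z = partial_deriv i g z"
    by (simp_all add: differentiable_def partial_deriv_def frechet_derivative_def)
qed

lemma C_k_cong: "open S \<Longrightarrow> (\<And>w. w \<in> S \<Longrightarrow> f w = g w) \<Longrightarrow> C_k k S f \<longleftrightarrow> C_k k S g"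
proof (induction k arbitrary: f g)
  case 0
  then show ?case by (simp cong: continuous_on_cong)
next
  case (Suc k)
  have "C_k k S (partial_deriv i f) \<longleftrightarrow> C_k k S (partial_deriv i g)" for i
    by (rule Suc.IH[OF Suc.prems(1)]) (rule partial_deriv_cong_open(2)[OF Suc.prems(1) _ Suc.prems(2)])
  then show ?case using partial_deriv_cong_open(1)[OF Suc.prems(1) _ Suc.prems(2)] by auto
qed

text \<open>Bounds of all orders make every derivative Lipschitz on the convex set \<open>S\<close>.
  On a set of diameter at most \<open>2 * R\<close> a Lipschitz function is Hoelder continuous for
  each exponent below 1.\<close>

lemma deriv_family_C_infinity:
  fixes S :: "(real^'d::finite) set"
  assumes S: "open S" "convex S" "S \<subseteq> ball 0 R" and fam: "deriv_family S K" and bd: "bounded_family S K"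
  shows "K [] \<in> C_infinity S"
proof -
  have D: "(K is has_derivative (\<lambda>h. \<Sum>i\<in>UNIV. h $ i * K (i # is) z)) (at z)" if "z \<in> S" for "is" z
    using fam that by (auto simp: deriv_family_def)
  have pd: "partial_deriv i (K is) z = K (i # is) z" if "z \<in> S" for i "is" z
    using partial_deriv_eqI[OF D[OF that]] .
  have ck: "C_k k S (K is)" for k "is"
  proof (induction k arbitrary: "is")
    case 0
    show ?case using D by (auto intro!: continuous_at_imp_continuous_on has_derivative_continuous)
  next
    case (Suc k)
    have "C_k k S (partial_deriv i (K is))" for i
      using C_k_cong[OF S(1), of "partial_deriv i (K is)" "K (i # is)"] pd Suc by blast
    then show ?case using D by (auto simp: differentiable_def)
  qed
  have it: "iter_deriv is (K []) z = K is z" if "z \<in> S" for "is" z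
    using that
  proof (induction "is" arbitrary: z)
    case (Cons i "is")
    have "iter_deriv (i # is) (K []) z = partial_deriv i (iter_deriv is (K [])) z" by (simp add: iter_deriv_def)
    also have "\<dots> = partial_deriv i (K is) z" by (rule partial_deriv_cong_open(2)[OF S(1) Cons.prems Cons.IH])
    finally show ?case using pd[OF Cons.prems] by simp
  qed (simp add: iter_deriv_def)
  obtain B where B: "\<And>is z. z \<in> S \<Longrightarrow> \<bar>K is z\<bar> \<le> B is" using bd unfolding bounded_family_def by metis
  have sup: "sup_norm_on S (iter_deriv is (K [])) < \<infinity>" for "is"
  proof -
    have "sup_norm_on S (iter_deriv is (K [])) \<le> ennreal (B is)"
      unfolding sup_norm_on_def by (rule SUP_least) (simp add: it B ennreal_leI)
    then show ?thesis by (rule le_less_trans) simp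
  qed
  have hol: "holder_seminorm \<alpha> S (iter_deriv is (K [])) < \<infinity>" if \<alpha>: "0 < \<alpha>" "\<alpha> < 1" for \<alpha> "is"
  proof -
    define L where "L = (\<Sum>i\<in>UNIV. \<bar>B (i # is)\<bar>)"
    have L0: "0 \<le> L" by (simp add: L_def sum_nonneg)
    have lip: "\<bar>K is z - K is w\<bar> \<le> L * dist z w" if z: "z \<in> S" "w \<in> S" for z w
    proof -
      have "norm (K is z - K is w) \<le> L * norm (z - w)"
      proof (rule differentiable_bound[OF S(2) _ _ z])
        show "(K is has_derivative (\<lambda>h. \<Sum>i\<in>UNIV. h $ i * K (i # is) q)) (at q within S)" if "q \<in> S" for q
          by (rule has_derivative_at_withinI[OF D[OF that]])
        show "onorm (\<lambda>h. \<Sum>i\<in>UNIV. h $ i * K (i # is) q) \<le> L" if "q \<in> S" for q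
        proof (rule onorm_le)
          fix h :: "real^'d"
          have "\<bar>\<Sum>i\<in>UNIV. h $ i * K (i # is) q\<bar> \<le> (\<Sum>i\<in>UNIV. norm h * \<bar>B (i # is)\<bar>)"
            by (rule order_trans[OF sum_abs sum_mono])
               (unfold abs_mult, intro mult_mono component_le_norm_cart order_trans[OF B[OF that]], auto)
          then show "norm (\<Sum>i\<in>UNIV. h $ i * K (i # is) q) \<le> L * norm h" by (simp add: L_def sum_distrib_left mult.commute)
        qed
      qed
      then show ?thesis by (simp add: dist_norm)
    qed
    have "holder_seminorm \<alpha> S (iter_deriv is (K [])) \<le> ennreal (L * (2 * R) powr (1 - \<alpha>))"
      unfolding holder_seminorm_def
    proof (rule SUP_least, clarify)
      fix z w assume zw: "z \<in> S" "w \<in> S" "z \<noteq> w"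
      have d: "0 < dist z w" using zw by simp
      have "norm z < R" "norm w < R" using zw S(3) by auto
      then have d2: "dist z w \<le> 2 * R" using dist_triangle2[of z w 0] by simp
      have "dist z w = dist z w powr (1 - \<alpha>) * dist z w powr \<alpha>" using d by (simp flip: powr_add)
      then have "L * dist z w \<le> L * ((2 * R) powr (1 - \<alpha>) * dist z w powr \<alpha>)"
        using d d2 \<alpha> L0 by (metis less_eq_real_def mult_left_mono mult_right_mono powr_ge_zero powr_mono2 diff_ge_0_iff_ge)
      then have "\<bar>K is z - K is w\<bar> / dist z w powr \<alpha> \<le> L * (2 * R) powr (1 - \<alpha>)"
        using lip[OF zw(1,2)] d by (simp add: divide_le_eq mult.assoc)
      then show "ennreal (\<bar>iter_deriv is (K []) z - iter_deriv is (K []) w\<bar> / dist z w powr \<alpha>) \<le> ennreal (L * (2 * R) powr (1 - \<alpha>))"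
        using zw by (simp add: it ennreal_leI)
    qed
    then show ?thesis by (rule le_less_trans) simp
  qed
  have f1: "finite {is :: 'd list. length is \<le> k}" for k
    using finite_lists_length_le[of "UNIV :: 'd set" k] by simp
  have f2: "finite {is :: 'd list. length is = k}" for k
    using finite_lists_length_eq[of "UNIV :: 'd set" k] by simp
  show ?thesis
    unfolding C_infinity_def C_k_alpha_norm_def using ck sup hol f1 f2
    by (auto simp: less_top[symmetric])
qed

subsection \<open>Derivatives of the heat kernel\<close>


lemma has_derivative_prod_coord:
  fixes w :: "real^'d::finite"
  assumes "\<And>j. (g j has_real_derivative g' j) (at (w $ j))"
  shows "((\<lambda>w. \<Prod>j\<in>UNIV. g j (w $ j)) has_derivative
     (\<lambda>h. \<Sum>i\<in>UNIV. h $ i * (\<Prod>j\<in>UNIV. if j = i then g' j else g j (w $ j)))) (at w)"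
proof -
  have c: "((\<lambda>w. g j (w $ j)) has_derivative (\<lambda>h. g' j * h $ j)) (at w)" for j
    by (rule has_derivative_compose[OF has_derivative_coord assms[of j, unfolded has_field_derivative_def]])
  have p: "(\<Prod>j\<in>UNIV. if j = i then g' j else g j (w $ j)) = g' i * (\<Prod>j\<in>UNIV - {i}. g j (w $ j))" for i
    by (subst prod.remove[of _ i]) (auto intro!: prod.cong)
  show ?thesis
    by (rule has_derivative_eq_rhs[OF has_derivative_prod[OF c]]) (simp add: p mult_ac)
qed

text \<open>\<open>bexp h al\<close> is, by construction, the sequence of all derivatives demanded
  by the rule \<open>elem_smooth.comp\<close>.\<close>

lemma (in bessel1) elem_smooth_heat1: "elem_smooth (\<lambda>w :: real^'d::finite. heat1 h al s y (w $ i))"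
proof -
  have e: "elem_smooth (\<lambda>w :: real^'d. exp (- (1 / (4 * s)) * (y * y + w $ i * w $ i)))"
    by (rule elem_smooth.comp[of "\<lambda>m. exp"])
       (intro DERIV_exp elem_smooth.mult elem_smooth.add elem_smooth.const elem_smooth.coord)+
  have b: "elem_smooth (\<lambda>w :: real^'d. bexp h al 0 ((y / (2 * s)) * w $ i))"
    by (rule elem_smooth.comp[of "bexp h al"])
       (intro bexp_deriv elem_smooth.mult elem_smooth.const elem_smooth.coord)+
  have "(\<lambda>w :: real^'d. heat1 h al s y (w $ i)) =
     (\<lambda>w. s powr (- ((al + 1) / 2)) * exp (- (1 / (4 * s)) * (y * y + w $ i * w $ i)) * bexp h al 0 ((y / (2 * s)) * w $ i))"
  proof
    fix w :: "real^'d"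
    have "- (y\<^sup>2 + (w $ i)\<^sup>2) / (4 * s) = - (1 / (4 * s)) * (y * y + w $ i * w $ i)"
      by (simp only: power2_eq_square minus_mult_left[symmetric] minus_divide_left[symmetric]) simp
    moreover have "y * w $ i / (2 * s) = (y / (2 * s)) * w $ i" by simp
    ultimately show "heat1 h al s y (w $ i) = s powr (- ((al + 1) / 2)) * exp (- (1 / (4 * s)) * (y * y + w $ i * w $ i)) * bexp h al 0 ((y / (2 * s)) * w $ i)"
      unfolding heat1_def by (simp only:)
  qed
  then show ?thesis using e b by (simp only:) (intro elem_smooth.mult elem_smooth.const)
qed

context bessel_weight
begin

definition heat_e :: "'d \<Rightarrow> real \<Rightarrow> real^'d \<Rightarrow> real^'d \<Rightarrow> real" where
  "heat_e i s z w = (\<Prod>j\<in>UNIV. (if j = i then B.heat1_e j else hk j) s (z $ j) (w $ j))"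

definition heat_ee :: "'d \<Rightarrow> real \<Rightarrow> real^'d \<Rightarrow> real^'d \<Rightarrow> real" where
  "heat_ee i s z w = (\<Prod>j\<in>UNIV. (if j = i then B.heat1_ee j else hk j) s (z $ j) (w $ j))"

definition heat_si :: "'d \<Rightarrow> real \<Rightarrow> real^'d \<Rightarrow> real^'d \<Rightarrow> real" where
  "heat_si i s z w = (\<Prod>j\<in>UNIV. (if j = i then B.heat1_s j else hk j) s (z $ j) (w $ j))"

definition heat_s :: "real \<Rightarrow> real^'d \<Rightarrow> real^'d \<Rightarrow> real" where
  "heat_s s z w = (\<Sum>i\<in>UNIV. heat_si i s z w)"

lemma heat_elem_smooth: "elem_smooth (heat s z)"
  unfolding heat_def[abs_def] by (intro elem_smooth_prod B.elem_smooth_heat1 finite)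

lemma partial_deriv_heat:
  assumes s: "0 < s"
  shows "partial_deriv i (heat s z) w = heat_e i s z w"
proof -
  have "(heat s z has_derivative (\<lambda>h. \<Sum>i\<in>UNIV. h $ i * (\<Prod>j\<in>UNIV. if j = i then B.heat1_e j s (z $ j) (w $ j) else hk j s (z $ j) (w $ j)))) (at w)"
    unfolding heat_def[abs_def] by (rule has_derivative_prod_coord) (rule B.heat1_deriv_eta[OF s])
  from partial_deriv_eqI[OF this, of i] show ?thesis
    by (simp add: heat_e_def if_distribR)
qed

lemma partial_deriv_heat_e:
  assumes s: "0 < s"
  shows "partial_deriv i (heat_e i s z) w = heat_ee i s z w"
proof -
  have "(heat_e i s z has_derivative (\<lambda>h. \<Sum>k\<in>UNIV. h $ k * (\<Prod>j\<in>UNIV. if j = k then (if j = i then B.heat1_ee j else B.heat1_e j) s (z $ j) (w $ j) else (if j = i then B.heat1_e j else hk j) s (z $ j) (w $ j)))) (at w)"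
    unfolding heat_e_def[abs_def]
  proof (rule has_derivative_prod_coord)
    fix j
    show "((if j = i then B.heat1_e j else hk j) s (z $ j) has_real_derivative (if j = i then B.heat1_ee j else B.heat1_e j) s (z $ j) (w $ j)) (at (w $ j))"
      by (cases "j = i") (simp_all add: B.heat1_deriv_eta[OF s] B.heat1_e_deriv_eta[OF s])
  qed
  from partial_deriv_eqI[OF this, of i] show ?thesis
    unfolding heat_ee_def by (auto intro!: prod.cong)
qed

lemma heat_deriv_s:
  assumes s: "0 < s"
  shows "((\<lambda>s. heat s z w) has_real_derivative heat_s s z w) (at s)"
proof -
  have "((\<lambda>s. heat s z w) has_derivative (\<lambda>h. \<Sum>i\<in>UNIV. (B.heat1_s i s (z $ i) (w $ i) * h) * (\<Prod>j\<in>UNIV - {i}. hk j s (z $ j) (w $ j)))) (at s)"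
    unfolding heat_def by (rule has_derivative_prod) (rule B.heat1_deriv_s[OF s, unfolded has_field_derivative_def])
  moreover have "heat_si i s z w = B.heat1_s i s (z $ i) (w $ i) * (\<Prod>j\<in>UNIV - {i}. hk j s (z $ j) (w $ j))" for i
    unfolding heat_si_def by (subst prod.remove[of _ i]) (auto intro!: prod.cong)
  then have "(\<lambda>h. \<Sum>i\<in>UNIV. (B.heat1_s i s (z $ i) (w $ i) * h) * (\<Prod>j\<in>UNIV - {i}. hk j s (z $ j) (w $ j))) = (*) (heat_s s z w)"
    by (simp add: heat_s_def fun_eq_iff sum_distrib_left mult_ac)
  ultimately show ?thesis
    unfolding has_field_derivative_def by (simp only:)
qed

lemma heat_equation:
  assumes s: "0 < s" and w: "w \<in> orthant"
  shows "heat_ee i s z w + al i / w $ i * heat_e i s z w = heat_si i s z w"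
proof -
  have n: "i \<in> Y \<Longrightarrow> w $ i \<noteq> 0" using w by (auto simp: orthant_def)
  have p: "(\<Prod>j\<in>UNIV. (if j = i then k j else hk j) s (z $ j) (w $ j)) = k i s (z $ i) (w $ i) * (\<Prod>j\<in>UNIV - {i}. hk j s (z $ j) (w $ j))" for k :: "'d \<Rightarrow> real \<Rightarrow> real \<Rightarrow> real \<Rightarrow> real"
    by (subst prod.remove[of _ i]) (auto intro!: prod.cong)
  have "B.heat1_ee i s (z $ i) (w $ i) + al i / w $ i * B.heat1_e i s (z $ i) (w $ i) = B.heat1_s i s (z $ i) (w $ i)"
    by (rule B.heat1_equation[OF s n])
  then show ?thesis unfolding heat_ee_def heat_e_def heat_si_def p
    by (simp only: mult.assoc[symmetric] distrib_right[symmetric])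
qed

lemma heat_e_boundary: "i \<in> Y \<Longrightarrow> w $ i = 0 \<Longrightarrow> heat_e i s z w = 0"
proof -
  assume i: "i \<in> Y" and w: "w $ i = 0"
  have "B.heat1_e i s (z $ i) (w $ i) = 0" unfolding w by (rule B.heat1_e_0[OF i])
  then show "heat_e i s z w = 0"
    unfolding heat_e_def by (intro prod_zero) (auto intro!: exI[of _ i])
qed

section \<open>The cutoff kernel as a test function\<close>

text \<open>This is \<open>bessel_op\<close> of a cutoff whose partial derivatives are
  \<open>w $ i * m w\<close>, with the singular quotient already cancelled against
  \<open>w $ i\<close>; it is therefore smooth across the hyperplanes.\<close>

definition radial_op :: "(real^'d \<Rightarrow> real) \<Rightarrow> real^'d \<Rightarrow> real" where
  "radial_op m w = (\<Sum>i\<in>UNIV. m w + w $ i * partial_deriv i m w + al i * m w)"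

text \<open>The commutator of the Bessel operator with multiplication by a radial cutoff whose gradient is \<open>m w w\<close>.\<close>

definition commutator :: "(real^'d \<Rightarrow> real) \<Rightarrow> real \<Rightarrow> real^'d \<Rightarrow> real^'d \<Rightarrow> real" where
  "commutator m s z w = (\<Sum>i\<in>UNIV. 2 * w $ i * m w * heat_e i s z w) + radial_op m w * heat s z w"

context
  fixes \<zeta> m :: "real^'d \<Rightarrow> real" and \<rho> :: real
  assumes \<zeta>: "elem_smooth \<zeta>" and m: "elem_smooth m" and grad: "\<And>i w. partial_deriv i \<zeta> w = w $ i * m w"
    and \<rho>: "0 < \<rho>" "\<rho> < 1" and supp: "\<And>w. \<rho> \<le> norm w \<Longrightarrow> \<zeta> w = 0"
begin

lemma partial_deriv_cutoff_heat:
  assumes s: "0 < s"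
  shows "partial_deriv i (\<lambda>w. \<zeta> w * heat s z w) = (\<lambda>w. \<zeta> w * heat_e i s z w + w $ i * m w * heat s z w)"
  by (rule ext, subst partial_deriv_mult)
     (auto simp: elem_smooth_differentiable \<zeta> heat_elem_smooth partial_deriv_heat[OF s] grad)

lemma neumann_test_cutoff_heat:
  assumes s: "0 < s"
  shows "neumann_test (\<lambda>w. \<zeta> w * heat s z w)"
  unfolding neumann_test_def
proof (intro conjI exI[of _ \<rho>] ballI allI impI)
  show "elem_smooth (\<lambda>w. \<zeta> w * heat s z w)" by (rule elem_smooth.mult[OF \<zeta> heat_elem_smooth])
  show "partial_deriv i (\<lambda>w. \<zeta> w * heat s z w) w = 0" if "i \<in> Y" "w $ i = 0" for i w
    unfolding partial_deriv_cutoff_heat[OF s] using that by (simp add: heat_e_boundary)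
qed (use \<rho> supp in auto)

text \<open>With L for \<open>bessel_op\<close> and p for the kernel, L(\<zeta> p) is \<zeta> L p
  plus twice the product of the gradients plus p L \<zeta>, and the heat equation replaces L p by
  the time derivative. On the orthant the quotients by \<open>w $ i\<close> with
  \<open>i \<in> Y\<close> are genuine.\<close>

lemma bessel_op_cutoff_heat:
  assumes s: "0 < s" and w: "w \<in> orthant"
  shows "bessel_op (\<lambda>w. \<zeta> w * heat s z w) w = \<zeta> w * heat_s s z w + commutator m s z w"
proof -
  have he: "heat_e i s z = partial_deriv i (heat s z)" for i using partial_deriv_heat[OF s] by auto
  have es: "elem_smooth (heat_e i s z)" for i unfolding he by (rule elem_smooth_partial[OF heat_elem_smooth])
  have d: "\<zeta> differentiable (at w)" "m differentiable (at w)" "heat s z differentiable (at w)" "heat_e i s z differentiable (at w)"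
    "(\<lambda>w. w $ i) differentiable (at w)" "(\<lambda>w. w $ i * m w) differentiable (at w)" "(\<lambda>w. \<zeta> w * heat_e i s z w) differentiable (at w)" "(\<lambda>w. w $ i * m w * heat s z w) differentiable (at w)" for i w
    by (intro elem_smooth_differentiable elem_smooth.mult elem_smooth.coord \<zeta> m es heat_elem_smooth)+
  have "partial_deriv i (partial_deriv i (\<lambda>w. \<zeta> w * heat s z w)) w + al i / w $ i * partial_deriv i (\<lambda>w. \<zeta> w * heat s z w) w =
     \<zeta> w * heat_si i s z w + (2 * w $ i * m w * heat_e i s z w + (m w + w $ i * partial_deriv i m w + al i * m w) * heat s z w)" for i
  proof -
    have p: "partial_deriv i (partial_deriv i (\<lambda>w. \<zeta> w * heat s z w)) w =
      \<zeta> w * heat_ee i s z w + w $ i * m w * heat_e i s z w + (w $ i * m w * heat_e i s z w + (w $ i * partial_deriv i m w + m w) * heat s z w)"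
      unfolding partial_deriv_cutoff_heat[OF s] partial_deriv_add[OF d(7,8)] partial_deriv_mult[OF d(1,4)] partial_deriv_mult[OF d(6,3)] partial_deriv_mult[OF d(5,2)]
        partial_deriv_heat[OF s] partial_deriv_heat_e[OF s] partial_deriv_coord grad by simp
    \<comment> \<open>For \<open>i \<in> Y\<close> the coordinate is positive on the orthant and
      cancels; otherwise \<open>al i = 0\<close>.\<close>
    have a: "al i / w $ i * (w $ i * m w * heat s z w) = al i * m w * heat s z w"
      using w by (cases "i \<in> Y") (auto simp: al_def orthant_def)
    show ?thesis
      unfolding p unfolding partial_deriv_cutoff_heat[OF s] distrib_left[of "al i / w $ i"] a heat_equation[OF s w, symmetric]
      by (simp add: algebra_simps)
  qed
  note i = this
  show ?thesis
    unfolding bessel_op_def heat_s_def commutator_def radial_op_def i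
    unfolding sum.distrib[of "\<lambda>i. \<zeta> w * heat_si i s z w"] sum.distrib[of "\<lambda>i. 2 * w $ i * m w * heat_e i s z w"]
      sum_distrib_left sum_distrib_right ..
qed

end

section \<open>Uniform bounds for products of one-variable kernels\<close>

text \<open>A single product and not a sum, so that bounds multiply over the coordinates and a
  partial derivative in \<open>z\<close> acts on one factor. Sums such as \<open>heat_s\<close> and
  \<open>commutator\<close> are handled termwise.\<close>

definition closed_kernel :: "(real \<Rightarrow> real^'d \<Rightarrow> real^'d \<Rightarrow> real) \<Rightarrow> bool" where
  "closed_kernel P \<longleftrightarrow> (\<exists>k. (\<forall>j. kerfun (j \<in> Y) (al j) (k j)) \<and> P = (\<lambda>s z w. \<Prod>j\<in>UNIV. k j s (z $ j) (w $ j)))"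

lemma closed_kernel_measurable:
  assumes P: "closed_kernel P" and [measurable]: "S \<in> borel_measurable \<mu>" "Z \<in> borel_measurable \<mu>" "W \<in> borel_measurable \<mu>"
  shows "(\<lambda>x. P (S x) (Z x) (W x)) \<in> borel_measurable \<mu>"
proof -
  obtain k where k: "\<And>j. kerfun (j \<in> Y) (al j) (k j)" "P = (\<lambda>s z w. \<Prod>j\<in>UNIV. k j s (z $ j) (w $ j))"
    using P unfolding closed_kernel_def by blast
  show ?thesis unfolding k(2) by (intro borel_measurable_prod B.kerfun_measurable[OF k(1)]) measurable
qed

lemma closed_kernel_bound:
  assumes "closed_kernel P"
  obtains C N where "0 \<le> C" "\<And>s z w. 0 < s \<Longrightarrow> z \<in> half_ball Y 1 \<Longrightarrow> w \<in> half_ball Y 1 \<Longrightarrow>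
     \<bar>P s z w\<bar> \<le> C * (1 + 1 / s) ^ N * exp (- (dist z w)\<^sup>2 / (4 * s))"
proof -
  obtain k where k: "\<And>j. kerfun (j \<in> Y) (al j) (k j)" "P = (\<lambda>s z w. \<Prod>j\<in>UNIV. k j s (z $ j) (w $ j))"
    using assms unfolding closed_kernel_def by blast
  have "\<exists>C N. 0 \<le> C \<and> (\<forall>s y \<eta>. 0 < s \<longrightarrow> (j \<in> Y \<longrightarrow> 0 \<le> y \<and> 0 \<le> \<eta>) \<longrightarrow> \<bar>y\<bar> \<le> 1 \<longrightarrow> \<bar>\<eta>\<bar> \<le> 1 \<longrightarrow>
            \<bar>k j s y \<eta>\<bar> \<le> C * (1 + 1 / s) ^ N * exp (- (y - \<eta>)\<^sup>2 / (4 * s)))" for j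
    by (rule B.kerfun_bound[OF k(1)])
  then obtain C N where C: "\<And>j. 0 \<le> C j" and N: "\<And>j s y \<eta>. 0 < s \<Longrightarrow> (j \<in> Y \<longrightarrow> 0 \<le> y \<and> 0 \<le> \<eta>) \<Longrightarrow> \<bar>y\<bar> \<le> 1 \<Longrightarrow> \<bar>\<eta>\<bar> \<le> 1 \<Longrightarrow>
            \<bar>k j s y \<eta>\<bar> \<le> C j * (1 + 1 / s) ^ (N j) * exp (- (y - \<eta>)\<^sup>2 / (4 * s))" by metis
  show ?thesis
  proof (rule that[of "\<Prod>j\<in>UNIV. C j" "\<Sum>j\<in>UNIV. N j"])
    show "0 \<le> (\<Prod>j\<in>UNIV. C j)" by (intro prod_nonneg) (use C in auto)
    fix s :: real and z w assume s: "0 < s" and z: "z \<in> half_ball Y 1" and w: "w \<in> half_ball Y 1"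
    have "\<bar>z $ j\<bar> \<le> 1" "\<bar>w $ j\<bar> \<le> 1" for j
      using z w component_le_norm_cart[of z j] component_le_norm_cart[of w j] by (auto simp: half_ball_def)
    moreover have "j \<in> Y \<longrightarrow> 0 \<le> z $ j \<and> 0 \<le> w $ j" for j using z w by (auto simp: half_ball_def less_imp_le)
    ultimately have "\<bar>P s z w\<bar> \<le> (\<Prod>j\<in>UNIV. C j * (1 + 1 / s) ^ (N j) * exp (- (z $ j - w $ j)\<^sup>2 / (4 * s)))"
      unfolding k(2) abs_prod by (intro prod_mono) (use N[OF s] in auto)
    also have "\<dots> = (\<Prod>j\<in>UNIV. C j) * (1 + 1 / s) ^ (\<Sum>j\<in>UNIV. N j) * exp (- (dist z w)\<^sup>2 / (4 * s))"
      unfolding prod.distrib dist_norm norm_sq_vec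
      by (simp add: power_sum exp_sum[symmetric] sum_negf sum_divide_distrib)
    finally show "\<bar>P s z w\<bar> \<le> (\<Prod>j\<in>UNIV. C j) * (1 + 1 / s) ^ (\<Sum>j\<in>UNIV. N j) * exp (- (dist z w)\<^sup>2 / (4 * s))" .
  qed
qed

text \<open>One term of the exponential series of \<open>c * (1 + x)\<close> controls the power. It
  is applied with \<open>x = 1 / s\<close>.\<close>

lemma power_exp_bounded:
  assumes c: "0 < (c::real)"
  obtains B where "\<And>x. 0 \<le> x \<Longrightarrow> (1 + x) ^ n * exp (- (c * x)) \<le> B"
proof -
  have "(1 + x) ^ n * exp (- (c * x)) \<le> fact n / c ^ n * exp c" if x: "0 \<le> x" for x
  proof -
    define t where "t = c * (1 + x)"
    have t: "0 \<le> t" using c x by (simp add: t_def)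
    have "(\<Sum>k\<in>{n}. t ^ k / fact k) \<le> (\<Sum>k. t ^ k / fact k)"
      using t summable_exp_generic[of t] by (intro sum_le_suminf) (auto simp: divide_inverse mult.commute)
    then have "t ^ n / fact n \<le> exp t" by (simp add: exp_def divide_inverse mult.commute)
    then have "t ^ n \<le> fact n * exp t" by (simp add: divide_le_eq mult.commute)
    moreover have "t ^ n = c ^ n * (1 + x) ^ n" unfolding t_def by (rule power_mult_distrib)
    moreover have "exp t = exp c * exp (c * x)" by (simp add: t_def distrib_left exp_add)
    ultimately have "c ^ n * (1 + x) ^ n \<le> fact n * (exp c * exp (c * x))" by simp
    then show ?thesis using c by (simp add: exp_minus field_simps)
  qed
  then show ?thesis using that by blast
qed

text \<open>Away from the diagonal the Gaussian outweighs all powers of \<open>1 / s\<close>, so the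
  bound is uniform down to \<open>s = 0\<close>. This is what makes the time integral converge
  together with all its derivatives in \<open>z\<close>.\<close>

lemma closed_kernel_bound_away:
  assumes P: "closed_kernel P" and \<delta>: "0 < \<delta>"
  obtains B where "0 \<le> B" "\<And>s z w. 0 < s \<Longrightarrow> z \<in> half_ball Y 1 \<Longrightarrow> w \<in> half_ball Y 1 \<Longrightarrow> \<delta> \<le> dist z w \<Longrightarrow> \<bar>P s z w\<bar> \<le> B"
proof -
  obtain C N where C: "0 \<le> C" and N: "\<And>s z w. 0 < s \<Longrightarrow> z \<in> half_ball Y 1 \<Longrightarrow> w \<in> half_ball Y 1 \<Longrightarrow>
     \<bar>P s z w\<bar> \<le> C * (1 + 1 / s) ^ N * exp (- (dist z w)\<^sup>2 / (4 * s))" by (rule closed_kernel_bound[OF P]) blast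
  obtain B where B: "\<And>x. 0 \<le> x \<Longrightarrow> (1 + x) ^ N * exp (- (\<delta>\<^sup>2 / 4 * x)) \<le> B"
    by (rule power_exp_bounded[of "\<delta>\<^sup>2 / 4" N]) (use \<delta> in auto)
  have B0: "0 \<le> B" using B[of 0] by simp
  have "\<bar>P s z w\<bar> \<le> C * B" if s: "0 < s" and zw: "z \<in> half_ball Y 1" "w \<in> half_ball Y 1" and d: "\<delta> \<le> dist z w" for s z w
  proof -
    have "\<delta>\<^sup>2 \<le> (dist z w)\<^sup>2" using d \<delta> by (intro power_mono) auto
    then have "exp (- (dist z w)\<^sup>2 / (4 * s)) \<le> exp (- (\<delta>\<^sup>2 / 4 * (1 / s)))"
      using s by (simp add: divide_right_mono)
    then have "(1 + 1 / s) ^ N * exp (- (dist z w)\<^sup>2 / (4 * s)) \<le> (1 + 1 / s) ^ N * exp (- (\<delta>\<^sup>2 / 4 * (1 / s)))"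
      using s by (intro mult_left_mono) auto
    also have "\<dots> \<le> B" using B[of "1 / s"] s by simp
    finally have "C * ((1 + 1 / s) ^ N * exp (- (dist z w)\<^sup>2 / (4 * s))) \<le> C * B" by (rule mult_left_mono[OF _ C])
    then show ?thesis using N[OF s zw] by (simp add: mult.assoc)
  qed
  then show ?thesis using that[of "C * B"] C B0 by simp
qed

lemma closed_kernel_bound_time:
  assumes P: "closed_kernel P" and s0: "0 < s0"
  obtains B where "0 \<le> B" "\<And>s z w. s0 \<le> s \<Longrightarrow> z \<in> half_ball Y 1 \<Longrightarrow> w \<in> half_ball Y 1 \<Longrightarrow> \<bar>P s z w\<bar> \<le> B"
proof -
  obtain C N where C: "0 \<le> C" and N: "\<And>s z w. 0 < s \<Longrightarrow> z \<in> half_ball Y 1 \<Longrightarrow> w \<in> half_ball Y 1 \<Longrightarrow>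
     \<bar>P s z w\<bar> \<le> C * (1 + 1 / s) ^ N * exp (- (dist z w)\<^sup>2 / (4 * s))" by (rule closed_kernel_bound[OF P]) blast
  have "\<bar>P s z w\<bar> \<le> C * (1 + 1 / s0) ^ N" if s: "s0 \<le> s" and zw: "z \<in> half_ball Y 1" "w \<in> half_ball Y 1" for s z w
  proof -
    have sp: "0 < s" using s s0 by simp
    have "(1 + 1 / s) ^ N \<le> (1 + 1 / s0) ^ N" using s s0 by (intro power_mono add_mono divide_left_mono) auto
    moreover have "exp (- (dist z w)\<^sup>2 / (4 * s)) \<le> 1" using sp by simp
    ultimately have "C * (1 + 1 / s) ^ N * exp (- (dist z w)\<^sup>2 / (4 * s)) \<le> C * (1 + 1 / s0) ^ N * 1"
      using C s0 sp by (intro mult_mono mult_left_mono) auto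
    then show ?thesis using N[OF sp zw] by simp
  qed
  then show ?thesis using that[of "C * (1 + 1 / s0) ^ N"] C s0 by simp
qed

text \<open>Factor \<open>j\<close> is differentiated as often as \<open>j\<close> occurs in the
  list of directions; each derivative is again a single product, so the bounds above apply to
  it.\<close>

lemma closed_kernel_family:
  assumes "closed_kernel P"
  obtains K where "K [] = P" "\<And>is. closed_kernel (K is)" "\<And>s w. 0 < s \<Longrightarrow> deriv_family UNIV (\<lambda>is z. K is s z w)"
proof -
  obtain k where k: "\<And>j. kerfun (j \<in> Y) (al j) (k j)" "P = (\<lambda>s z w. \<Prod>j\<in>UNIV. k j s (z $ j) (w $ j))"
    using assms unfolding closed_kernel_def by blast
  have "\<exists>F. F 0 = k j \<and> (\<forall>m. kerfun (j \<in> Y) (al j) (F m)) \<and>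
    (\<forall>m s y \<eta>. 0 < s \<longrightarrow> ((\<lambda>y. F m s y \<eta>) has_real_derivative F (Suc m) s y \<eta>) (at y))" for j
    by (rule B.kerfun_deriv_seq[OF k(1)[of j]]) blast
  then obtain F where F: "\<And>j. F j 0 = k j" "\<And>j m. kerfun (j \<in> Y) (al j) (F j m)"
    "\<And>j m s y \<eta>. 0 < s \<Longrightarrow> ((\<lambda>y. F j m s y \<eta>) has_real_derivative F j (Suc m) s y \<eta>) (at y)" by metis
  define K where "K = (\<lambda>is s z w. \<Prod>j\<in>UNIV. F j (count_list is j) s (z $ j) (w $ j))"
  show ?thesis
  proof (rule that[of K])
    show "K [] = P" by (simp add: K_def k(2) F(1))
    show "closed_kernel (K is)" for "is"
      unfolding closed_kernel_def K_def by (intro exI[of _ "\<lambda>j. F j (count_list is j)"] conjI allI F(2) refl)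
    show "deriv_family UNIV (\<lambda>is z. K is s z w)" if s: "0 < s" for s w
      unfolding deriv_family_def
    proof (intro allI ballI)
      fix "is" z
      have "((\<lambda>z. K is s z w) has_derivative (\<lambda>h. \<Sum>i\<in>UNIV. h $ i * (\<Prod>j\<in>UNIV. if j = i then F j (Suc (count_list is j)) s (z $ j) (w $ j) else F j (count_list is j) s (z $ j) (w $ j)))) (at z)"
        unfolding K_def by (rule has_derivative_prod_coord) (rule F(3)[OF s])
      moreover have "(\<Prod>j\<in>UNIV. if j = i then F j (Suc (count_list is j)) s (z $ j) (w $ j) else F j (count_list is j) s (z $ j) (w $ j)) = K (i # is) s z w" for i
        unfolding K_def by (intro prod.cong) auto
      ultimately show "((\<lambda>z. K is s z w) has_derivative (\<lambda>h. \<Sum>i\<in>UNIV. h $ i * K (i # is) s z w)) (at z)" by simp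
    qed
  qed
qed

lemma closed_kernel_heat: "closed_kernel heat"
  unfolding closed_kernel_def heat_def[abs_def] by (intro exI[of _ hk] conjI allI B.kerfun_heat1 refl)

lemma closed_kernel_heat_e: "closed_kernel (heat_e i)"
  unfolding closed_kernel_def heat_e_def[abs_def]
  by (intro exI[of _ "\<lambda>j. if j = i then B.heat1_e j else hk j"] conjI allI refl) (auto simp: B.kerfun_heat1 B.kerfun_heat1_e)

lemma closed_kernel_heat_si: "closed_kernel (heat_si i)"
  unfolding closed_kernel_def heat_si_def[abs_def]
  by (intro exI[of _ "\<lambda>j. if j = i then B.heat1_s j else hk j"] conjI allI refl) (auto simp: B.kerfun_heat1 B.kerfun_heat1_s)

end

subsection \<open>Regularity\<close>


context bessel_weight
begin

lemma convex_half_ball: "convex (half_ball Y R)"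
proof -
  have "convex orthant"
    unfolding convex_def
  proof (intro ballI allI impI)
    fix x y :: "real^'d" and u v :: real
    assume xy: "x \<in> orthant" "y \<in> orthant" and uv: "0 \<le> u" "0 \<le> v" "u + v = 1"
    have "0 < u * x $ i + v * y $ i" if "i \<in> Y" for i
    proof (cases "u = 0")
      case True
      then show ?thesis using xy uv that by (simp add: orthant_def)
    next
      case False
      then show ?thesis using xy uv that
        by (intro add_pos_nonneg mult_pos_pos mult_nonneg_nonneg) (auto simp: orthant_def less_imp_le)
    qed
    then show "u *\<^sub>R x + v *\<^sub>R y \<in> orthant" by (simp add: orthant_def)
  qed
  then show ?thesis unfolding half_ball_eq by (intro convex_Int) auto
qed

lemma half_ball_mono: "R \<le> R' \<Longrightarrow> half_ball Y R \<subseteq> half_ball Y R'"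
  by (auto simp: half_ball_def)

abbreviation T :: "real measure" where "T \<equiv> restrict_space lborel {0<..1}"

lemma space_T: "space T = {0<..1}"
  by (simp add: space_restrict_space)

lemma integral_T: "(\<integral>s. f s \<partial>T) = (\<integral>s. indicator {0<..1} s * f s \<partial>lborel)" for f :: "real \<Rightarrow> real"
  by (subst integral_restrict_space) simp_all

lemma finite_measure_T: "finite_measure T"
  by (rule finite_measureI) (simp add: emeasure_restrict_space space_T)

lemma closed_kernel_measurable_T:
  assumes P: "closed_kernel P" and [measurable]: "c \<in> borel_measurable borel"
  shows "(\<lambda>s. \<integral>w. c w * P s z w \<partial>N) \<in> borel_measurable borel"
proof -
  have "(\<lambda>x. P (fst x) z (snd x)) \<in> borel_measurable (borel \<Otimes>\<^sub>M N)"
    by (rule closed_kernel_measurable[OF P]) measurable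
  then have [measurable]: "(\<lambda>(s, w). P s z w) \<in> borel_measurable (borel \<Otimes>\<^sub>M N)" by (simp add: case_prod_beta')
  show ?thesis by (rule N.borel_measurable_lebesgue_integral) measurable
qed

lemma closed_kernel_measurable_w: "closed_kernel P \<Longrightarrow> (\<lambda>w. P s z w) \<in> borel_measurable borel"
  by (rule closed_kernel_measurable) auto

text \<open>For the term of the representation at the fixed time 1, where the kernel and its
  derivatives are bounded even on the diagonal.\<close>

lemma near_family:
  assumes P: "closed_kernel P" and c: "integrable N c" "\<And>w. w \<notin> half_ball Y 1 \<Longrightarrow> c w = 0" and r: "r \<le> 1"
  shows "\<exists>K. K [] = (\<lambda>z. \<integral>w. c w * P 1 z w \<partial>N) \<and> deriv_family (half_ball Y r) K \<and> bounded_family (half_ball Y r) K"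
proof -
  obtain K where K: "K [] = P" "\<And>is. closed_kernel (K is)" "\<And>s w. 0 < s \<Longrightarrow> deriv_family UNIV (\<lambda>is z. K is s z w)"
    by (rule closed_kernel_family[OF P]) blast
  have "\<exists>B. 0 \<le> B \<and> (\<forall>s z w. 1 \<le> s \<longrightarrow> z \<in> half_ball Y 1 \<longrightarrow> w \<in> half_ball Y 1 \<longrightarrow> \<bar>K is s z w\<bar> \<le> B)" for "is"
    by (rule closed_kernel_bound_time[OF K(2) zero_less_one, of "is"]) blast
  then obtain B where B: "\<And>is. 0 \<le> B is" "\<And>is s z w. 1 \<le> s \<Longrightarrow> z \<in> half_ball Y 1 \<Longrightarrow> w \<in> half_ball Y 1 \<Longrightarrow> \<bar>K is s z w\<bar> \<le> B is" by metis
  have bnd: "\<bar>c w * K is 1 z w\<bar> \<le> \<bar>c w\<bar> * B is" if z: "z \<in> half_ball Y r" for z w "is"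
  proof (cases "w \<in> half_ball Y 1")
    case True
    then show ?thesis unfolding abs_mult using B(2)[of 1 z w "is"] z half_ball_mono[OF r] by (intro mult_left_mono) auto
  qed (simp add: c(2) B)
  note F = deriv_family_integral[where S="half_ball Y r" and \<mu>=N and K="\<lambda>is z w. c w * K is 1 z w" and g="\<lambda>is w. \<bar>c w\<bar> * B is", OF open_half_ball convex_half_ball]
  have f1: "deriv_family (half_ball Y r) (\<lambda>is z. c w * K is 1 z w)" for w
    using deriv_family_scale[OF K(3)[OF zero_less_one, of w], of "c w"] by (simp add: deriv_family_def)
  have f2: "(\<lambda>w. c w * K is 1 z w) \<in> borel_measurable N" for "is" z
    using borel_measurable_integrable[OF c(1)] closed_kernel_measurable_w[OF K(2)] by (intro borel_measurable_times) (auto simp: borel_measurable_N)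
  have f3: "integrable N (\<lambda>w. \<bar>c w\<bar> * B is)" for "is" using c(1) by auto
  show ?thesis
    by (intro exI[of _ "\<lambda>is z. \<integral>w. c w * K is 1 z w \<partial>N"] conjI F f1 f2 f3 bnd) (simp_all add: K(1))
qed

text \<open>\<open>c\<close> lives where \<open>norm w \<ge> \<rho>1\<close> and \<open>z\<close>
  satisfies \<open>norm z < r\<close>, so the kernels are only seen at distance at least
  \<open>\<rho>1 - r\<close> from the diagonal, with bounds uniform in time. Differentiation passes
  first under the \<open>w\<close>-integral, then under the time integral. The second conclusion
  serves integrability in \<open>s\<close> and the limit at \<open>s = 0\<close>.\<close>

lemma far_family:
  assumes P: "closed_kernel P" and c: "integrable N c" "\<And>w. w \<notin> half_ball Y 1 \<Longrightarrow> c w = 0" and r: "r < \<rho>1" "r \<le> 1"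
    and away: "\<And>w. norm w < \<rho>1 \<Longrightarrow> c w = 0"
  shows "\<exists>K. K [] = (\<lambda>z. \<integral>s. (\<integral>w. c w * P s z w \<partial>N) \<partial>T) \<and> deriv_family (half_ball Y r) K \<and> bounded_family (half_ball Y r) K"
    "\<exists>B. \<forall>z\<in>half_ball Y r. \<forall>s>0. \<bar>\<integral>w. c w * P s z w \<partial>N\<bar> \<le> B"
proof -
  interpret T: finite_measure T by (rule finite_measure_T)
  obtain K where K: "K [] = P" "\<And>is. closed_kernel (K is)" "\<And>s w. 0 < s \<Longrightarrow> deriv_family UNIV (\<lambda>is z. K is s z w)"
    by (rule closed_kernel_family[OF P]) blast
  have "\<exists>B. 0 \<le> B \<and> (\<forall>s z w. 0 < s \<longrightarrow> z \<in> half_ball Y 1 \<longrightarrow> w \<in> half_ball Y 1 \<longrightarrow> \<rho>1 - r \<le> dist z w \<longrightarrow> \<bar>K is s z w\<bar> \<le> B)" for "is"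
  proof -
    have d: "0 < \<rho>1 - r" using r by simp
    show ?thesis by (rule closed_kernel_bound_away[OF K(2) d, of "is"]) blast
  qed
  then obtain B where B: "\<And>is. 0 \<le> B is" "\<And>is s z w. 0 < s \<Longrightarrow> z \<in> half_ball Y 1 \<Longrightarrow> w \<in> half_ball Y 1 \<Longrightarrow> \<rho>1 - r \<le> dist z w \<Longrightarrow> \<bar>K is s z w\<bar> \<le> B is" by metis
  have bnd: "\<bar>c w * K is s z w\<bar> \<le> \<bar>c w\<bar> * B is" if z: "z \<in> half_ball Y r" and s: "0 < s" for s z w "is"
  proof (cases "w \<in> half_ball Y 1 \<and> \<rho>1 \<le> norm w")
    case True
    have "norm w \<le> norm z + dist z w" using norm_triangle_ineq2[of w z] by (simp add: dist_norm norm_minus_commute)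
    then have "\<rho>1 - r \<le> dist z w" using True z by (simp add: half_ball_def)
    then show ?thesis unfolding abs_mult using B(2)[OF s, of z w "is"] z half_ball_mono[OF r(2)] True by (intro mult_left_mono) auto
  next
    case False
    then have "c w = 0" using c(2) away by force
    then show ?thesis by simp
  qed
  have cm: "c \<in> borel_measurable borel" using borel_measurable_integrable[OF c(1)] by (simp add: borel_measurable_N)
  define G where "G = (\<lambda>is s z. \<integral>w. c w * K is s z w \<partial>N)"
  have f2: "(\<lambda>w. c w * K is s z w) \<in> borel_measurable N" for "is" s z
    using cm closed_kernel_measurable_w[OF K(2)] by (intro borel_measurable_times) (auto simp: borel_measurable_N)
  have f3: "integrable N (\<lambda>w. \<bar>c w\<bar> * B is)" for "is" using c(1) by auto
  have inner: "deriv_family (half_ball Y r) (\<lambda>is z. G is s z)" if s: "0 < s" for s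
    unfolding G_def
  proof (rule deriv_family_integral(1)[where g="\<lambda>is w. \<bar>c w\<bar> * B is", OF open_half_ball convex_half_ball])
    show "deriv_family (half_ball Y r) (\<lambda>is z. c w * K is s z w)" for w
      using deriv_family_scale[OF K(3)[OF s, of w], of "c w"] by (simp add: deriv_family_def)
  qed (use f2 f3 bnd s in auto)
  have Gb: "\<bar>G is s z\<bar> \<le> (\<integral>w. \<bar>c w\<bar> * B is \<partial>N)" if "z \<in> half_ball Y r" "0 < s" for "is" s z
  proof -
    have "integrable N (\<lambda>w. c w * K is s z w)"
      by (rule Bochner_Integration.integrable_bound[OF f3[of "is"] f2]) (use bnd[OF that] B(1) in \<open>auto simp: abs_mult\<close>)
    then show ?thesis unfolding G_def
      by (intro order_trans[OF integral_abs_bound integral_mono] integrable_abs f3 bnd that)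
  qed
  note F = deriv_family_integral[where S="half_ball Y r" and \<mu>=T and K="\<lambda>is z s. G is s z" and g="\<lambda>is s. \<integral>w. \<bar>c w\<bar> * B is \<partial>N", OF open_half_ball convex_half_ball]
  have g1: "deriv_family (half_ball Y r) (\<lambda>is z. G is s z)" if "s \<in> space T" for s
    using inner that by (simp add: space_T)
  have g2: "(\<lambda>s. G is s z) \<in> borel_measurable T" for "is" z
    unfolding G_def by (intro measurable_restrict_space1) (simp add: closed_kernel_measurable_T[OF K(2) cm])
  have g3: "integrable T (\<lambda>s. \<integral>w. \<bar>c w\<bar> * B is \<partial>N)" for "is" by simp
  have g4: "\<bar>G is s z\<bar> \<le> (\<integral>w. \<bar>c w\<bar> * B is \<partial>N)" if "z \<in> half_ball Y r" "s \<in> space T" for "is" s z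
    using Gb that by (simp add: space_T)
  show "\<exists>K. K [] = (\<lambda>z. \<integral>s. (\<integral>w. c w * P s z w \<partial>N) \<partial>T) \<and> deriv_family (half_ball Y r) K \<and> bounded_family (half_ball Y r) K"
    by (intro exI[of _ "\<lambda>is z. \<integral>s. G is s z \<partial>T"] conjI F g1 g2 g3 g4) (simp_all add: G_def K(1))
  show "\<exists>B. \<forall>z\<in>half_ball Y r. \<forall>s>0. \<bar>\<integral>w. c w * P s z w \<partial>N\<bar> \<le> B"
    using Gb[of _ _ "[]"] unfolding G_def K(1) by blast
qed

end


lemma elem_smooth_bounded_on_ball:
  fixes f :: "real^'d::finite \<Rightarrow> real"
  assumes "elem_smooth f"
  shows "\<exists>B\<ge>0. \<forall>w. norm w \<le> 1 \<longrightarrow> \<bar>f w\<bar> \<le> B"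
proof -
  have "bounded (f ` cball 0 1)"
    by (rule compact_imp_bounded[OF compact_continuous_image[OF elem_smooth_continuous[OF assms] compact_cball]])
  then obtain B where B: "\<forall>w\<in>cball 0 1. \<bar>f w\<bar> \<le> B" by (auto simp: bounded_iff)
  then have "0 \<le> B" by (metis abs_ge_zero centre_in_cball order_trans zero_le_one)
  then show ?thesis using B by auto
qed

section \<open>The representation formula for weak solutions\<close>

context bessel_weight
begin

context
  fixes U :: "real^'d \<Rightarrow> real" and \<zeta> m :: "real^'d \<Rightarrow> real" and r \<rho>1 \<rho>2 :: real
  assumes Um: "U \<in> borel_measurable borel" and U0: "\<And>z. z \<notin> half_ball Y 1 \<Longrightarrow> U z = 0" and intU: "integrable N U"
    and weak: "\<And>\<psi>. neumann_test \<psi> \<Longrightarrow> (\<integral>z. U z * bessel_op \<psi> z \<partial>N) = 0"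
    and \<zeta>: "elem_smooth \<zeta>" and m: "elem_smooth m" and grad: "\<And>i w. partial_deriv i \<zeta> w = w $ i * m w"
    and \<rho>: "0 < r" "r < \<rho>1" "\<rho>1 < \<rho>2" "\<rho>2 < 1"
    and \<zeta>1: "\<And>w. norm w \<le> \<rho>1 \<Longrightarrow> \<zeta> w = 1" and \<zeta>0: "\<And>w. \<rho>2 \<le> norm w \<Longrightarrow> \<zeta> w = 0" and m0: "\<And>w. norm w \<le> \<rho>1 \<Longrightarrow> m w = 0"
begin

lemma integrable_U_mult:
  assumes [measurable]: "f \<in> borel_measurable borel" and f: "\<And>w. w \<in> half_ball Y 1 \<Longrightarrow> \<bar>f w\<bar> \<le> B"
  shows "integrable N (\<lambda>w. U w * f w)"
proof (rule Bochner_Integration.integrable_bound[OF integrable_mult_right[OF intU, of "\<bar>B\<bar>"]])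
  show "AE w in N. norm (U w * f w) \<le> norm (\<bar>B\<bar> * U w)"
  proof (rule AE_I2)
    fix w
    show "norm (U w * f w) \<le> norm (\<bar>B\<bar> * U w)"
    proof (cases "w \<in> half_ball Y 1")
      case True
      then have "\<bar>f w\<bar> \<le> \<bar>B\<bar>" using f[OF True] by simp
      then show ?thesis by (simp add: abs_mult mult.commute[of "\<bar>B\<bar>"] mult_left_mono)
    qed (simp add: U0)
  qed
  show "(\<lambda>w. U w * f w) \<in> borel_measurable N"
    unfolding borel_measurable_N using Um by measurable
qed

lemma elem_smooth_measurable: "elem_smooth f \<Longrightarrow> f \<in> borel_measurable borel"
  by (intro borel_measurable_continuous_onI elem_smooth_continuous)

lemma radial_op_smooth: "elem_smooth (radial_op m)"
  unfolding radial_op_def[abs_def]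
  by (intro elem_smooth_sum elem_smooth.add elem_smooth.mult elem_smooth.const elem_smooth.coord elem_smooth_partial m finite)

lemma radial_op_zero: "norm w < \<rho>1 \<Longrightarrow> radial_op m w = 0"
proof -
  assume w: "norm w < \<rho>1"
  have "(m has_derivative (\<lambda>h. 0)) (at w)"
    by (rule has_derivative_transform_within_open[OF has_derivative_const, of "ball 0 \<rho>1"]) (use w m0 in auto)
  then have "partial_deriv i m w = 0" for i by (intro partial_deriv_eqI[where f'="\<lambda>i. 0"]) simp
  then show ?thesis using w m0 by (simp add: radial_op_def)
qed

lemma integrable_U_elem_smooth: "elem_smooth f \<Longrightarrow> integrable N (\<lambda>w. U w * f w)"
proof -
  assume f: "elem_smooth f"
  obtain B where "\<And>w. norm w \<le> 1 \<Longrightarrow> \<bar>f w\<bar> \<le> B" using elem_smooth_bounded_on_ball[OF f] by blast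
  then show ?thesis by (intro integrable_U_mult[where B=B] elem_smooth_measurable f) (auto simp: half_ball_def)
qed

lemma integrable_U_kernel:
  assumes P: "closed_kernel P" and f: "elem_smooth f" and s: "0 < s" and z: "z \<in> half_ball Y 1"
  shows "integrable N (\<lambda>w. U w * f w * P s z w)"
proof -
  obtain B where B: "0 \<le> B" "\<And>w. norm w \<le> 1 \<Longrightarrow> \<bar>f w\<bar> \<le> B" using elem_smooth_bounded_on_ball[OF f] by blast
  obtain C where C: "0 \<le> C" "\<And>t z w. s \<le> t \<Longrightarrow> z \<in> half_ball Y 1 \<Longrightarrow> w \<in> half_ball Y 1 \<Longrightarrow> \<bar>P t z w\<bar> \<le> C"
    by (rule closed_kernel_bound_time[OF P s]) blast
  have "integrable N (\<lambda>w. U w * (f w * P s z w))"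
  proof (rule integrable_U_mult)
    show "(\<lambda>w. f w * P s z w) \<in> borel_measurable borel"
      by (intro borel_measurable_times elem_smooth_measurable f closed_kernel_measurable_w P)
    show "\<bar>f w * P s z w\<bar> \<le> B * C" if "w \<in> half_ball Y 1" for w
      unfolding abs_mult using B C z that by (intro mult_mono) (auto simp: half_ball_def)
  qed
  then show ?thesis by (simp add: mult.assoc)
qed

definition J :: "real \<Rightarrow> real^'d \<Rightarrow> real" where "J s z = (\<integral>w. U w * \<zeta> w * heat s z w \<partial>N)"

text \<open>The integral of \<open>U\<close> against \<open>commutator\<close>, split so that each
  summand contains a single \<open>closed_kernel\<close> and falls under
  \<open>far_family\<close>.\<close>

definition source :: "real \<Rightarrow> real^'d \<Rightarrow> real" where
  "source s z = (\<Sum>i\<in>UNIV. \<integral>w. (U w * (2 * w $ i * m w)) * heat_e i s z w \<partial>N) + (\<integral>w. (U w * radial_op m w) * heat s z w \<partial>N)"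

lemma elem_smooth_coeff: "elem_smooth (\<lambda>w. 2 * w $ i * m w)"
  by (intro elem_smooth.mult elem_smooth.const elem_smooth.coord m)

lemma J_derivative:
  assumes s: "0 < s" and z: "z \<in> half_ball Y 1"
  shows "((\<lambda>s. J s z) has_real_derivative - source s z) (at s)"
proof -
  note ik = integrable_U_kernel[OF _ _ s z]
  have i1: "integrable N (\<lambda>w. U w * \<zeta> w * heat_s s z w)"
    unfolding heat_s_def sum_distrib_left
    by (intro Bochner_Integration.integrable_sum ik closed_kernel_heat_si \<zeta>)
  have i2: "integrable N (\<lambda>w. U w * commutator m s z w)"
    unfolding commutator_def distrib_left sum_distrib_left mult.assoc[symmetric]
    using ik[OF closed_kernel_heat_e elem_smooth_coeff] ik[OF closed_kernel_heat radial_op_smooth]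
    by (intro Bochner_Integration.integrable_add Bochner_Integration.integrable_sum) (simp_all add: mult.assoc)
  have gc: "(\<integral>w. U w * commutator m s z w \<partial>N) = source s z"
  proof -
    have "(\<integral>w. U w * commutator m s z w \<partial>N) = (\<integral>w. (\<Sum>i\<in>UNIV. (U w * (2 * w $ i * m w)) * heat_e i s z w) + (U w * radial_op m w) * heat s z w \<partial>N)"
      by (intro Bochner_Integration.integral_cong) (simp_all add: commutator_def distrib_left sum_distrib_left mult.assoc)
    then show ?thesis unfolding source_def
      using ik[OF closed_kernel_heat_e elem_smooth_coeff] ik[OF closed_kernel_heat radial_op_smooth] by simp
  qed
  have "0 = (\<integral>w. U w * bessel_op (\<lambda>w. \<zeta> w * heat s z w) w \<partial>N)"
    using weak[OF neumann_test_cutoff_heat[OF \<zeta> m grad _ \<rho>(4) \<zeta>0 s]] \<rho> by simp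
  also have "\<dots> = (\<integral>w. U w * \<zeta> w * heat_s s z w + U w * commutator m s z w \<partial>N)"
  proof (rule integral_cong_AE)
    have nt: "neumann_test (\<lambda>w. \<zeta> w * heat s z w)"
      using neumann_test_cutoff_heat[OF \<zeta> m grad _ \<rho>(4) \<zeta>0 s] \<rho> by simp
    show "(\<lambda>w. U w * bessel_op (\<lambda>w. \<zeta> w * heat s z w) w) \<in> borel_measurable N"
      unfolding borel_measurable_N by (rule bessel_op_bounded[OF nt]) (use Um in \<open>auto intro: borel_measurable_times\<close>)
    show "(\<lambda>w. U w * \<zeta> w * heat_s s z w + U w * commutator m s z w) \<in> borel_measurable N"
      using i1 i2 by (intro borel_measurable_add borel_measurable_integrable)
    show "AE w in N. U w * bessel_op (\<lambda>w. \<zeta> w * heat s z w) w = U w * \<zeta> w * heat_s s z w + U w * commutator m s z w"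
      using AE_N_orthant
      by eventually_elim (subst bessel_op_cutoff_heat[OF \<zeta> m grad _ \<rho>(4) \<zeta>0 s], use \<rho> in \<open>auto simp: distrib_left\<close>)
  qed
  also have "\<dots> = (\<integral>w. U w * \<zeta> w * heat_s s z w \<partial>N) + source s z"
    using i1 i2 gc by simp
  finally have val: "(\<integral>w. U w * \<zeta> w * heat_s s z w \<partial>N) = - source s z" by simp
  \<comment> \<open>Times stay above \<open>s / 2\<close>, where the time derivative of the kernel
    is bounded; this provides the dominating function for differentiating \<open>J\<close>.\<close>
  have "\<exists>C. \<forall>t w. s / 2 \<le> t \<longrightarrow> w \<in> half_ball Y 1 \<longrightarrow> \<bar>heat_si i t z w\<bar> \<le> C" for i
  proof -
    have s2: "0 < s / 2" using s by simp
    show ?thesis by (rule closed_kernel_bound_time[OF closed_kernel_heat_si s2, of i]) (use z in blast)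
  qed
  then obtain C where C: "\<And>i t w. s / 2 \<le> t \<Longrightarrow> w \<in> half_ball Y 1 \<Longrightarrow> \<bar>heat_si i t z w\<bar> \<le> C i" by metis
  have "((\<lambda>q. \<integral>w. U w * \<zeta> w * heat q z w \<partial>N) has_real_derivative (\<integral>w. U w * \<zeta> w * heat_s s z w \<partial>N)) (at s)"
  proof (rule has_real_derivative_integral[where c="s / 2" and d="2 * s" and g="\<lambda>w. \<bar>U w * \<zeta> w\<bar> * (\<Sum>i\<in>UNIV. \<bar>C i\<bar>)"])
    show "integrable N (\<lambda>w. U w * \<zeta> w * heat q z w)" if "s / 2 < q" for q
      using that s z by (intro integrable_U_kernel closed_kernel_heat \<zeta>) auto
    show "((\<lambda>q. U w * \<zeta> w * heat q z w) has_real_derivative U w * \<zeta> w * heat_s q z w) (at q)" if "s / 2 < q" for q w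
      using that s by (intro DERIV_cmult heat_deriv_s) auto
    show "(\<lambda>w. U w * \<zeta> w * heat_s s z w) \<in> borel_measurable N" using i1 by simp
    show "integrable N (\<lambda>w. \<bar>U w * \<zeta> w\<bar> * (\<Sum>i\<in>UNIV. \<bar>C i\<bar>))"
      using integrable_U_elem_smooth[OF \<zeta>] by (intro integrable_mult_left integrable_abs)
    show "\<bar>U w * \<zeta> w * heat_s q z w\<bar> \<le> \<bar>U w * \<zeta> w\<bar> * (\<Sum>i\<in>UNIV. \<bar>C i\<bar>)" if q: "s / 2 < q" for q w
    proof (cases "w \<in> half_ball Y 1")
      case True
      have "\<bar>heat_s q z w\<bar> \<le> (\<Sum>i\<in>UNIV. \<bar>C i\<bar>)"
        unfolding heat_s_def using C[OF _ True] q by (intro order_trans[OF sum_abs sum_mono]) (meson abs_ge_self less_imp_le order_trans)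
      then show ?thesis unfolding abs_mult[of "U w * \<zeta> w"] by (intro mult_left_mono) auto
    qed (simp add: U0)
  qed (use s in auto)
  then show ?thesis unfolding J_def val .
qed

definition V :: "real^'d \<Rightarrow> real" where "V z = J 1 z + (\<integral>s. source s z \<partial>T)"

lemma coeff_zero: 
  assumes "norm w < \<rho>1" shows "U w * (2 * w $ i * m w) = 0" "U w * radial_op m w = 0"
  using assms m0 radial_op_zero by auto

lemma coeff_outside:
  assumes "w \<notin> half_ball Y 1" shows "U w * x = 0"
  using U0 assms by simp

lemma r_le_1: "r \<le> 1" using \<rho> by simp

lemma source_measurable: "(\<lambda>s. source s z) \<in> borel_measurable borel"
  unfolding source_def
  by (intro borel_measurable_add borel_measurable_sum closed_kernel_measurable_T closed_kernel_heat_e closed_kernel_heat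
       borel_measurable_times Um elem_smooth_measurable elem_smooth_coeff radial_op_smooth)

lemma source_parts:
  shows "\<forall>i. \<exists>K. K [] = (\<lambda>z. \<integral>s. (\<integral>w. (U w * (2 * w $ i * m w)) * heat_e i s z w \<partial>N) \<partial>T) \<and> deriv_family (half_ball Y r) K \<and> bounded_family (half_ball Y r) K" (is ?A)
    and "\<forall>i. \<exists>B. \<forall>z\<in>half_ball Y r. \<forall>s>0. \<bar>\<integral>w. (U w * (2 * w $ i * m w)) * heat_e i s z w \<partial>N\<bar> \<le> B" (is ?B)
    and "\<exists>K. K [] = (\<lambda>z. \<integral>s. (\<integral>w. (U w * radial_op m w) * heat s z w \<partial>N) \<partial>T) \<and> deriv_family (half_ball Y r) K \<and> bounded_family (half_ball Y r) K" (is ?C)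
    and "\<exists>B. \<forall>z\<in>half_ball Y r. \<forall>s>0. \<bar>\<integral>w. (U w * radial_op m w) * heat s z w \<partial>N\<bar> \<le> B" (is ?D)
proof -
  note F = far_family[OF _ integrable_U_elem_smooth coeff_outside \<rho>(2) r_le_1]
  show ?A ?B by (intro allI, rule F[OF closed_kernel_heat_e elem_smooth_coeff]; simp add: coeff_zero)+
  show ?C ?D by (rule F[OF closed_kernel_heat radial_op_smooth]; simp add: coeff_zero)+
qed

lemma source_bound: "\<exists>B. \<forall>z\<in>half_ball Y r. \<forall>s>0. \<bar>source s z\<bar> \<le> B"
proof -
  obtain B where B: "\<And>i z s. z \<in> half_ball Y r \<Longrightarrow> 0 < s \<Longrightarrow> \<bar>\<integral>w. (U w * (2 * w $ i * m w)) * heat_e i s z w \<partial>N\<bar> \<le> B i"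
    using choice[OF source_parts(2)] by blast
  obtain B' where B': "\<And>z s. z \<in> half_ball Y r \<Longrightarrow> 0 < s \<Longrightarrow> \<bar>\<integral>w. (U w * radial_op m w) * heat s z w \<partial>N\<bar> \<le> B'"
    using source_parts(4) by blast
  have "\<bar>source s z\<bar> \<le> (\<Sum>i\<in>UNIV. B i) + B'" if "z \<in> half_ball Y r" "0 < s" for s z
    unfolding source_def by (intro order_trans[OF abs_triangle_ineq] add_mono order_trans[OF sum_abs sum_mono] B B' that)
  then show ?thesis by blast
qed

lemma integrable_T_bounded:
  assumes m: "f \<in> borel_measurable borel" and b: "\<And>s. 0 < s \<Longrightarrow> \<bar>f s\<bar> \<le> (B::real)"
  shows "integrable T f"
proof -
  interpret T: finite_measure T by (rule finite_measure_T)
  have "AE s in T. norm (f s) \<le> B"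
    by (rule AE_I2) (use b in \<open>simp add: space_T\<close>)
  moreover have "f \<in> borel_measurable T" by (intro measurable_restrict_space1) (simp add: m)
  ultimately show ?thesis by (rule T.integrable_const_bound)
qed

lemma V_family: "\<exists>K. (\<forall>z\<in>half_ball Y r. K [] z = V z) \<and> deriv_family (half_ball Y r) K \<and> bounded_family (half_ball Y r) K"
proof -
  let ?S = "half_ball Y r"
  obtain K0 where K0: "K0 [] = (\<lambda>z. \<integral>w. (U w * \<zeta> w) * heat 1 z w \<partial>N)" "deriv_family ?S K0" "bounded_family ?S K0"
    using near_family[OF closed_kernel_heat integrable_U_elem_smooth[OF \<zeta>] coeff_outside r_le_1] by blast
  obtain K1 where K1: "\<And>i. K1 i [] = (\<lambda>z. \<integral>s. (\<integral>w. (U w * (2 * w $ i * m w)) * heat_e i s z w \<partial>N) \<partial>T)" "\<And>i. deriv_family ?S (K1 i)" "\<And>i. bounded_family ?S (K1 i)"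
    using choice[OF source_parts(1)] by blast
  obtain K2 where K2: "K2 [] = (\<lambda>z. \<integral>s. (\<integral>w. (U w * radial_op m w) * heat s z w \<partial>N) \<partial>T)" "deriv_family ?S K2" "bounded_family ?S K2"
    using source_parts(3) by blast
  define K where "K = (\<lambda>is z. K0 is z + ((\<Sum>i\<in>UNIV. K1 i is z) + K2 is z))"
  have "deriv_family ?S K" unfolding K_def
    by (intro deriv_family_add deriv_family_sum K0 K1 K2 finite)
  moreover have "bounded_family ?S (\<lambda>is z. \<Sum>i\<in>UNIV. K1 i is z)"
  proof -
    obtain B where B: "\<And>i is z. z \<in> ?S \<Longrightarrow> \<bar>K1 i is z\<bar> \<le> B i is" using K1(3) unfolding bounded_family_def by metis
    have "\<bar>\<Sum>i\<in>UNIV. K1 i is z\<bar> \<le> (\<Sum>i\<in>UNIV. B i is)" if "z \<in> ?S" for "is" z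
      by (intro order_trans[OF sum_abs sum_mono] B that)
    then show ?thesis unfolding bounded_family_def by blast
  qed
  then have "bounded_family ?S K" unfolding K_def by (intro bounded_family_add K0 K2)
  moreover have "K [] z = V z" if z: "z \<in> ?S" for z
  proof -
    \<comment> \<open>The bounds make each summand of \<open>source\<close> integrable in time, so
      that the time integral may be split.\<close>
    obtain B where B: "\<And>i s. 0 < s \<Longrightarrow> \<bar>\<integral>w. (U w * (2 * w $ i * m w)) * heat_e i s z w \<partial>N\<bar> \<le> B i"
      using choice[OF source_parts(2)] z by blast
    obtain B' where B': "\<And>s. 0 < s \<Longrightarrow> \<bar>\<integral>w. (U w * radial_op m w) * heat s z w \<partial>N\<bar> \<le> B'"
      using source_parts(4) z by blast
    have i1: "integrable T (\<lambda>s. \<integral>w. (U w * (2 * w $ i * m w)) * heat_e i s z w \<partial>N)" for i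
      by (rule integrable_T_bounded[OF _ B])
         (intro closed_kernel_measurable_T closed_kernel_heat_e borel_measurable_times Um elem_smooth_measurable elem_smooth_coeff)
    have i2: "integrable T (\<lambda>s. \<integral>w. (U w * radial_op m w) * heat s z w \<partial>N)"
      by (rule integrable_T_bounded[OF _ B'])
         (intro closed_kernel_measurable_T closed_kernel_heat borel_measurable_times Um elem_smooth_measurable radial_op_smooth)
    show ?thesis
      unfolding K_def V_def J_def source_def K0(1) K1(1) K2(1) using i1 i2 by (simp add: Bochner_Integration.integral_sum)
  qed
  ultimately show ?thesis by blast
qed

text \<open>The fundamental theorem of calculus on the times from \<open>1 / (n + 1)\<close> to 1;
  the bound on \<open>source\<close>, uniform in time, lets the lower end tend to 0.\<close>

lemma J_limit:
  assumes z: "z \<in> half_ball Y r"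
  shows "(\<lambda>n. J (1 / real (Suc n)) z) \<longlonglongrightarrow> V z"
proof -
  have z1: "z \<in> half_ball Y 1" using z half_ball_mono[OF r_le_1] by blast
  obtain B where B: "\<And>s. 0 < s \<Longrightarrow> \<bar>source s z\<bar> \<le> B" using source_bound z by blast
  define e where "e = (\<lambda>n. 1 / real (Suc n))"
  have e: "0 < e n" "e n \<le> 1" for n by (auto simp: e_def)
  have eq: "J (e n) z = J 1 z + (\<integral>s. indicator {e n..1} s * source s z \<partial>T)" for n
  proof -
    have "((\<lambda>s. - source s z) has_integral (J 1 z - J (e n) z)) {e n..1}"
      by (rule fundamental_theorem_of_calculus[OF e(2)])
         (use e(1)[of n] in \<open>auto intro!: has_field_derivative_at_within J_derivative[OF _ z1] simp flip: has_real_derivative_iff_has_vector_derivative\<close>)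
    then have hk: "((\<lambda>s. source s z) has_integral (J (e n) z - J 1 z)) {e n..1}"
      by (auto dest: has_integral_neg)
    have "integrable lborel (\<lambda>s. indicator {e n..1} s *\<^sub>R B)"
      by (intro integrable_scaleR_left integrable_real_indicator) (simp_all add: e(2))
    then have si: "set_integrable lborel {e n..1} (\<lambda>s. source s z)"
      unfolding set_integrable_def
      by (rule Bochner_Integration.integrable_bound)
         (use source_measurable B e(1)[of n] in \<open>auto simp: indicator_def intro!: AE_I2 order_trans[OF B]\<close>)
    have "(\<integral>s. indicator {e n..1} s * source s z \<partial>T) = (LINT s:{e n..1}|lborel. source s z)"
      unfolding integral_T set_lebesgue_integral_def using e(1)[of n]
      by (intro Bochner_Integration.integral_cong) (auto simp: indicator_def)
    also have "\<dots> = J (e n) z - J 1 z"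
      using set_borel_integral_eq_integral(2)[OF si] hk by (simp add: integral_unique)
    finally show ?thesis by simp
  qed
  have "(\<lambda>n. \<integral>s. indicator {e n..1} s * source s z \<partial>T) \<longlonglongrightarrow> (\<integral>s. source s z \<partial>T)"
  proof (rule integral_dominated_convergence[where w="\<lambda>s. B"])
    show "integrable T (\<lambda>s. B)" by (rule integrable_T_bounded[where B="\<bar>B\<bar>"]) auto
    show "AE s in T. (\<lambda>n. indicator {e n..1} s * source s z) \<longlonglongrightarrow> source s z"
    proof (rule AE_I2)
      fix s assume "s \<in> space T"
      then have s: "0 < s" "s \<le> 1" by (auto simp: space_T)
      have "e \<longlonglongrightarrow> 0" unfolding e_def by real_asymp
      then have "\<forall>\<^sub>F n in sequentially. e n < s" using s by (intro order_tendstoD(2))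
      then have "\<forall>\<^sub>F n in sequentially. source s z = indicator {e n..1} s * source s z"
        by eventually_elim (use s in auto)
      then show "(\<lambda>n. indicator {e n..1} s * source s z) \<longlonglongrightarrow> source s z"
        by (rule Lim_transform_eventually[OF tendsto_const])
    qed
    show "AE s in T. norm (indicator {e n..1} s * source s z) \<le> B" for n
    proof (rule AE_I2)
      fix s assume "s \<in> space T"
      then have "\<bar>source s z\<bar> \<le> B" by (intro B) (auto simp: space_T)
      then show "norm (indicator {e n..1} s * source s z) \<le> B" by (auto simp: indicator_def)
    qed
    show "(\<lambda>s. source s z) \<in> borel_measurable T" by (intro measurable_restrict_space1) (simp add: source_measurable)
    show "(\<lambda>s. indicator {e n..1} s * source s z) \<in> borel_measurable T" for n
      by (intro measurable_restrict_space1) (use source_measurable in \<open>simp, measurable\<close>)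
  qed
  then have "(\<lambda>n. J 1 z + (\<integral>s. indicator {e n..1} s * source s z \<partial>T)) \<longlonglongrightarrow> J 1 z + (\<integral>s. source s z \<partial>T)"
    by (intro tendsto_intros)
  then show ?thesis unfolding V_def eq[symmetric] unfolding e_def .
qed

lemma J_measurable: "(\<lambda>z. J s z) \<in> borel_measurable N"
proof -
  have [measurable]: "U \<in> borel_measurable borel" "\<zeta> \<in> borel_measurable borel" using Um elem_smooth_measurable[OF \<zeta>] by auto
  have "(\<lambda>x. heat s (fst x) (snd x)) \<in> borel_measurable (N \<Otimes>\<^sub>M N)"
    by (rule heat_measurable) measurable
  then have [measurable]: "(\<lambda>(z, w). heat s z w) \<in> borel_measurable (N \<Otimes>\<^sub>M N)" by (simp add: case_prod_beta')
  show ?thesis unfolding J_def by (rule N.borel_measurable_lebesgue_integral) measurable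
qed

text \<open>\<open>U\<close> is merely integrable, so the approximate identity cannot be evaluated
  on it at a point. It is evaluated on the continuous functions \<open>\<zeta> * \<phi> k\<close>,
  and Schur's test carries the error in L^1. As \<open>J\<close> converges pointwise to
  \<open>V\<close>, Fatou's lemma turns smallness in L^1 into equality almost everywhere.\<close>

lemma V_eq_U:
  assumes \<phi>: "\<And>k::nat. smooth (\<phi> k)"
    and \<phi>U: "(\<lambda>k. \<integral>\<^sup>+z. ennreal (indicator (half_ball Y 1) z * \<bar>\<phi> k z - U z\<bar>) \<partial>N) \<longlonglongrightarrow> 0"
  shows "AE z in N. z \<in> half_ball Y r \<longrightarrow> V z = cmass * U z"
proof -
  let ?S = "half_ball Y r"
  let ?D = "half_ball Y 1"
  have SD: "?S \<subseteq> ?D" by (rule half_ball_mono[OF r_le_1])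
  define e where "e = (\<lambda>n. 1 / real (Suc n))"
  have e: "0 < e n" for n by (simp add: e_def)
  have er: "filterlim e (at_right 0) sequentially" unfolding e_def by real_asymp
  define X where "X = (\<lambda>n z. ennreal (indicator ?S z * \<bar>J (e n) z - cmass * U z\<bar>))"
  define \<epsilon> where "\<epsilon> = (\<lambda>k. \<integral>\<^sup>+z. ennreal (indicator ?D z * \<bar>\<phi> k z - U z\<bar>) \<partial>N)"
  obtain Z where Z: "0 \<le> Z" "\<And>w. norm w \<le> 1 \<Longrightarrow> \<bar>\<zeta> w\<bar> \<le> Z" using elem_smooth_bounded_on_ball[OF \<zeta>] by blast
  define f where "f = (\<lambda>k w. \<zeta> w * \<phi> k w)"
  define b where "b = (\<lambda>k n. \<integral>\<^sup>+z. ennreal (indicator ?S z * \<bar>(\<integral>w. f k w * heat (e n) z w \<partial>N) - cmass * f k z\<bar>) \<partial>N)"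
  have fc: "continuous_on UNIV (f k)" for k
    unfolding f_def by (intro continuous_on_mult elem_smooth_continuous[OF \<zeta>] smooth_continuous[OF \<phi>])
  have \<phi>m: "\<phi> k \<in> borel_measurable borel" for k by (intro borel_measurable_continuous_onI smooth_continuous \<phi>)
  have fm [measurable]: "f k \<in> borel_measurable borel" for k by (rule borel_measurable_continuous_onI[OF fc])
  have fM: "\<exists>M\<ge>0. \<forall>w. \<bar>f k w\<bar> \<le> M" for k
    by (rule bounded_of_compact_support[OF fc[of k], of \<rho>2]) (auto simp: f_def \<zeta>0)
  have fhm: "(\<lambda>z. \<integral>w. f k w * heat s z w \<partial>N) \<in> borel_measurable N" for k s
  proof -
    have "(\<lambda>x. heat s (fst x) (snd x)) \<in> borel_measurable (N \<Otimes>\<^sub>M N)"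
      by (rule heat_measurable) measurable
    then have [measurable]: "(\<lambda>(z, w). heat s z w) \<in> borel_measurable (N \<Otimes>\<^sub>M N)" by (simp add: case_prod_beta')
    show ?thesis by (rule N.borel_measurable_lebesgue_integral) measurable
  qed
  have indm: "indicator ?S \<in> borel_measurable N" "indicator ?D \<in> borel_measurable N"
    unfolding borel_measurable_N by (intro borel_measurable_indicator half_ball_sets)+
  have Nm: "U \<in> borel_measurable N" "f k \<in> borel_measurable N" "\<phi> k \<in> borel_measurable N" "\<zeta> \<in> borel_measurable N" for k
    unfolding borel_measurable_N using Um fm \<phi>m elem_smooth_measurable[OF \<zeta>] by auto
  note m = borel_measurable_times indm borel_measurable_abs borel_measurable_diff borel_measurable_const Nm fhm J_measurable measurable_compose[OF _ measurable_ennreal]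
  have Xm: "X n \<in> borel_measurable N" for n unfolding X_def by (intro m)
  \<comment> \<open>For fixed \<open>k\<close> this is the approximate identity for a bounded
    continuous function, integrated by dominated convergence over a set of finite measure.\<close>
  have blim: "b k \<longlonglongrightarrow> 0" for k
  proof -
    obtain M where M: "0 \<le> M" "\<And>w. \<bar>f k w\<bar> \<le> M" using fM[of k] by blast
    have bd: "\<bar>(\<integral>w. f k w * heat (e n) z w \<partial>N) - cmass * f k z\<bar> \<le> 2 * (cmass * M)" for n z
    proof -
      have "\<bar>\<integral>w. f k w * heat (e n) z w \<partial>N\<bar> \<le> (\<integral>w. M * heat (e n) z w \<partial>N)"
        using M by (intro order_trans[OF integral_abs_bound integral_mono] integrable_abs integrable_bounded_heat[OF fm M(2) e] integrable_mult_right integrable_heat[OF e])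
           (simp add: abs_mult heat_nonneg mult_right_mono)
      also have "\<dots> = cmass * M" by (simp add: integral_heat[OF e])
      finally have "\<bar>\<integral>w. f k w * heat (e n) z w \<partial>N\<bar> \<le> cmass * M" .
      moreover have "\<bar>cmass * f k z\<bar> \<le> cmass * M" using M cmass_pos by (simp add: abs_mult)
      ultimately show ?thesis by linarith
    qed
    have "(\<lambda>n. \<integral>\<^sup>+z. ennreal (indicator ?S z * \<bar>(\<integral>w. f k w * heat (e n) z w \<partial>N) - cmass * f k z\<bar>) \<partial>N) \<longlonglongrightarrow> (\<integral>\<^sup>+z. 0 \<partial>N)"
    proof (rule nn_integral_dominated_convergence[where w="\<lambda>z. ennreal (2 * (cmass * M)) * indicator ?S z"])
      show "(\<lambda>z. ennreal (indicator ?S z * \<bar>(\<integral>w. f k w * heat (e n) z w \<partial>N) - cmass * f k z\<bar>)) \<in> borel_measurable N" for n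
        by (intro m)
      show "(\<lambda>z. ennreal (2 * (cmass * M)) * indicator ?S z) \<in> borel_measurable N"
        by measurable
      show "AE z in N. ennreal (indicator ?S z * \<bar>(\<integral>w. f k w * heat (e n) z w \<partial>N) - cmass * f k z\<bar>) \<le> ennreal (2 * (cmass * M)) * indicator ?S z" for n
        using bd by (intro AE_I2) (auto simp: indicator_def intro!: ennreal_leI)
      have "emeasure N ?S \<le> emeasure N (ball 0 1)"
        using r_le_1 by (intro emeasure_mono) (auto simp: half_ball_def)
      then have "emeasure N ?S < \<infinity>" using emeasure_N_ball_finite[of 1] by (rule le_less_trans)
      then show "(\<integral>\<^sup>+z. ennreal (2 * (cmass * M)) * indicator ?S z \<partial>N) < \<infinity>"
        by (simp add: nn_integral_cmult_indicator ennreal_mult_less_top)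
      show "AE z in N. (\<lambda>n. ennreal (indicator ?S z * \<bar>(\<integral>w. f k w * heat (e n) z w \<partial>N) - cmass * f k z\<bar>)) \<longlonglongrightarrow> 0"
      proof (rule AE_I2)
        fix z
        show "(\<lambda>n. ennreal (indicator ?S z * \<bar>(\<integral>w. f k w * heat (e n) z w \<partial>N) - cmass * f k z\<bar>)) \<longlonglongrightarrow> 0"
        proof (cases "z \<in> ?S")
          case True
          have "((\<lambda>s. \<integral>w. f k w * heat s z w \<partial>N) \<longlongrightarrow> cmass * f k z) (at_right 0)"
            using True by (intro heat_approx_identity[OF fm M(2)]) (auto simp: half_ball_def less_imp_le intro: continuous_on_interior fc[unfolded continuous_on_eq_continuous_at[OF open_UNIV], rule_format])
          from filterlim_compose[OF this er] have "(\<lambda>n. (\<integral>w. f k w * heat (e n) z w \<partial>N) - cmass * f k z) \<longlonglongrightarrow> cmass * f k z - cmass * f k z"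
            by (intro tendsto_diff tendsto_const)
          then have "(\<lambda>n. \<bar>(\<integral>w. f k w * heat (e n) z w \<partial>N) - cmass * f k z\<bar>) \<longlonglongrightarrow> 0" by (simp add: tendsto_rabs_zero_iff)
          then have "(\<lambda>n. ennreal \<bar>(\<integral>w. f k w * heat (e n) z w \<partial>N) - cmass * f k z\<bar>) \<longlonglongrightarrow> ennreal 0" by (rule tendsto_ennrealI)
          then show ?thesis using True by simp
        qed simp
      qed
    qed simp
    then show ?thesis unfolding b_def by simp
  qed
  \<comment> \<open>The two places where \<open>U\<close> is replaced by \<open>\<phi> k\<close>:
    under the kernel, at the cost of the constant in Schur's test times the bound \<open>Z\<close>
    of the cutoff, and at the point itself, at the cost of \<open>cmass\<close>.\<close>
  define A where "A = ennreal cmass * ennreal Z + ennreal cmass"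
  have est: "(\<integral>\<^sup>+z. X n z \<partial>N) \<le> A * \<epsilon> k + b k n" for n k
  proof -
    obtain M where M: "0 \<le> M" "\<And>w. \<bar>f k w\<bar> \<le> M" using fM[of k] by blast
    define h where "h = (\<lambda>w. U w * \<zeta> w - f k w)"
    have hm: "h \<in> borel_measurable borel"
      unfolding h_def by (intro borel_measurable_diff borel_measurable_times Um fm elem_smooth_measurable \<zeta>)
    have "X n z \<le> ennreal \<bar>\<integral>w. h w * heat (e n) z w \<partial>N\<bar> + (ennreal (indicator ?S z * \<bar>(\<integral>w. f k w * heat (e n) z w \<partial>N) - cmass * f k z\<bar>) + ennreal cmass * ennreal (indicator ?D z * \<bar>\<phi> k z - U z\<bar>))" for z
    proof (cases "z \<in> ?S")
      case True
      then have zD: "z \<in> ?D" using SD by blast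
      have "norm z \<le> \<rho>1" using True \<rho> by (simp add: half_ball_def)
      then have f1: "f k z = \<phi> k z" by (simp add: f_def \<zeta>1)
      have hh: "(\<integral>w. h w * heat (e n) z w \<partial>N) = J (e n) z - (\<integral>w. f k w * heat (e n) z w \<partial>N)"
        unfolding h_def J_def left_diff_distrib
        by (rule Bochner_Integration.integral_diff[OF integrable_U_kernel[OF closed_kernel_heat \<zeta> e zD] integrable_bounded_heat[OF fm M(2) e]])
      have "\<bar>J (e n) z - cmass * U z\<bar> \<le> \<bar>\<integral>w. h w * heat (e n) z w \<partial>N\<bar> + (\<bar>(\<integral>w. f k w * heat (e n) z w \<partial>N) - cmass * f k z\<bar> + cmass * \<bar>\<phi> k z - U z\<bar>)"
      proof -
        have "cmass * \<bar>\<phi> k z - U z\<bar> = \<bar>cmass * f k z - cmass * U z\<bar>"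
          unfolding f1 right_diff_distrib[symmetric] abs_mult using cmass_pos by simp
        then show ?thesis unfolding hh by linarith
      qed
      then have "ennreal \<bar>J (e n) z - cmass * U z\<bar> \<le> ennreal (\<bar>\<integral>w. h w * heat (e n) z w \<partial>N\<bar> + (\<bar>(\<integral>w. f k w * heat (e n) z w \<partial>N) - cmass * f k z\<bar> + cmass * \<bar>\<phi> k z - U z\<bar>))"
        by (rule ennreal_leI)
      also have "\<dots> = ennreal \<bar>\<integral>w. h w * heat (e n) z w \<partial>N\<bar> + (ennreal \<bar>(\<integral>w. f k w * heat (e n) z w \<partial>N) - cmass * f k z\<bar> + ennreal cmass * ennreal \<bar>\<phi> k z - U z\<bar>)"
        using cmass_pos by (simp add: ennreal_plus ennreal_mult')
      finally show ?thesis using True zD by (simp add: X_def)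
    qed (simp add: X_def)
    then have "(\<integral>\<^sup>+z. X n z \<partial>N) \<le> (\<integral>\<^sup>+z. ennreal \<bar>\<integral>w. h w * heat (e n) z w \<partial>N\<bar> + (ennreal (indicator ?S z * \<bar>(\<integral>w. f k w * heat (e n) z w \<partial>N) - cmass * f k z\<bar>) + ennreal cmass * ennreal (indicator ?D z * \<bar>\<phi> k z - U z\<bar>)) \<partial>N)"
      by (intro nn_integral_mono)
    also have "\<dots> = (\<integral>\<^sup>+z. ennreal \<bar>\<integral>w. h w * heat (e n) z w \<partial>N\<bar> \<partial>N) + (b k n + ennreal cmass * \<epsilon> k)"
    proof -
      have hhm: "(\<lambda>z. \<integral>w. h w * heat (e n) z w \<partial>N) \<in> borel_measurable N"
      proof -
        note [measurable] = hm
        have "(\<lambda>x. heat (e n) (fst x) (snd x)) \<in> borel_measurable (N \<Otimes>\<^sub>M N)"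
          by (rule heat_measurable) measurable
        then have [measurable]: "(\<lambda>(z, w). heat (e n) z w) \<in> borel_measurable (N \<Otimes>\<^sub>M N)" by (simp add: case_prod_beta')
        show ?thesis by (rule N.borel_measurable_lebesgue_integral) measurable
      qed
      have m1: "(\<lambda>z. ennreal \<bar>\<integral>w. h w * heat (e n) z w \<partial>N\<bar>) \<in> borel_measurable N"
        "(\<lambda>z. ennreal (indicator ?S z * \<bar>(\<integral>w. f k w * heat (e n) z w \<partial>N) - cmass * f k z\<bar>)) \<in> borel_measurable N"
        "(\<lambda>z. ennreal (indicator ?D z * \<bar>\<phi> k z - U z\<bar>)) \<in> borel_measurable N"
        by (intro m hhm)+
      have m2: "(\<lambda>z. ennreal cmass * ennreal (indicator ?D z * \<bar>\<phi> k z - U z\<bar>)) \<in> borel_measurable N"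
        using m1(3) by measurable
      have m3: "(\<lambda>z. ennreal (indicator ?S z * \<bar>(\<integral>w. f k w * heat (e n) z w \<partial>N) - cmass * f k z\<bar>) + ennreal cmass * ennreal (indicator ?D z * \<bar>\<phi> k z - U z\<bar>)) \<in> borel_measurable N"
        using m1(2) m2 by measurable
      show ?thesis unfolding b_def \<epsilon>_def nn_integral_cmult[OF m1(3), symmetric] nn_integral_add[OF m1(2) m2, symmetric]
        by (rule nn_integral_add[OF m1(1) m3])
    qed
    also have "(\<integral>\<^sup>+z. ennreal \<bar>\<integral>w. h w * heat (e n) z w \<partial>N\<bar> \<partial>N) \<le> ennreal cmass * (\<integral>\<^sup>+w. ennreal \<bar>h w\<bar> \<partial>N)"
      by (rule heat_L1_contraction[OF hm e])
    also have "(\<integral>\<^sup>+w. ennreal \<bar>h w\<bar> \<partial>N) \<le> (\<integral>\<^sup>+w. ennreal Z * ennreal (indicator ?D w * \<bar>\<phi> k w - U w\<bar>) \<partial>N)"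
    proof (rule nn_integral_mono_AE, use AE_N_orthant in eventually_elim)
      case (elim w)
      have "\<bar>h w\<bar> \<le> Z * (indicator ?D w * \<bar>\<phi> k w - U w\<bar>)"
      proof (cases "norm w < 1")
        case True
        then have "\<bar>\<zeta> w\<bar> * \<bar>\<phi> k w - U w\<bar> \<le> Z * \<bar>\<phi> k w - U w\<bar>" using Z by (intro mult_right_mono) auto
        moreover have "\<bar>h w\<bar> = \<bar>\<zeta> w\<bar> * \<bar>\<phi> k w - U w\<bar>"
          unfolding h_def f_def abs_mult[symmetric] by (simp add: right_diff_distrib mult.commute abs_minus_commute)
        ultimately show ?thesis using True elim by (simp add: half_ball_eq)
      next
        case False
        then have "\<zeta> w = 0" using \<zeta>0 \<rho> by simp
        then show ?thesis using Z by (simp add: h_def f_def)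
      qed
      then show ?case using Z by (simp add: ennreal_mult'[symmetric] ennreal_leI)
    qed
    also have "(\<integral>\<^sup>+w. ennreal Z * ennreal (indicator ?D w * \<bar>\<phi> k w - U w\<bar>) \<partial>N) = ennreal Z * \<epsilon> k"
      unfolding \<epsilon>_def by (rule nn_integral_cmult) (intro m)
    finally show ?thesis by (simp add: A_def distrib_right mult.assoc add_ac add_mono mult_left_mono)
  qed
  \<comment> \<open>First \<open>n\<close> tends to infinity with \<open>k\<close> fixed, which
    removes \<open>b k n\<close>; then \<open>k\<close> tends to infinity.\<close>
  have "(\<integral>\<^sup>+z. liminf (\<lambda>n. X n z) \<partial>N) \<le> A * \<epsilon> k" for k
  proof -
    have "(\<integral>\<^sup>+z. liminf (\<lambda>n. X n z) \<partial>N) \<le> liminf (\<lambda>n. \<integral>\<^sup>+z. X n z \<partial>N)" by (rule nn_integral_liminf[OF Xm])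
    also have "\<dots> \<le> liminf (\<lambda>n. A * \<epsilon> k + b k n)" by (intro Liminf_mono always_eventually allI est)
    also have "\<dots> = A * \<epsilon> k + 0"
      by (intro lim_imp_Liminf tendsto_add tendsto_const blim) simp
    finally show ?thesis by simp
  qed
  moreover have "(\<lambda>k. A * \<epsilon> k) \<longlonglongrightarrow> A * 0"
    unfolding \<epsilon>_def by (intro ennreal_tendsto_cmult \<phi>U) (simp add: A_def ennreal_mult_less_top)
  ultimately have "(\<integral>\<^sup>+z. liminf (\<lambda>n. X n z) \<partial>N) \<le> A * 0"
    by (intro LIMSEQ_le_const[where X="\<lambda>k. A * \<epsilon> k"]) auto
  then have "(\<integral>\<^sup>+z. liminf (\<lambda>n. X n z) \<partial>N) = 0" by simp
  then have "AE z in N. liminf (\<lambda>n. X n z) = 0"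
    by (subst (asm) nn_integral_0_iff_AE) (use Xm in measurable)
  then show ?thesis
  proof eventually_elim
    case (elim z)
    show ?case
    proof
      assume z: "z \<in> ?S"
      have "(\<lambda>n. \<bar>J (e n) z - cmass * U z\<bar>) \<longlonglongrightarrow> \<bar>V z - cmass * U z\<bar>"
        unfolding e_def by (intro tendsto_intros J_limit[OF z])
      then have "(\<lambda>n. X n z) \<longlonglongrightarrow> ennreal \<bar>V z - cmass * U z\<bar>"
        unfolding X_def using z by (simp add: tendsto_ennrealI)
      then have "liminf (\<lambda>n. X n z) = ennreal \<bar>V z - cmass * U z\<bar>" by (intro lim_imp_Liminf) simp_all
      then show "V z = cmass * U z" using elim by simp
    qed
  qed
qed

lemma smooth_representative:
  assumes "\<And>k::nat. smooth (\<phi> k)"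
    and "(\<lambda>k. \<integral>\<^sup>+z. ennreal (indicator (half_ball Y 1) z * \<bar>\<phi> k z - U z\<bar>) \<partial>N) \<longlonglongrightarrow> 0"
  shows "\<exists>v \<in> C_infinity (half_ball Y r). AE z in lborel. z \<in> half_ball Y r \<longrightarrow> U z = v z"
proof -
  obtain K where K: "\<And>z. z \<in> half_ball Y r \<Longrightarrow> K [] z = V z" "deriv_family (half_ball Y r) K" "bounded_family (half_ball Y r) K"
    using V_family by blast
  define L where "L = (\<lambda>is z. 1 / cmass * K is z)"
  have "L [] \<in> C_infinity (half_ball Y r)"
    unfolding L_def
    by (rule deriv_family_C_infinity[OF open_half_ball convex_half_ball _ deriv_family_scale[OF K(2)] bounded_family_scale[OF K(3)]])
       (auto simp: half_ball_def)
  moreover have "AE z in lborel. z \<in> half_ball Y r \<longrightarrow> U z = L [] z"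
  proof -
    \<comment> \<open>Positivity of the weight on the half ball turns a statement almost everywhere
      for \<open>N\<close> into one for Lebesgue measure.\<close>
    have pos: "0 < ennreal (Wt z)" if "z \<in> half_ball Y r" for z
      using that unfolding Wt_def by (auto intro!: prod_pos simp: weight1_def half_ball_def)
    have "AE z in lborel. 0 < ennreal (Wt z) \<longrightarrow> z \<in> half_ball Y r \<longrightarrow> V z = cmass * U z"
      using V_eq_U[OF assms] unfolding N_def by (subst (asm) AE_density) auto
    then show ?thesis
      by eventually_elim (use pos K(1) cmass_pos in \<open>auto simp: L_def\<close>)
  qed
  ultimately show ?thesis by blast
qed

end

end


lemma (in bessel_weight) weak_solution_smooth:
  assumes ws: "weak_solution Y a u" and r: "0 < r" "r < 1"
  shows "\<exists>v \<in> C_infinity (half_ball Y r). AE z in lebesgue_on (half_ball Y r). u z = v z"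
proof -
  obtain U and \<phi> :: "nat \<Rightarrow> real^'d \<Rightarrow> real" where U: "U \<in> borel_measurable borel" "\<And>z. z \<notin> half_ball Y 1 \<Longrightarrow> U z = 0"
    "AE z in lebesgue_on (half_ball Y 1). u z = U z" "integrable N U" "\<And>k. smooth (\<phi> k)"
    "(\<lambda>k. \<integral>\<^sup>+z. ennreal (indicator (half_ball Y 1) z * \<bar>\<phi> k z - U z\<bar>) \<partial>N) \<longlonglongrightarrow> 0"
    "\<And>\<psi>. neumann_test \<psi> \<Longrightarrow> (\<integral>z. U z * bessel_op \<psi> z \<partial>N) = 0"
    by (rule weak_solution_imp[OF ws]) (rule that; assumption)
  \<comment> \<open>\<open>\<rho>1\<close> and \<open>\<rho>2\<close> divide the interval from
    \<open>r\<close> to 1 into thirds.\<close>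
  define \<rho>1 where "\<rho>1 = (2 * r + 1) / 3"
  define \<rho>2 where "\<rho>2 = (r + 2) / 3"
  have \<rho>: "r < \<rho>1" "\<rho>1 < \<rho>2" "\<rho>2 < 1" using r by (simp_all add: \<rho>1_def \<rho>2_def)
  obtain \<zeta> m :: "real^'d \<Rightarrow> real" where cut: "elem_smooth \<zeta>" "elem_smooth m" "\<And>i w. partial_deriv i \<zeta> w = w $ i * m w"
    "\<And>w. norm w \<le> \<rho>1 \<Longrightarrow> \<zeta> w = 1" "\<And>w. \<rho>2 \<le> norm w \<Longrightarrow> \<zeta> w = 0" "\<And>w. norm w \<le> \<rho>1 \<Longrightarrow> m w = 0"
    using radial_cutoff[of \<rho>1 \<rho>2] r \<rho> by auto
  obtain v where v: "v \<in> C_infinity (half_ball Y r)" "AE z in lborel. z \<in> half_ball Y r \<longrightarrow> U z = v z"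
    using smooth_representative[OF U(1,2,4,7) cut(1,2,3) r(1) \<rho> cut(4,5,6) U(5,6)] by blast
  have "AE z in lebesgue. z \<in> half_ball Y 1 \<longrightarrow> u z = U z"
    using U(3) by (subst (asm) AE_restrict_space_iff) auto
  moreover have "AE z in lebesgue. z \<in> half_ball Y r \<longrightarrow> U z = v z" by (rule AE_completion[OF v(2)])
  ultimately have "AE z in lebesgue. z \<in> half_ball Y r \<longrightarrow> u z = v z"
    by eventually_elim (use half_ball_mono[of r 1] r in auto)
  then have "AE z in lebesgue_on (half_ball Y r). u z = v z"
    by (subst AE_restrict_space_iff) auto
  then show ?thesis using v(1) by blast
qed

theorem theorem7p4:
  fixes Y :: "'d::finite set" and n :: nat and a :: "'d \<Rightarrow> real" and u :: "real^'d \<Rightarrow> real"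
  assumes "2 \<le> CARD('d)"
    and "card Y = n" and "1 \<le> n" and "n \<le> CARD('d)"
    and "\<forall>i\<in>Y. -1 < a i"
    and "weak_solution Y a u"
  shows "\<forall>r. 0 < r \<and> r < 1 \<longrightarrow>
           (\<exists>v \<in> C_infinity (half_ball Y r). AE z in lebesgue_on (half_ball Y r). u z = v z)"
proof -
  interpret bessel_weight Y a using assms(5) by unfold_locales auto
  show ?thesis using weak_solution_smooth[OF assms(6)] by blast
qed

end
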